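(* Let $p\in[1,\infty)$ and let $Q\in L_p(\mathcal M_2)$ be of the form $Q=\begin{pmatrix} q_1&q_2\\ q_2&-q_1\end{pmatrix}$ with real-valued $q_1,q_2\in L_p(0,1)$. Let $(\lambda_n)_{n\in\mathbb Z}$ be the eigenvalues of the Dirac operator $\mathcal A_1$, enumerated as described in the context. Then the norming constants $\alpha_n:=\|\mathbf c(\cdot,\lambda_n)\|_{\mathbb H}^{-2}$ have the asymptotics $$\alpha_n=1+e_n(g),\qquad n\in\mathbb Z,$$ for some $g\in L_p(0,1)$.
   Context: $\mathcal M_2$ is the algebra of $2\times2$ complex matrices with the operator norm; $L_p(\mathcal M_2):=L_p((0,1),\mathcal M_2)$; $\mathbb H:=L_2(0,1)\times L_2(0,1)$; $B=\begin{pmatrix}0&1\\-1&0\end{pmatrix}$; $\ell_Q\mathbf u:=B\mathbf u'+Q\mathbf u$. $\mathcal A_1$ is the selfadjoint operator in $\mathbb H$ acting as $\mathcal A_1\mathbf u=\ell_Q\mathbf u$ on $\{\mathbf u=(u_1,u_2)^{\mathrm t}: u_1,u_2\in\mathrm{AC}[0,1],\ \ell_Q\mathbf u\in\mathbb H,\ u_2(0)=u_1(1)=0\}$; its spectrum is simple and discrete. $e_n(g):=\int_0^1e^{-2\pi nix}g(x)\,dx$. The eigenvalues are enumerated in strictly increasing order so that $\lambda_n=\pi(n+\tfrac12)+e_n(g_1)$, $n\in\mathbb Z$, for some $g_1\in L_p(0,1)$ (such an enumeration exists). $\mathbf c(\cdot,\lambda)=(c_1,c_2)^{\mathrm t}$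 is the solution of $\ell_Q\mathbf u=\lambda\mathbf u$ with $c_1(0,\lambda)=1$, $c_2(0,\lambda)=0$. Functions in $L_p(0,1)$ may be complex-valued unless stated otherwise. *)

theory Defs
  imports "HOL-Analysis.Analysis"
begin

text \<open>Elements of $L_p$-spaces are represented by functions on the real line that are considered up
  to equality almost everywhere on $(0,1)$; values outside that interval are irrelevant.\<close>

abbreviation leb01 :: "real measure" where
  "leb01 \<equiv> lebesgue_on {0<..<1}"

definition Lp :: "real \<Rightarrow> (real \<Rightarrow> 'a::real_normed_vector) set" where
  "Lp p = {f. f \<in> borel_measurable leb01 \<and> integrable leb01 (\<lambda>x. norm (f x) powr p)}"

text \<open>The library norm on matrices is the Frobenius norm, hence the explicit operator norm.\<close>

definition Lp_M2 :: "real \<Rightarrow> (real \<Rightarrow> complex^2^2) set" where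
  "Lp_M2 p = {Q. Q \<in> borel_measurable leb01 \<and>
                 integrable leb01 (\<lambda>x. onorm (\<lambda>v. Q x *v v) powr p)}"

definition HH :: "(real \<Rightarrow> complex^2) set" where
  "HH = {u. (\<lambda>x. u x $ 1) \<in> Lp 2 \<and> (\<lambda>x. u x $ 2) \<in> Lp 2}"

definition HH_norm :: "(real \<Rightarrow> complex^2) \<Rightarrow> real" where
  "HH_norm u = sqrt ((LINT x|leb01. (norm (u x $ 1))\<^sup>2) + (LINT x|leb01. (norm (u x $ 2))\<^sup>2))"

definition AC01 :: "(real \<Rightarrow> complex) set" where
  "AC01 = {f. \<forall>\<epsilon>>0. \<exists>\<delta>>0. \<forall>(n::nat) a b.
      (\<forall>k<n. 0 \<le> a k \<and> a k \<le> b k \<and> b k \<le> 1) \<and>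
      disjoint_family_on (\<lambda>k. {a k<..<b k}) {..<n} \<and>
      (\<Sum>k<n. b k - a k) < \<delta>
      \<longrightarrow> (\<Sum>k<n. norm (f (b k) - f (a k))) < \<epsilon>}"

definition fourier_coeff :: "int \<Rightarrow> (real \<Rightarrow> complex) \<Rightarrow> complex" where
  "fourier_coeff n g = (LINT x|leb01. exp (- 2 * of_real pi * of_int n * \<i> * of_real x) * g x)"

definition dirac_B :: "complex^2^2" where
  "dirac_B = vector [vector [0, 1], vector [-1, 0]]"

text \<open>\<open>dirac_expr Q u f\<close> says that $\ell_Q u = B u' + Q u$ equals \<open>f\<close> almost everywhere on
  $(0,1)$. It is a relation because $u'$ exists only almost everywhere; it is used for
  absolutely continuous \<open>u\<close> only.\<close>

definition dirac_expr ::
  "(real \<Rightarrow> complex^2^2) \<Rightarrow> (real \<Rightarrow> complex^2) \<Rightarrow> (real \<Rightarrow> complex^2) \<Rightarrow> bool" where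
  "dirac_expr Q u f \<longleftrightarrow>
     (AE x in leb01. \<exists>u'. (u has_vector_derivative u') (at x) \<and> f x = dirac_B *v u' + Q x *v u x)"

definition dom_A1 :: "(real \<Rightarrow> complex^2^2) \<Rightarrow> (real \<Rightarrow> complex^2) set" where
  "dom_A1 Q = {u. (\<lambda>x. u x $ 1) \<in> AC01 \<and> (\<lambda>x. u x $ 2) \<in> AC01 \<and>
                  (\<exists>f\<in>HH. dirac_expr Q u f) \<and> u 0 $ 2 = 0 \<and> u 1 $ 1 = 0}"

definition eigenvalues_A1 :: "(real \<Rightarrow> complex^2^2) \<Rightarrow> complex set" where
  "eigenvalues_A1 Q = {z. \<exists>u\<in>dom_A1 Q. \<not> (AE x in leb01. u x = 0) \<and>
                                        dirac_expr Q u (\<lambda>x. z *s u x)}"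

text \<open>The enumeration of the eigenvalues; the asymptotics, with $e_n(g_1) \to 0$, pin down
  which eigenvalue gets the index 0.\<close>

definition eigenvalue_enum :: "real \<Rightarrow> (real \<Rightarrow> complex^2^2) \<Rightarrow> (int \<Rightarrow> real) \<Rightarrow> bool" where
  "eigenvalue_enum p Q lam \<longleftrightarrow>
     strict_mono lam \<and> range (\<lambda>n. complex_of_real (lam n)) = eigenvalues_A1 Q \<and>
     (\<exists>g\<^sub>1\<in>Lp p. \<forall>n. complex_of_real (lam n) = of_real (pi * (of_int n + 1/2)) + fourier_coeff n g\<^sub>1)"

definition is_sol_c :: "(real \<Rightarrow> complex^2^2) \<Rightarrow> complex \<Rightarrow> (real \<Rightarrow> complex^2) \<Rightarrow> bool" where
  "is_sol_c Q z u \<longleftrightarrow>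
     (\<lambda>x. u x $ 1) \<in> AC01 \<and> (\<lambda>x. u x $ 2) \<in> AC01 \<and>
     dirac_expr Q u (\<lambda>x. z *s u x) \<and> u 0 $ 1 = 1 \<and> u 0 $ 2 = 0"

text \<open>For integrable \<open>Q\<close> the solution exists and is unique on $[0,1]$; the choice affects only
  its values outside $[0,1]$.\<close>

definition sol_c :: "(real \<Rightarrow> complex^2^2) \<Rightarrow> complex \<Rightarrow> real \<Rightarrow> complex^2" where
  "sol_c Q z = (SOME u. is_sol_c Q z u)"

definition norming_constant :: "(real \<Rightarrow> complex^2^2) \<Rightarrow> real \<Rightarrow> real" where
  "norming_constant Q t = HH_norm (sol_c Q (of_real t)) powi (-2)"

end

theory Submission
  imports Defs
begin

text \<open>Write $q = q_2 - i q_1$ and let $u$ be the solution \<open>c\<close> at a real spectral parameter $\lambda$. The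
  proof rests on the observation that two quadratic quantities built from $u$,
  $P = |u_1|^2 + |u_2|^2$ and $D = e^{2 i \lambda x}\,\overline{(u_1 + i u_2)}\,(u_1 - i u_2)$,
  satisfy the \<^emph>\<open>linear\<close> system
  $P' = 2\,\mathrm{Re}(q e^{-2 i \lambda x} D)$, $D' = 2 \overline q e^{2 i \lambda x} P$ with
  $P(0) = D(0) = 1$ (\<open>solution_quadratic\<close>). Integrating $P$ over the interval gives
  $\|u\|^2 = 1 + 2\,\mathrm{Re}\, z$ with $z = \int_0^1 (1-t)\, q(t) e^{-2 i \lambda t} D(t)\,dt$
  (\<open>HH_norm_formula\<close>).

  The Picard series of the linear system represents
  $D(t) = 1 + \int d(t,s) e^{-2 i \lambda s}\,ds$ with a kernel that does not depend on $\lambda$, vanishes for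
  $|s| > 2$ and satisfies $|d(t,s)| \le h(s)$ with an integrable $h$ (\<open>solution_kernel\<close>). Hence $z$ is the
  Fourier transform, at $2\lambda$, of $(1-t)q(t)$ plus a function dominated by the convolution of $|q|$ with $h$.
  By Jensen's inequality, convolution with $L_1$ preserves $L_p$ (\<open>folded_Lp\<close>). If $\lambda$ were exactly
  $\pi(n + 1/2)$, then $z$ would thus be the $n$-th Fourier coefficient of an $L_p$ function on the circle.

  For the eigenvalues one has $\lambda_n = \pi(n+1/2) + \epsilon_n$ with $\epsilon_n$ themselves the Fourier
  coefficients of an $L_p$ function. Sequences of Fourier coefficients of $L_1$ functions form an algebra in
  which norms are at hand, and those of $L_p$ functions form an ideal in it; so the power series of
  $e^{-2 i \epsilon_n s}$ in $\epsilon_n$ changes $z$ only by $\epsilon_n$ times an element of the algebra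
  (\<open>Lp_coeffs_perturbed_frequency\<close>). Finally $\alpha_n = 1/(1 + a_n)$, where $a_n$ is the value of
  $2\,\mathrm{Re}\, z$ at $\lambda_n$, and Wiener's lemma for the circle
  (\<open>wiener_lemma\<close>) shows that $1/(1 + a_n)$ is again of the form $1 + s_n$ with $s$ in the algebra. Then
  $\alpha_n - 1 = -a_n (1 + s_n)$ lies in the ideal.\<close>

section \<open>Borel representatives and characters of the circle\<close>

definition chr :: "int \<Rightarrow> real \<Rightarrow> complex" where
  "chr n x = cis (- (2 * pi * of_int n * x))"

lemma norm_chr [simp]: "norm (chr n x) = 1"
  by (simp add: chr_def)

lemma chr_measurable [measurable]: "chr n \<in> borel_measurable borel"
proof -
  have "continuous_on UNIV (chr n)"
    unfolding chr_def by (intro continuous_intros)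
  then show ?thesis by (rule borel_measurable_continuous_onI)
qed

lemma chr_add: "chr n (x + y) = chr n x * chr n y"
  by (simp add: chr_def cis_mult algebra_simps)

lemma chr_minus: "chr n (- x) = cnj (chr n x)"
  by (simp add: chr_def cis_cnj)

lemma chr_of_int [simp]: "chr n (of_int k) = 1"
proof -
  have "- (2 * pi * of_int n * of_int k) = 2 * pi * of_int (- (n * k))" by simp
  then show ?thesis unfolding chr_def
    by (smt (verit, best) cis_multiple_2pi Ints_of_int)
qed

lemma chr_frac: "chr n (frac (x - s) + s) = chr n x"
proof -
  have "x = frac (x - s) + s + of_int \<lfloor>x - s\<rfloor>" by (simp add: frac_def)
  then show ?thesis by (metis chr_add chr_of_int mult.right_neutral)
qed

lemma exp_eq_chr: "exp (- 2 * of_real pi * of_int n * \<i> * of_real x) = chr n x"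
  by (simp add: chr_def cis_conv_exp algebra_simps)

lemma cnj_measurable [measurable (raw)]:
  "f \<in> borel_measurable M \<Longrightarrow> (\<lambda>x. cnj (f x)) \<in> borel_measurable M"
  by (rule borel_measurable_continuous_on[of cnj]) (auto intro!: continuous_intros)

lemma cis_comp_measurable [measurable (raw)]:
  "f \<in> borel_measurable M \<Longrightarrow> (\<lambda>x. cis (f x)) \<in> borel_measurable M"
  by (rule borel_measurable_continuous_on[of cis]) (auto intro!: continuous_intros)

lemma integral_leb01:
  fixes f :: "real \<Rightarrow> 'a::{banach, second_countable_topology}"
  assumes "f \<in> borel_measurable borel"
  shows "integral\<^sup>L leb01 f = (\<integral>x. indicator {0<..<1} x *\<^sub>R f x \<partial>lborel)"
  using assms by (subst integral_restrict_space) (auto intro!: integral_completion)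

lemma integrable_leb01:
  fixes f :: "real \<Rightarrow> 'a::{banach, second_countable_topology}"
  assumes "f \<in> borel_measurable borel"
  shows "integrable leb01 f \<longleftrightarrow> integrable lborel (\<lambda>x. indicator {0<..<1} x *\<^sub>R f x)"
  using assms by (subst integrable_restrict_space) (auto intro!: integrable_completion)

lemma borel_imp_leb01:
  assumes "f \<in> borel_measurable borel"
  shows "f \<in> borel_measurable leb01"
  using assms by (simp add: measurable_completion measurable_restrict_space1)

lemma borel_representative_real:
  fixes f :: "real \<Rightarrow> real"
  assumes "f \<in> borel_measurable leb01"
  obtains g where "g \<in> borel_measurable borel" "\<And>x. x \<notin> {0<..<1} \<Longrightarrow> g x = 0"
    "AE x in leb01. f x = g x"
proof -
  have "(\<lambda>x. indicator {0<..<1} x *\<^sub>R f x) \<in> borel_measurable lebesgue"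
    using assms by (simp add: borel_measurable_restrict_space_iff)
  then obtain g' where g': "g' \<in> borel_measurable lborel"
     "AE x in lborel. indicator {0<..<1} x *\<^sub>R f x = g' x"
    using completion_ex_borel_measurable_real by blast
  define g where "g = (\<lambda>x. indicator {0<..<1} x * g' x)"
  have "AE x in lebesgue. indicator {0<..<1} x *\<^sub>R f x = g' x"
    using g'(2) by (rule AE_completion)
  then have "AE x in leb01. f x = g x"
    by (subst AE_restrict_space_iff) (auto simp: g_def elim!: eventually_mono)
  moreover have "g \<in> borel_measurable borel"
    using g'(1) unfolding g_def by measurable
  ultimately show ?thesis by (intro that[of g]) (auto simp: g_def)
qed

lemma borel_representative:
  fixes f :: "real \<Rightarrow> complex"
  assumes "f \<in> borel_measurable leb01"
  obtains g where "g \<in> borel_measurable borel" "\<And>x. x \<notin> {0<..<1} \<Longrightarrow> g x = 0"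
    "AE x in leb01. f x = g x"
proof -
  obtain a where a: "a \<in> borel_measurable borel" "\<And>x. x \<notin> {0<..<1} \<Longrightarrow> a x = 0"
    "AE x in leb01. Re (f x) = a x"
    using borel_representative_real[of "\<lambda>x. Re (f x)"] assms by auto
  obtain b where b: "b \<in> borel_measurable borel" "\<And>x. x \<notin> {0<..<1} \<Longrightarrow> b x = 0"
    "AE x in leb01. Im (f x) = b x"
    using borel_representative_real[of "\<lambda>x. Im (f x)"] assms by auto
  show ?thesis
  proof (rule that[of "\<lambda>x. Complex (a x) (b x)"])
    have "(\<lambda>x. of_real (a x) + \<i> * of_real (b x)) \<in> borel_measurable borel"
      using a(1) b(1) by measurable
    then show "(\<lambda>x. Complex (a x) (b x)) \<in> borel_measurable borel"
      by (simp add: Complex_eq)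
    show "AE x in leb01. f x = Complex (a x) (b x)"
      using a(3) b(3) by eventually_elim (simp add: complex_eq_iff)
  qed (use a b in \<open>auto simp: complex_eq_iff\<close>)
qed

lemma frac_measurable [measurable]: "frac \<in> borel_measurable (borel :: real measure)"
  unfolding frac_def[abs_def] by measurable

text \<open>Rotation invariance of Lebesgue measure on the circle: after reducing $s$ modulo one, the
  rotation is two translations, one for each side of the cut.\<close>

lemma nn_integral_frac_shift:
  fixes f :: "real \<Rightarrow> ennreal"
  assumes [measurable]: "f \<in> borel_measurable borel"
  shows "(\<integral>\<^sup>+x. indicator {0<..<1} x * f (frac (x - s)) \<partial>lborel)
       = (\<integral>\<^sup>+x. indicator {0<..<1} x * f x \<partial>lborel)"
proof -
  define r where "r = frac s"
  have r: "0 \<le> r" "r < 1" by (auto simp: r_def frac_lt_1)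
  have fr: "frac (x - s) = (if r \<le> x then x - r else x - r + 1)" if "x \<in> {0<..<1}" for x
  proof -
    have "frac (x - s) = frac (x - r)" unfolding r_def by (simp add: frac_diff_simp)
    also have "\<dots> = (if r \<le> x then x - r else x - r + 1)"
    proof (cases "r \<le> x")
      case True
      then show ?thesis using that r by (simp add: frac_eq)
    next
      case False
      have "frac (x - r) = frac (x - r + 1)" by (simp add: frac_1_eq)
      also have "\<dots> = x - r + 1" using that r False by (simp add: frac_eq)
      finally show ?thesis using False by simp
    qed
    finally show ?thesis .
  qed
  have "(\<integral>\<^sup>+x. indicator {0<..<1} x * f (frac (x - s)) \<partial>lborel)
      = (\<integral>\<^sup>+x. indicator {0<..<r} x * f (x - r + 1) + indicator {r..<1} x * f (x - r) \<partial>lborel)"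
    using AE_lborel_singleton[of 0] r
    by (intro nn_integral_cong_AE) (auto elim!: eventually_mono simp: fr indicator_def)
  also have "\<dots> = (\<integral>\<^sup>+x. indicator {0<..<r} x * f (x - r + 1) \<partial>lborel)
                + (\<integral>\<^sup>+x. indicator {r..<1} x * f (x - r) \<partial>lborel)"
    by (rule nn_integral_add) auto
  also have "(\<integral>\<^sup>+x. indicator {0<..<r} x * f (x - r + 1) \<partial>lborel)
           = (\<integral>\<^sup>+x. indicator {1-r<..<1} x * f x \<partial>lborel)"
    by (subst nn_integral_real_affine[where c=1 and t="r - 1"])
       (auto intro!: nn_integral_cong simp: indicator_def)
  also have "(\<integral>\<^sup>+x. indicator {r..<1} x * f (x - r) \<partial>lborel)
           = (\<integral>\<^sup>+x. indicator {0..<1-r} x * f x \<partial>lborel)"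
    by (subst nn_integral_real_affine[where c=1 and t="r"])
       (auto intro!: nn_integral_cong simp: indicator_def)
  also have "(\<integral>\<^sup>+x. indicator {1-r<..<1} x * f x \<partial>lborel) + (\<integral>\<^sup>+x. indicator {0..<1-r} x * f x \<partial>lborel)
    = (\<integral>\<^sup>+x. indicator {1-r<..<1} x * f x + indicator {0..<1-r} x * f x \<partial>lborel)"
    by (rule nn_integral_add[symmetric]) auto
  also have "\<dots> = (\<integral>\<^sup>+x. indicator {0<..<1} x * f x \<partial>lborel)"
    using AE_lborel_singleton[of 0] AE_lborel_singleton[of "1-r"] r
    by (intro nn_integral_cong_AE) (auto elim!: eventually_elim2 simp: indicator_def)
  finally show ?thesis .
qed

lemma distr_frac_shift:
  "distr (density lborel (indicator {0<..<1})) borel (\<lambda>x. frac (x - s))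
   = density lborel (indicator {0<..<1::real})" (is "?L = ?R")
proof (rule measure_eqI)
  show "sets ?L = sets ?R" by simp
  fix A assume "A \<in> sets ?L"
  then have [measurable]: "A \<in> sets borel" by simp
  have "emeasure ?L A = (\<integral>\<^sup>+x. indicator {0<..<1} x * indicator A (frac (x - s)) \<partial>lborel)"
    by (subst nn_integral_indicator[symmetric], simp)
       (simp add: nn_integral_distr nn_integral_density del: nn_integral_indicator)
  also have "\<dots> = emeasure ?R A"
    by (simp add: nn_integral_frac_shift emeasure_density mult.commute)
  finally show "emeasure ?L A = emeasure ?R A" .
qed

lemma integral_frac_shift:
  fixes f :: "real \<Rightarrow> complex"
  assumes [measurable]: "f \<in> borel_measurable borel"
  shows "(\<integral>x. indicator {0<..<1} x *\<^sub>R f (frac (x - s)) \<partial>lborel)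
       = (\<integral>x. indicator {0<..<1} x *\<^sub>R f x \<partial>lborel)"
proof -
  let ?U = "density lborel (\<lambda>x. ennreal (indicator {0<..<1::real} x))"
  have U: "density lborel (indicator {0<..<1::real}) = ?U"
    by (intro density_cong) (auto simp: indicator_def)
  have "(\<integral>x. indicator {0<..<1} x *\<^sub>R f (frac (x - s)) \<partial>lborel) = (\<integral>x. f (frac (x - s)) \<partial>?U)"
    by (subst integral_density) auto
  also have "\<dots> = (\<integral>x. f x \<partial>distr ?U borel (\<lambda>x. frac (x - s)))"
    by (subst integral_distr) auto
  also have "\<dots> = (\<integral>x. f x \<partial>?U)" using distr_frac_shift[of s] unfolding U by simp
  also have "\<dots> = (\<integral>x. indicator {0<..<1} x *\<^sub>R f x \<partial>lborel)"
    by (subst integral_density) auto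
  finally show ?thesis .
qed

section \<open>Convolution on the circle\<close>

lemma ennreal_norm_integral_le:
  fixes f :: "'a \<Rightarrow> 'b::{banach, second_countable_topology}"
  shows "ennreal (norm (integral\<^sup>L M f)) \<le> (\<integral>\<^sup>+x. ennreal (norm (f x)) \<partial>M)"
  by (cases "integrable M f") (auto intro: integral_norm_bound_ennreal simp: not_integrable_integral_eq)

lemma integrable_lborel_pair_iff:
  fixes F :: "real \<times> real \<Rightarrow> 'b::{banach, second_countable_topology}"
  assumes [measurable]: "F \<in> borel_measurable (borel \<Otimes>\<^sub>M borel)"
  shows "integrable (lborel \<Otimes>\<^sub>M lborel) F \<longleftrightarrow> (\<integral>\<^sup>+x. \<integral>\<^sup>+y. ennreal (norm (F (x, y))) \<partial>lborel \<partial>lborel) < \<infinity>"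
proof -
  have "F \<in> borel_measurable (lborel \<Otimes>\<^sub>M lborel)" by measurable
  moreover have "(\<integral>\<^sup>+p. ennreal (norm (F p)) \<partial>(lborel \<Otimes>\<^sub>M lborel))
      = (\<integral>\<^sup>+x. \<integral>\<^sup>+y. ennreal (norm (F (x, y))) \<partial>lborel \<partial>lborel)"
    by (subst lborel.nn_integral_fst[symmetric]) auto
  ultimately show ?thesis by (simp add: integrable_iff_bounded)
qed

lemma nn_integral_lborel_pair:
  fixes F :: "real \<times> real \<Rightarrow> ennreal"
  assumes [measurable]: "F \<in> borel_measurable (borel \<Otimes>\<^sub>M borel)"
  shows "(\<integral>\<^sup>+p. F p \<partial>(lborel \<Otimes>\<^sub>M lborel)) = (\<integral>\<^sup>+x. \<integral>\<^sup>+y. F (x, y) \<partial>lborel \<partial>lborel)"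
  by (subst lborel.nn_integral_fst[symmetric]) auto

lemma nn_integral_swap:
  fixes F :: "real \<times> real \<Rightarrow> ennreal"
  assumes [measurable]: "F \<in> borel_measurable (borel \<Otimes>\<^sub>M borel)"
  shows "(\<integral>\<^sup>+y. \<integral>\<^sup>+x. F (x, y) \<partial>lborel \<partial>lborel) = (\<integral>\<^sup>+x. \<integral>\<^sup>+y. F (x, y) \<partial>lborel \<partial>lborel)"
  by (rule lborel_pair.Fubini') auto

lemma nn_integral_pair_frac_shift:
  fixes F :: "real \<times> real \<Rightarrow> ennreal"
  assumes [measurable]: "F \<in> borel_measurable (borel \<Otimes>\<^sub>M borel)"
  shows "(\<integral>\<^sup>+x. \<integral>\<^sup>+s. indicator {0<..<1} x * F (frac (x - s), s) \<partial>lborel \<partial>lborel)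
       = (\<integral>\<^sup>+t. \<integral>\<^sup>+s. indicator {0<..<1} t * F (t, s) \<partial>lborel \<partial>lborel)"
proof -
  have "(\<integral>\<^sup>+x. \<integral>\<^sup>+s. indicator {0<..<1} x * F (frac (x - s), s) \<partial>lborel \<partial>lborel)
      = (\<integral>\<^sup>+s. \<integral>\<^sup>+x. indicator {0<..<1} x * F (frac (x - s), s) \<partial>lborel \<partial>lborel)"
    by (rule nn_integral_swap[where F="\<lambda>(x,s). indicator {0<..<1} x * F (frac (x - s), s)",
          simplified, symmetric]) measurable
  also have "\<dots> = (\<integral>\<^sup>+s. \<integral>\<^sup>+t. indicator {0<..<1} t * F (t, s) \<partial>lborel \<partial>lborel)"
    by (intro nn_integral_cong nn_integral_frac_shift[where f="\<lambda>t. F (t, s)" for s]) measurable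
  also have "\<dots> = (\<integral>\<^sup>+t. \<integral>\<^sup>+s. indicator {0<..<1} t * F (t, s) \<partial>lborel \<partial>lborel)"
    by (rule nn_integral_swap[where F="\<lambda>(t,s). indicator {0<..<1} t * F (t, s)", simplified]) measurable
  finally show ?thesis .
qed

text \<open>For $F$ supported over $0 < t < 1$ this is the density, with respect to Lebesgue measure on the circle,
  of the push-forward of $F(t,s)\,dt\,ds$ under $(t,s) \mapsto t + s$ modulo one; for $F(t,s) = f(t) g(s)$ it is the
  convolution of the periodic extension of $f$ with $g$. Arbitrary $F$ are allowed because the
  kernels of the Volterra system below are not products.\<close>

definition folded :: "(real \<times> real \<Rightarrow> complex) \<Rightarrow> real \<Rightarrow> complex" where
  "folded F x = indicator {0<..<1} x *\<^sub>R (\<integral>s. F (frac (x - s), s) \<partial>lborel)"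

lemma folded_outside: "x \<notin> {0<..<1} \<Longrightarrow> folded F x = 0"
  by (simp add: folded_def)

lemma folded_measurable [measurable]:
  assumes [measurable]: "F \<in> borel_measurable (borel \<Otimes>\<^sub>M borel)"
  shows "folded F \<in> borel_measurable borel"
  unfolding folded_def[abs_def] by measurable

text \<open>Rotation invariance in the first variable, for each fixed value of the second one.\<close>

lemma folded_L1:
  assumes [measurable]: "F \<in> borel_measurable (borel \<Otimes>\<^sub>M borel)"
    and int: "integrable (lborel \<Otimes>\<^sub>M lborel) F"
    and supp: "\<And>t s. t \<notin> {0<..<1} \<Longrightarrow> F (t, s) = 0"
  shows "integrable (lborel \<Otimes>\<^sub>M lborel) (\<lambda>(x,s). indicator {0<..<1} x *\<^sub>R F (frac (x - s), s))"
    and "integrable lborel (folded F)"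
    and "(\<integral>x. norm (folded F x) \<partial>lborel) \<le> (\<integral>p. norm (F p) \<partial>(lborel \<Otimes>\<^sub>M lborel))"
proof -
  have nn: "(\<integral>\<^sup>+x. \<integral>\<^sup>+s. ennreal (norm (indicator {0<..<1} x *\<^sub>R F (frac (x - s), s))) \<partial>lborel \<partial>lborel)
      = (\<integral>\<^sup>+p. ennreal (norm (F p)) \<partial>(lborel \<Otimes>\<^sub>M lborel))"
  proof -
    have "(\<integral>\<^sup>+x. \<integral>\<^sup>+s. ennreal (norm (indicator {0<..<1} x *\<^sub>R F (frac (x - s), s))) \<partial>lborel \<partial>lborel)
       = (\<integral>\<^sup>+x. \<integral>\<^sup>+s. indicator {0<..<1} x * ennreal (norm (F (frac (x - s), s))) \<partial>lborel \<partial>lborel)"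
      by (intro nn_integral_cong) (auto simp: indicator_def)
    also have "\<dots> = (\<integral>\<^sup>+t. \<integral>\<^sup>+s. indicator {0<..<1} t * ennreal (norm (F (t, s))) \<partial>lborel \<partial>lborel)"
      by (rule nn_integral_pair_frac_shift[where F="\<lambda>p. ennreal (norm (F p))"]) measurable
    also have "\<dots> = (\<integral>\<^sup>+t. \<integral>\<^sup>+s. ennreal (norm (F (t, s))) \<partial>lborel \<partial>lborel)"
      using supp by (intro nn_integral_cong) (auto simp: indicator_def)
    also have "\<dots> = (\<integral>\<^sup>+p. ennreal (norm (F p)) \<partial>(lborel \<Otimes>\<^sub>M lborel))"
      by (subst nn_integral_lborel_pair) auto
    finally show ?thesis .
  qed
  have fin: "(\<integral>\<^sup>+p. ennreal (norm (F p)) \<partial>(lborel \<Otimes>\<^sub>M lborel))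
      = ennreal (\<integral>p. norm (F p) \<partial>(lborel \<Otimes>\<^sub>M lborel))"
    by (rule nn_integral_eq_integral) (use int in auto)
  show I: "integrable (lborel \<Otimes>\<^sub>M lborel) (\<lambda>(x,s). indicator {0<..<1} x *\<^sub>R F (frac (x - s), s))"
    by (subst integrable_lborel_pair_iff) (use nn fin in auto)
  have le: "(\<integral>\<^sup>+x. ennreal (norm (folded F x)) \<partial>lborel)
     \<le> ennreal (\<integral>p. norm (F p) \<partial>(lborel \<Otimes>\<^sub>M lborel))"
  proof -
    have "(\<integral>\<^sup>+x. ennreal (norm (folded F x)) \<partial>lborel)
      \<le> (\<integral>\<^sup>+x. \<integral>\<^sup>+s. ennreal (norm (indicator {0<..<1} x *\<^sub>R F (frac (x - s), s))) \<partial>lborel \<partial>lborel)"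
    proof (rule nn_integral_mono)
      fix x
      have "folded F x = (\<integral>s. indicator {0<..<1} x *\<^sub>R F (frac (x - s), s) \<partial>lborel)"
        by (simp add: folded_def)
      then show "ennreal (norm (folded F x))
        \<le> (\<integral>\<^sup>+s. ennreal (norm (indicator {0<..<1} x *\<^sub>R F (frac (x - s), s))) \<partial>lborel)"
        using ennreal_norm_integral_le by metis
    qed
    then show ?thesis using nn fin by simp
  qed
  show J: "integrable lborel (folded F)"
    unfolding integrable_iff_bounded using le by (auto simp: top_unique order_le_less_trans)
  have "ennreal (\<integral>x. norm (folded F x) \<partial>lborel) = (\<integral>\<^sup>+x. ennreal (norm (folded F x)) \<partial>lborel)"
    by (rule nn_integral_eq_integral[symmetric]) (use J in auto)
  with le show "(\<integral>x. norm (folded F x) \<partial>lborel) \<le> (\<integral>p. norm (F p) \<partial>(lborel \<Otimes>\<^sub>M lborel))"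
    by (subst ennreal_le_iff[symmetric]) (auto intro!: integral_nonneg_AE)
qed

text \<open>A character of the circle does not notice the reduction modulo one, so the Fourier coefficients of the
  push-forward are those of $F$ along $t + s$.\<close>

lemma folded_fourier:
  assumes [measurable]: "F \<in> borel_measurable (borel \<Otimes>\<^sub>M borel)"
    and int: "integrable (lborel \<Otimes>\<^sub>M lborel) F"
    and supp: "\<And>t s. t \<notin> {0<..<1} \<Longrightarrow> F (t, s) = 0"
  shows "(\<integral>x. chr n x * folded F x \<partial>lborel) = (\<integral>p. F p * chr n (fst p + snd p) \<partial>(lborel \<Otimes>\<^sub>M lborel))"
proof -
  define G where "G = (\<lambda>p. F p * chr n (fst p + snd p))"
  have G_meas [measurable]: "G \<in> borel_measurable (borel \<Otimes>\<^sub>M borel)"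
    unfolding G_def by measurable
  have nG: "norm (G p) = norm (F p)" for p by (simp add: G_def norm_mult)
  have G_int: "integrable (lborel \<Otimes>\<^sub>M lborel) G"
    by (rule Bochner_Integration.integrable_bound[OF int]) (auto simp: nG)
  have G_supp: "t \<notin> {0<..<1} \<Longrightarrow> G (t, s) = 0" for t s by (simp add: G_def supp)
  have "(\<integral>x. chr n x * folded F x \<partial>lborel)
      = (\<integral>x. (\<integral>s. indicator {0<..<1} x *\<^sub>R G (frac (x - s), s) \<partial>lborel) \<partial>lborel)"
  proof (rule Bochner_Integration.integral_cong[OF refl])
    fix x
    have "chr n x * folded F x = indicator {0<..<1} x *\<^sub>R (\<integral>s. chr n x * F (frac (x - s), s) \<partial>lborel)"
      by (simp add: folded_def)
    then show "chr n x * folded F x = (\<integral>s. indicator {0<..<1} x *\<^sub>R G (frac (x - s), s) \<partial>lborel)"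
      by (simp add: G_def chr_frac mult.commute)
  qed
  also have "\<dots> = (\<integral>s. (\<integral>x. indicator {0<..<1} x *\<^sub>R G (frac (x - s), s) \<partial>lborel) \<partial>lborel)"
    by (rule lborel_pair.Fubini_integral[symmetric])
       (use folded_L1(1)[OF G_meas G_int G_supp] in simp)
  also have "\<dots> = (\<integral>s. (\<integral>t. indicator {0<..<1} t *\<^sub>R G (t, s) \<partial>lborel) \<partial>lborel)"
    by (intro Bochner_Integration.integral_cong refl integral_frac_shift[where f="\<lambda>t. G (t, s)" for s]) measurable
  also have "\<dots> = (\<integral>s. (\<integral>t. G (t, s) \<partial>lborel) \<partial>lborel)"
    using G_supp by (intro Bochner_Integration.integral_cong refl) (auto simp: indicator_def)
  also have "\<dots> = (\<integral>p. G p \<partial>(lborel \<Otimes>\<^sub>M lborel))"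
    using lborel_pair.integral_snd[of "\<lambda>t s. G (t, s)"] G_int by simp
  finally show ?thesis by (simp add: G_def)
qed

text \<open>The graph of $y \mapsto y^p$ lies above its tangent; here this is Young's inequality for
  $a \cdot c^{p-1}$.\<close>

lemma powr_tangent:
  fixes a c p :: real
  assumes "1 \<le> p" "0 < c" "0 \<le> a"
  shows "c powr p + p * c powr (p - 1) * (a - c) \<le> a powr p"
proof (cases "p = 1")
  case True
  then show ?thesis using assms by simp
next
  case False
  then have p: "p > 1" using assms by simp
  define q where "q = p / (p - 1)"
  have q: "q > 1" "1/p + 1/q = 1" using p by (auto simp: q_def field_simps)
  have "a * c powr (p - 1) \<le> a powr p / p + (c powr (p - 1)) powr q / q"
    using p q assms by (intro Youngs_inequality) auto
  also have "(c powr (p - 1)) powr q = c powr p" using p by (simp add: powr_powr q_def)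
  finally have "p * (a * c powr (p - 1)) \<le> p * (a powr p / p + c powr p / q)"
    using p by (intro mult_left_mono) auto
  also have "\<dots> = a powr p + (p - 1) * c powr p"
    using p by (simp add: q_def field_simps)
  finally have "p * (a * c powr (p - 1)) \<le> a powr p + (p - 1) * c powr p" .
  moreover have "c powr (p - 1) * c = c powr p"
    using assms powr_mult_base[of c "p - 1"] by (simp add: mult.commute)
  ultimately show ?thesis by (simp add: algebra_simps)
qed

text \<open>Jensen's inequality for the finite measure $h(s)\,ds$. The right-hand side may be infinite.\<close>

lemma Jensen_powr:
  fixes g h :: "real \<Rightarrow> real" and p :: real
  assumes [measurable]: "g \<in> borel_measurable borel" "h \<in> borel_measurable borel"
    and p: "1 \<le> p" and g0: "\<And>s. 0 \<le> g s" and h0: "\<And>s. 0 \<le> h s" and h: "integrable lborel h"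
  shows "ennreal ((\<integral>s. g s * h s \<partial>lborel) powr p)
     \<le> ennreal ((\<integral>s. h s \<partial>lborel) powr (p - 1)) * (\<integral>\<^sup>+s. ennreal (g s powr p * h s) \<partial>lborel)"
proof -
  define I where "I = (\<integral>s. g s * h s \<partial>lborel)"
  define H where "H = (\<integral>s. h s \<partial>lborel)"
  have I0: "0 \<le> I" unfolding I_def by (rule integral_nonneg_AE) (simp add: g0 h0)
  have H0: "0 \<le> H" unfolding H_def by (rule integral_nonneg_AE) (simp add: h0)
  show ?thesis
  proof (cases "I = 0")
    case True
    then show ?thesis by (simp add: I_def)
  next
    case False
    then have I: "0 < I" using I0 by simp
    have gh: "integrable lborel (\<lambda>s. g s * h s)"
      using False not_integrable_integral_eq unfolding I_def by blast
    have H: "0 < H"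
    proof (rule ccontr)
      assume "\<not> 0 < H"
      then have "H = 0" using H0 by simp
      then have "AE s in lborel. h s = 0"
        using integral_nonneg_eq_0_iff_AE[OF h] h0 by (simp add: H_def)
      then have "AE s in lborel. g s * h s = 0" by eventually_elim simp
      then have "I = 0" unfolding I_def by (rule integral_eq_zero_AE)
      with False show False by simp
    qed
    define J where "J = (\<integral>\<^sup>+s. ennreal (g s powr p * h s) \<partial>lborel)"
    show ?thesis
    proof (cases "J = \<infinity>")
      case True
      then show ?thesis using H by (simp add: J_def H_def ennreal_mult_top)
    next
      case False
      have gp: "integrable lborel (\<lambda>s. g s powr p * h s)"
        unfolding integrable_iff_bounded using False h0 by (auto simp: J_def top.not_eq_extremum abs_mult)
      have J: "J = ennreal (\<integral>s. g s powr p * h s \<partial>lborel)"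
        unfolding J_def by (rule nn_integral_eq_integral[OF gp]) (simp add: h0)
      \<comment> \<open>The tangent at the mean value: its linear part integrates to zero.\<close>
      define c where "c = I / H"
      have c: "0 < c" using I H by (simp add: c_def)
      have "(\<integral>s. (c powr p - p * c powr (p - 1) * c) * h s + p * c powr (p - 1) * (g s * h s) \<partial>lborel)
          \<le> (\<integral>s. g s powr p * h s \<partial>lborel)"
      proof (rule integral_mono)
        fix s
        have "(c powr p + p * c powr (p - 1) * (g s - c)) * h s \<le> g s powr p * h s"
          using powr_tangent[OF p c g0] h0 by (intro mult_right_mono) auto
        then show "(c powr p - p * c powr (p - 1) * c) * h s + p * c powr (p - 1) * (g s * h s)
            \<le> g s powr p * h s" by (simp add: algebra_simps)
      qed (use h gh gp in auto)
      moreover have "(\<integral>s. (c powr p - p * c powr (p - 1) * c) * h s + p * c powr (p - 1) * (g s * h s) \<partial>lborel)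
         = (c powr p - p * c powr (p - 1) * c) * H + p * c powr (p - 1) * I"
        using h gh by (simp add: I_def H_def)
      moreover have "\<dots> = c powr p * H"
        using H by (simp add: c_def field_simps)
      ultimately have *: "c powr p * H \<le> (\<integral>s. g s powr p * h s \<partial>lborel)" by simp
      have "I powr p = (c * H) powr p" using H by (simp add: c_def)
      also have "\<dots> = c powr p * H powr p" using c H by (simp add: powr_mult)
      also have "H powr p = H powr (p - 1) * H"
        using H powr_mult_base[of H "p - 1"] by (simp add: mult.commute)
      finally have "I powr p \<le> H powr (p - 1) * (\<integral>s. g s powr p * h s \<partial>lborel)"
        using mult_left_mono[OF *, of "H powr (p - 1)"] by (simp add: mult_ac)
      then have "ennreal (I powr p) \<le> ennreal (H powr (p - 1)) * ennreal (\<integral>s. g s powr p * h s \<partial>lborel)"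
        by (subst ennreal_mult[symmetric]) (auto intro!: ennreal_leI integral_nonneg_AE simp: h0)
      then show ?thesis unfolding J[symmetric] by (simp add: I_def H_def J_def)
    qed
  qed
qed

text \<open>The Minkowski--Young inequality $\|g * h\|_p \le \|g\|_p \|h\|_1$: apply Jensen's inequality in $s$ for each $x$,
  then rotation invariance in $x$.\<close>

lemma folded_Lp:
  assumes [measurable]: "F \<in> borel_measurable (borel \<Otimes>\<^sub>M borel)"
    and [measurable]: "g \<in> borel_measurable borel" "h \<in> borel_measurable borel"
    and p: "1 \<le> p" and g0: "\<And>s. 0 \<le> g s" and h0: "\<And>s. 0 \<le> h s" and h: "integrable lborel h"
    and g: "integrable lborel (\<lambda>t. g t powr p)" and g1: "integrable lborel g"
    and F: "\<And>t s. norm (F (t, s)) \<le> g t * h s"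
  shows "integrable lborel (\<lambda>x. norm (folded F x) powr p)"
proof -
  define H where "H = (\<integral>s. h s \<partial>lborel)"
  have AE1: "AE x in lborel. indicator {0<..<1} x * (\<integral>\<^sup>+s. ennreal (g (frac (x - s)) * h s) \<partial>lborel) \<noteq> \<infinity>"
  proof (rule nn_integral_PInf_AE)
    have "(\<integral>\<^sup>+x. indicator {0<..<1} x * (\<integral>\<^sup>+s. ennreal (g (frac (x - s)) * h s) \<partial>lborel) \<partial>lborel)
      = (\<integral>\<^sup>+x. \<integral>\<^sup>+s. indicator {0<..<1} x * ennreal (g (frac (x - s)) * h s) \<partial>lborel \<partial>lborel)"
      by (intro nn_integral_cong nn_integral_cmult[symmetric]) measurable
    also have "\<dots> = (\<integral>\<^sup>+t. \<integral>\<^sup>+s. indicator {0<..<1} t * ennreal (g t * h s) \<partial>lborel \<partial>lborel)"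
      by (rule nn_integral_pair_frac_shift[where F="\<lambda>p. ennreal (g (fst p) * h (snd p))", simplified]) measurable
    also have "\<dots> \<le> (\<integral>\<^sup>+t. \<integral>\<^sup>+s. ennreal (g t) * ennreal (h s) \<partial>lborel \<partial>lborel)"
      using g0 h0 by (intro nn_integral_mono) (auto simp: indicator_def ennreal_mult)
    also have "\<dots> = (\<integral>\<^sup>+t. ennreal (g t) \<partial>lborel) * (\<integral>\<^sup>+s. ennreal (h s) \<partial>lborel)"
      by (simp add: nn_integral_cmult nn_integral_multc)
    also have "\<dots> < \<infinity>"
      using g1 h g0 h0 by (simp add: nn_integral_eq_integral ennreal_mult_less_top)
    finally show "(\<integral>\<^sup>+x. indicator {0<..<1} x * (\<integral>\<^sup>+s. ennreal (g (frac (x - s)) * h s) \<partial>lborel) \<partial>lborel) \<noteq> \<infinity>"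
      by simp
  qed measurable
  have "(\<integral>\<^sup>+x. ennreal (norm (folded F x) powr p) \<partial>lborel)
     \<le> (\<integral>\<^sup>+x. ennreal (H powr (p - 1)) *
            (\<integral>\<^sup>+s. indicator {0<..<1} x * ennreal (g (frac (x - s)) powr p * h s) \<partial>lborel) \<partial>lborel)"
  proof (rule nn_integral_mono_AE)
    show "AE x in lborel. ennreal (norm (folded F x) powr p) \<le> ennreal (H powr (p - 1)) *
            (\<integral>\<^sup>+s. indicator {0<..<1} x * ennreal (g (frac (x - s)) powr p * h s) \<partial>lborel)"
      using AE1
    proof eventually_elim
      fix x
      assume fin: "indicator {0<..<1} x * (\<integral>\<^sup>+s. ennreal (g (frac (x - s)) * h s) \<partial>lborel) \<noteq> \<infinity>"
      show "ennreal (norm (folded F x) powr p) \<le> ennreal (H powr (p - 1)) *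
            (\<integral>\<^sup>+s. indicator {0<..<1} x * ennreal (g (frac (x - s)) powr p * h s) \<partial>lborel)"
      proof (cases "x \<in> {0<..<1}")
        case False
        then show ?thesis by (simp add: folded_outside)
      next
        case True
        then have "(\<integral>\<^sup>+s. ennreal (g (frac (x - s)) * h s) \<partial>lborel) < \<infinity>"
          using fin by (simp add: top.not_eq_extremum)
        then have gi: "integrable lborel (\<lambda>s. g (frac (x - s)) * h s)"
          unfolding integrable_iff_bounded using g0 h0 by (auto simp: abs_mult)
        have "ennreal (norm (folded F x)) \<le> (\<integral>\<^sup>+s. ennreal (norm (F (frac (x - s), s))) \<partial>lborel)"
          using True by (simp add: folded_def ennreal_norm_integral_le)
        also have "\<dots> \<le> (\<integral>\<^sup>+s. ennreal (g (frac (x - s)) * h s) \<partial>lborel)"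
          using F by (intro nn_integral_mono ennreal_leI) auto
        also have "\<dots> = ennreal (\<integral>s. g (frac (x - s)) * h s \<partial>lborel)"
          by (rule nn_integral_eq_integral[OF gi]) (simp add: g0 h0)
        finally have "norm (folded F x) \<le> (\<integral>s. g (frac (x - s)) * h s \<partial>lborel)"
          by (subst (asm) ennreal_le_iff) (auto intro!: integral_nonneg_AE simp: g0 h0)
        then have "ennreal (norm (folded F x) powr p) \<le> ennreal ((\<integral>s. g (frac (x - s)) * h s \<partial>lborel) powr p)"
          using p by (intro ennreal_leI powr_mono2) auto
        also have "\<dots> \<le> ennreal (H powr (p - 1)) * (\<integral>\<^sup>+s. ennreal (g (frac (x - s)) powr p * h s) \<partial>lborel)"
          unfolding H_def by (rule Jensen_powr) (use p g0 h0 h in auto)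
        finally show ?thesis using True by simp
      qed
    qed
  qed
  also have "\<dots> = ennreal (H powr (p - 1)) *
        (\<integral>\<^sup>+x. \<integral>\<^sup>+s. indicator {0<..<1} x * ennreal (g (frac (x - s)) powr p * h s) \<partial>lborel \<partial>lborel)"
    by (rule nn_integral_cmult) measurable
  also have "(\<integral>\<^sup>+x. \<integral>\<^sup>+s. indicator {0<..<1} x * ennreal (g (frac (x - s)) powr p * h s) \<partial>lborel \<partial>lborel)
     = (\<integral>\<^sup>+t. \<integral>\<^sup>+s. indicator {0<..<1} t * ennreal (g t powr p * h s) \<partial>lborel \<partial>lborel)"
    by (rule nn_integral_pair_frac_shift[where F="\<lambda>q. ennreal (g (fst q) powr p * h (snd q))", simplified]) measurable
  also have "\<dots> \<le> (\<integral>\<^sup>+t. \<integral>\<^sup>+s. ennreal (g t powr p) * ennreal (h s) \<partial>lborel \<partial>lborel)"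
    using h0 by (intro nn_integral_mono) (auto simp: indicator_def ennreal_mult)
  also have "\<dots> = (\<integral>\<^sup>+t. ennreal (g t powr p) \<partial>lborel) * (\<integral>\<^sup>+s. ennreal (h s) \<partial>lborel)"
    by (simp add: nn_integral_cmult nn_integral_multc)
  finally have "(\<integral>\<^sup>+x. ennreal (norm (folded F x) powr p) \<partial>lborel)
     \<le> ennreal (H powr (p - 1)) * ((\<integral>\<^sup>+t. ennreal (g t powr p) \<partial>lborel) * (\<integral>\<^sup>+s. ennreal (h s) \<partial>lborel))"
    by (simp add: mult_left_mono)
  also have "\<dots> < \<infinity>"
    using g h h0 by (simp add: nn_integral_eq_integral ennreal_mult_less_top)
  finally show ?thesis unfolding integrable_iff_bounded by simp
qed

section \<open>The convolution algebra on the side of Fourier coefficients\<close>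

lemma fourier_coeff_eq_chr: "fourier_coeff n g = (\<integral>x. chr n x * g x \<partial>leb01)"
  unfolding fourier_coeff_def exp_eq_chr ..

lemma norm_le_powr:
  fixes y p :: real
  assumes "1 \<le> p" "0 \<le> y"
  shows "y \<le> 1 + y powr p"
proof (cases "y \<le> 1")
  case True
  then show ?thesis by (smt (verit) powr_ge_zero)
next
  case False
  then have "y powr 1 \<le> y powr p" using assms by (intro powr_mono) auto
  with False show ?thesis by simp
qed

lemma integrable_of_powr:
  fixes g :: "real \<Rightarrow> 'a::{banach, second_countable_topology}"
  assumes [measurable]: "g \<in> borel_measurable borel" and supp: "\<And>x. x \<notin> {0<..<1} \<Longrightarrow> g x = 0"
    and p: "1 \<le> p" and int: "integrable lborel (\<lambda>x. norm (g x) powr p)"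
  shows "integrable lborel g"
proof -
  have "integrable lborel (\<lambda>x. indicator {0<..<1} x + norm (g x) powr p)"
    using int by (intro Bochner_Integration.integrable_add) (auto intro: integrable_real_indicator)
  then show ?thesis
  proof (rule Bochner_Integration.integrable_bound)
    show "AE x in lborel. norm (g x) \<le> norm (indicator {0<..<1} x + norm (g x) powr p)"
      using norm_le_powr[OF p] supp by (intro AE_I2) (auto simp: indicator_def)
  qed measurable
qed

text \<open>Elements of $L_p$ are Lebesgue measurable on the interval only, whereas product measures and
  substitutions are handled with Borel functions on the whole line.\<close>

lemma Lp_representative:
  fixes f :: "real \<Rightarrow> complex"
  assumes "f \<in> Lp p" and p: "1 \<le> p"
  obtains g where "g \<in> borel_measurable borel" "\<And>x. x \<notin> {0<..<1} \<Longrightarrow> g x = 0"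
    "integrable lborel (\<lambda>x. norm (g x) powr p)" "integrable lborel g" "AE x in leb01. f x = g x"
proof -
  have f: "f \<in> borel_measurable leb01" "integrable leb01 (\<lambda>x. norm (f x) powr p)"
    using assms by (auto simp: Lp_def)
  obtain g where g: "g \<in> borel_measurable borel" "\<And>x. x \<notin> {0<..<1} \<Longrightarrow> g x = 0"
    "AE x in leb01. f x = g x" using borel_representative[OF f(1)] by blast
  note [measurable] = g(1)
  have "integrable leb01 (\<lambda>x. norm (g x) powr p)"
    using f(2) by (rule integrable_cong_AE_imp)
      (use g(3) in \<open>auto intro!: borel_imp_leb01 elim!: eventually_mono\<close>)
  then have "integrable lborel (\<lambda>x. indicator {0<..<1} x *\<^sub>R (norm (g x) powr p))"
    by (subst (asm) integrable_leb01) auto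
  moreover have "(\<lambda>x. indicator {0<..<1} x *\<^sub>R (norm (g x) powr p)) = (\<lambda>x. norm (g x) powr p)"
    using g(2) by (auto simp: indicator_def fun_eq_iff)
  ultimately have gp: "integrable lborel (\<lambda>x. norm (g x) powr p)" by simp
  show ?thesis by (rule that[OF g(1,2) gp integrable_of_powr[OF g(1,2) p gp] g(3)])
qed

lemma powr_add_le:
  fixes a b p :: real assumes "0 \<le> a" "0 \<le> b" "1 \<le> p"
  shows "(a + b) powr p \<le> 2 powr p * (a powr p + b powr p)"
proof -
  have "(a + b) powr p \<le> (2 * max a b) powr p" using assms by (intro powr_mono2) auto
  also have "\<dots> = 2 powr p * (max a b) powr p" using assms by (simp add: powr_mult)
  also have "(max a b) powr p \<le> a powr p + b powr p" by (auto simp: max_def)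
  finally show ?thesis by (simp add: mult_left_mono)
qed

lemma Lp_complex_combination:
  fixes q1 q2 :: "real \<Rightarrow> real"
  assumes p: "1 \<le> p" and q1: "q1 \<in> Lp p" and q2: "q2 \<in> Lp p"
  shows "(\<lambda>x. complex_of_real (q2 x) - \<i> * of_real (q1 x)) \<in> Lp p"
proof -
  have m [measurable]: "q1 \<in> borel_measurable leb01" "q2 \<in> borel_measurable leb01"
    and i: "integrable leb01 (\<lambda>x. norm (q1 x) powr p)" "integrable leb01 (\<lambda>x. norm (q2 x) powr p)"
    using q1 q2 by (auto simp: Lp_def)
  have "integrable leb01 (\<lambda>x. norm (complex_of_real (q2 x) - \<i> * of_real (q1 x)) powr p)"
  proof (rule Bochner_Integration.integrable_bound)
    show "integrable leb01 (\<lambda>x. 2 powr p * (norm (q2 x) powr p + norm (q1 x) powr p))" using i by simp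
    show "AE x in leb01. norm (norm (complex_of_real (q2 x) - \<i> * of_real (q1 x)) powr p)
       \<le> norm (2 powr p * (norm (q2 x) powr p + norm (q1 x) powr p))"
    proof (rule AE_I2)
      fix x
      have "norm (complex_of_real (q2 x) - \<i> * of_real (q1 x)) \<le> norm (q2 x) + norm (q1 x)"
        using norm_triangle_ineq4[of "complex_of_real (q2 x)" "\<i> * of_real (q1 x)"] by (simp add: norm_mult)
      then have "norm (complex_of_real (q2 x) - \<i> * of_real (q1 x)) powr p \<le> (norm (q2 x) + norm (q1 x)) powr p"
        using p by (intro powr_mono2) auto
      also have "\<dots> \<le> 2 powr p * (norm (q2 x) powr p + norm (q1 x) powr p)"
        using p by (intro powr_add_le) auto
      finally show "norm (norm (complex_of_real (q2 x) - \<i> * of_real (q1 x)) powr p)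
       \<le> norm (2 powr p * (norm (q2 x) powr p + norm (q1 x) powr p))" by simp
    qed
  qed measurable
  then show ?thesis by (simp add: Lp_def)
qed

definition Lp_coeffs :: "real \<Rightarrow> (int \<Rightarrow> complex) \<Rightarrow> bool" where
  "Lp_coeffs p a \<longleftrightarrow> (\<exists>g\<in>Lp p. \<forall>n. a n = fourier_coeff n g)"

text \<open>The bound on the $L_1$ norm is carried along because infinite series of such sequences have to be
  summed.\<close>

definition L1_coeffs :: "real \<Rightarrow> (int \<Rightarrow> complex) \<Rightarrow> bool" where
  "L1_coeffs C a \<longleftrightarrow> (\<exists>g. g \<in> borel_measurable borel \<and> (\<forall>x. x \<notin> {0<..<1} \<longrightarrow> g x = 0) \<and>
     integrable lborel g \<and> (\<integral>x. norm (g x) \<partial>lborel) \<le> C \<and>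
     (\<forall>n. a n = (\<integral>x. chr n x * g x \<partial>lborel)))"

lemma Lp_coeffs_iff:
  assumes p: "1 \<le> p"
  shows "Lp_coeffs p a \<longleftrightarrow> (\<exists>g. g \<in> borel_measurable borel \<and> (\<forall>x. x \<notin> {0<..<1} \<longrightarrow> g x = 0) \<and>
     integrable lborel (\<lambda>x. norm (g x) powr p) \<and> integrable lborel g \<and>
     (\<forall>n. a n = (\<integral>x. chr n x * g x \<partial>lborel)))" (is "_ \<longleftrightarrow> ?R")
proof
  assume "Lp_coeffs p a"
  then obtain f where f: "f \<in> Lp p" "\<And>n. a n = fourier_coeff n f" by (auto simp: Lp_coeffs_def)
  obtain g where g: "g \<in> borel_measurable borel" "\<And>x. x \<notin> {0<..<1} \<Longrightarrow> g x = 0"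
    "integrable lborel (\<lambda>x. norm (g x) powr p)" "integrable lborel g" "AE x in leb01. f x = g x"
    using Lp_representative[OF f(1) p] by blast
  note [measurable] = g(1)
  have fl: "f \<in> borel_measurable leb01" using f(1) by (simp add: Lp_def)
  have "a n = (\<integral>x. chr n x * g x \<partial>lborel)" for n
  proof -
    have "a n = (\<integral>x. chr n x * f x \<partial>leb01)"
      by (simp add: f(2) fourier_coeff_eq_chr)
    also have "\<dots> = (\<integral>x. chr n x * g x \<partial>leb01)"
      using fl borel_imp_leb01[OF g(1)] g(5) borel_imp_leb01[OF chr_measurable[of n]]
      by (intro integral_cong_AE borel_measurable_times) (auto elim!: eventually_mono)
    also have "\<dots> = (\<integral>x. indicator {0<..<1} x *\<^sub>R (chr n x * g x) \<partial>lborel)"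
      by (rule integral_leb01) measurable
    also have "\<dots> = (\<integral>x. chr n x * g x \<partial>lborel)"
      using g(2) by (intro Bochner_Integration.integral_cong) (auto simp: indicator_def)
    finally show ?thesis .
  qed
  with g show ?R by blast
next
  assume ?R
  then obtain g where g: "g \<in> borel_measurable borel" "\<And>x. x \<notin> {0<..<1} \<Longrightarrow> g x = 0"
    "integrable lborel (\<lambda>x. norm (g x) powr p)" "\<And>n. a n = (\<integral>x. chr n x * g x \<partial>lborel)" by blast
  note [measurable] = g(1)
  have "(\<lambda>x. indicator {0<..<1} x *\<^sub>R (norm (g x) powr p)) = (\<lambda>x. norm (g x) powr p)"
    using g(2) by (auto simp: indicator_def fun_eq_iff)
  then have "integrable leb01 (\<lambda>x. norm (g x) powr p)"
    using g(3) by (subst integrable_leb01) auto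
  then have "g \<in> Lp p" by (simp add: Lp_def borel_imp_leb01[OF g(1)])
  moreover have "a n = fourier_coeff n g" for n
  proof -
    have "fourier_coeff n g = (\<integral>x. chr n x * g x \<partial>leb01)"
      by (rule fourier_coeff_eq_chr)
    also have "\<dots> = (\<integral>x. indicator {0<..<1} x *\<^sub>R (chr n x * g x) \<partial>lborel)"
      by (rule integral_leb01) measurable
    also have "\<dots> = (\<integral>x. chr n x * g x \<partial>lborel)"
      using g(2) by (intro Bochner_Integration.integral_cong) (auto simp: indicator_def)
    finally show ?thesis using g(4) by simp
  qed
  ultimately show "Lp_coeffs p a" by (auto simp: Lp_coeffs_def)
qed

lemma L1_coeffs_bound:
  assumes "L1_coeffs C a" shows "norm (a n) \<le> C"
proof -
  obtain g where g: "integrable lborel g" "(\<integral>x. norm (g x) \<partial>lborel) \<le> C"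
     "a n = (\<integral>x. chr n x * g x \<partial>lborel)" using assms unfolding L1_coeffs_def by blast
  have "norm (a n) \<le> (\<integral>x. norm (chr n x * g x) \<partial>lborel)"
    unfolding g(3) by (rule integral_norm_bound)
  then show ?thesis using g(2) by (simp add: norm_mult)
qed

lemma L1_coeffs_mono: "L1_coeffs C a \<Longrightarrow> C \<le> D \<Longrightarrow> L1_coeffs D a"
  unfolding L1_coeffs_def by (meson order_trans)

lemma integrable_chr_mult:
  assumes "integrable lborel g" "g \<in> borel_measurable borel"
  shows "integrable lborel (\<lambda>x. chr n x * g x)"
  by (rule Bochner_Integration.integrable_bound[OF assms(1)]) (use assms in \<open>auto simp: norm_mult\<close>)

lemma L1_coeffs_cmult:
  assumes "L1_coeffs C a" shows "L1_coeffs (norm c * C) (\<lambda>n. c * a n)"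
proof -
  obtain g where g: "g \<in> borel_measurable borel" "\<And>x. x \<notin> {0<..<1} \<Longrightarrow> g x = 0"
     "integrable lborel g" "(\<integral>x. norm (g x) \<partial>lborel) \<le> C"
     "\<And>n. a n = (\<integral>x. chr n x * g x \<partial>lborel)" using assms unfolding L1_coeffs_def by blast
  have "(\<integral>x. chr n x * (c * g x) \<partial>lborel) = c * a n" for n
    unfolding g(5) by (subst integral_mult_right_zero[symmetric]) (simp add: mult_ac)
  then show ?thesis unfolding L1_coeffs_def using g
    by (intro exI[of _ "\<lambda>x. c * g x"]) (auto simp: norm_mult mult_left_mono)
qed

lemma L1_coeffs_add:
  assumes "L1_coeffs C a" "L1_coeffs D b" shows "L1_coeffs (C + D) (\<lambda>n. a n + b n)"
proof -
  obtain g where g: "g \<in> borel_measurable borel" "\<And>x. x \<notin> {0<..<1} \<Longrightarrow> g x = 0"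
     "integrable lborel g" "(\<integral>x. norm (g x) \<partial>lborel) \<le> C"
     "\<And>n. a n = (\<integral>x. chr n x * g x \<partial>lborel)" using assms(1) unfolding L1_coeffs_def by blast
  obtain h where h: "h \<in> borel_measurable borel" "\<And>x. x \<notin> {0<..<1} \<Longrightarrow> h x = 0"
     "integrable lborel h" "(\<integral>x. norm (h x) \<partial>lborel) \<le> D"
     "\<And>n. b n = (\<integral>x. chr n x * h x \<partial>lborel)" using assms(2) unfolding L1_coeffs_def by blast
  have "(\<integral>x. norm (g x + h x) \<partial>lborel) \<le> (\<integral>x. norm (g x) + norm (h x) \<partial>lborel)"
    using g h by (intro integral_mono) (auto simp: norm_triangle_ineq)
  also have "\<dots> \<le> C + D" using g h by simp
  finally have 1: "(\<integral>x. norm (g x + h x) \<partial>lborel) \<le> C + D" .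
  have 2: "(\<integral>x. chr n x * (g x + h x) \<partial>lborel) = a n + b n" for n
    using integrable_chr_mult[OF g(3,1)] integrable_chr_mult[OF h(3,1)]
    by (simp add: g(5) h(5) ring_distribs)
  show ?thesis unfolding L1_coeffs_def
    by (intro exI[of _ "\<lambda>x. g x + h x"]) (use g h 1 2 in auto)
qed

lemma Lp_coeffs_imp_L1_coeffs: assumes "Lp_coeffs p a" "1 \<le> p" shows "\<exists>C. L1_coeffs C a"
  using assms unfolding Lp_coeffs_iff[OF assms(2)] L1_coeffs_def by blast

lemma Lp_coeffs_cmult:
  assumes p: "1 \<le> p" and "Lp_coeffs p a" shows "Lp_coeffs p (\<lambda>n. c * a n)"
proof -
  obtain g where g: "g \<in> borel_measurable borel" "\<And>x. x \<notin> {0<..<1} \<Longrightarrow> g x = 0"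
     "integrable lborel (\<lambda>x. norm (g x) powr p)" "integrable lborel g"
     "\<And>n. a n = (\<integral>x. chr n x * g x \<partial>lborel)" using assms unfolding Lp_coeffs_iff[OF p] by blast
  have "(\<integral>x. chr n x * (c * g x) \<partial>lborel) = c * a n" for n
    unfolding g(5) by (subst integral_mult_right_zero[symmetric]) (simp add: mult_ac)
  then show ?thesis unfolding Lp_coeffs_iff[OF p] using g
    by (intro exI[of _ "\<lambda>x. c * g x"]) (auto simp: norm_mult powr_mult)
qed

lemma Lp_coeffs_add:
  assumes p: "1 \<le> p" and "Lp_coeffs p a" "Lp_coeffs p b" shows "Lp_coeffs p (\<lambda>n. a n + b n)"
proof -
  obtain g where g: "g \<in> borel_measurable borel" "\<And>x. x \<notin> {0<..<1} \<Longrightarrow> g x = 0"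
     "integrable lborel (\<lambda>x. norm (g x) powr p)" "integrable lborel g"
     "\<And>n. a n = (\<integral>x. chr n x * g x \<partial>lborel)" using assms unfolding Lp_coeffs_iff[OF p] by blast
  obtain h where h: "h \<in> borel_measurable borel" "\<And>x. x \<notin> {0<..<1} \<Longrightarrow> h x = 0"
     "integrable lborel (\<lambda>x. norm (h x) powr p)" "integrable lborel h"
     "\<And>n. b n = (\<integral>x. chr n x * h x \<partial>lborel)" using assms unfolding Lp_coeffs_iff[OF p] by blast
  have [measurable]: "g \<in> borel_measurable borel" "h \<in> borel_measurable borel" by fact+
  have 2: "(\<integral>x. chr n x * (g x + h x) \<partial>lborel) = a n + b n" for n
    using integrable_chr_mult[OF g(4,1)] integrable_chr_mult[OF h(4,1)]
    by (simp add: g(5) h(5) ring_distribs)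
  have 1: "integrable lborel (\<lambda>x. norm (g x + h x) powr p)"
  proof (rule Bochner_Integration.integrable_bound)
    show "integrable lborel (\<lambda>x. 2 powr p * (norm (g x) powr p + norm (h x) powr p))"
      using g h by simp
    show "AE x in lborel. norm (norm (g x + h x) powr p) \<le> norm (2 powr p * (norm (g x) powr p + norm (h x) powr p))"
    proof (intro AE_I2)
      fix x
      have "norm (g x + h x) powr p \<le> (norm (g x) + norm (h x)) powr p"
        using p by (intro powr_mono2) (auto simp: norm_triangle_ineq)
      also have "\<dots> \<le> 2 powr p * (norm (g x) powr p + norm (h x) powr p)"
        using p by (intro powr_add_le) auto
      finally show "norm (norm (g x + h x) powr p) \<le> norm (2 powr p * (norm (g x) powr p + norm (h x) powr p))"
        by simp
    qed
  qed measurable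
  show ?thesis unfolding Lp_coeffs_iff[OF p]
    by (intro exI[of _ "\<lambda>x. g x + h x"]) (use g h 1 2 in auto)
qed

text \<open>Conjugation of the coefficients corresponds to $g(x) \mapsto \overline{g(1-x)}$.\<close>

lemma Lp_coeffs_cnj:
  assumes p: "1 \<le> p" and a: "Lp_coeffs p a"
  shows "Lp_coeffs p (\<lambda>n. cnj (a n))"
proof -
  obtain g where g: "g \<in> borel_measurable borel" "\<And>x. x \<notin> {0<..<1} \<Longrightarrow> g x = 0"
     "integrable lborel (\<lambda>x. norm (g x) powr p)" "integrable lborel g"
     "\<And>n. a n = (\<integral>x. chr n x * g x \<partial>lborel)" using a unfolding Lp_coeffs_iff[OF p] by blast
  note [measurable] = g(1)
  let ?h = "\<lambda>x. cnj (g (1 - x))"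
  have "cnj (a n) = (\<integral>x. chr n x * ?h x \<partial>lborel)" for n
  proof -
    have "cnj (a n) = (\<integral>x. cnj (chr n x * g x) \<partial>lborel)"
      unfolding g(5) by (rule Bochner_Integration.integral_cnj[symmetric])
    also have "\<dots> = (\<integral>x. cnj (chr n (1 - x) * g (1 - x)) \<partial>lborel)"
      by (subst lborel_integral_real_affine[where c="-1" and t=1]) auto
    also have "\<dots> = (\<integral>x. chr n x * ?h x \<partial>lborel)"
    proof (rule Bochner_Integration.integral_cong[OF refl])
      fix x
      have "chr n (1 - x) = cnj (chr n x)"
        using chr_add[of n 1 "- x"] chr_of_int[of n 1] by (simp add: chr_minus)
      then show "cnj (chr n (1 - x) * g (1 - x)) = chr n x * ?h x" by simp
    qed
    finally show ?thesis .
  qed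
  moreover have "integrable lborel (\<lambda>x. norm (?h x) powr p)"
    using lborel_integrable_real_affine[OF g(3), of "-1" 1] by simp
  moreover have "integrable lborel ?h"
    using Bochner_Integration.integrable_cnj[OF lborel_integrable_real_affine[OF g(4), of "-1" 1]] by simp
  moreover have "?h \<in> borel_measurable borel" by measurable
  moreover have "?h x = 0" if "x \<notin> {0<..<1}" for x using that g(2)[of "1 - x"] by auto
  ultimately show ?thesis unfolding Lp_coeffs_iff[OF p] by (intro exI[of _ ?h]) auto
qed

lemma L1_coeffs_folded:
  assumes [measurable]: "F \<in> borel_measurable (borel \<Otimes>\<^sub>M borel)"
    and int: "integrable (lborel \<Otimes>\<^sub>M lborel) F"
    and supp: "\<And>t s. t \<notin> {0<..<1} \<Longrightarrow> F (t, s) = 0"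
  shows "L1_coeffs (\<integral>p. norm (F p) \<partial>(lborel \<Otimes>\<^sub>M lborel))
           (\<lambda>n. \<integral>p. F p * chr n (fst p + snd p) \<partial>(lborel \<Otimes>\<^sub>M lborel))"
  unfolding L1_coeffs_def
  using folded_L1[OF assms] folded_fourier[OF assms] folded_measurable[OF assms(1)]
  by (intro exI[of _ "folded F"]) (auto simp: folded_outside)

lemma Lp_coeffs_folded:
  assumes [measurable]: "F \<in> borel_measurable (borel \<Otimes>\<^sub>M borel)"
    and [measurable]: "g \<in> borel_measurable borel" "h \<in> borel_measurable borel"
    and p: "1 \<le> p" and g0: "\<And>s. 0 \<le> g s" and h0: "\<And>s. 0 \<le> h s" and h: "integrable lborel h"
    and g: "integrable lborel (\<lambda>t. g t powr p)" and supp: "\<And>t. t \<notin> {0<..<1} \<Longrightarrow> g t = 0"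
    and F: "\<And>t s. norm (F (t, s)) \<le> g t * h s"
  shows "integrable (lborel \<Otimes>\<^sub>M lborel) F"
    and "Lp_coeffs p (\<lambda>n. \<integral>p. F p * chr n (fst p + snd p) \<partial>(lborel \<Otimes>\<^sub>M lborel))"
proof -
  have g1: "integrable lborel g"
    by (rule integrable_of_powr[OF _ _ p]) (use supp g g0 in auto)
  have "(\<integral>\<^sup>+x. \<integral>\<^sup>+y. ennreal (norm (F (x, y))) \<partial>lborel \<partial>lborel)
     \<le> (\<integral>\<^sup>+t. \<integral>\<^sup>+s. ennreal (g t) * ennreal (h s) \<partial>lborel \<partial>lborel)"
    using F g0 h0 by (intro nn_integral_mono) (simp add: ennreal_mult[symmetric] ennreal_leI)
  also have "\<dots> = (\<integral>\<^sup>+t. ennreal (g t) \<partial>lborel) * (\<integral>\<^sup>+s. ennreal (h s) \<partial>lborel)"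
    by (simp add: nn_integral_cmult nn_integral_multc)
  also have "\<dots> < \<infinity>"
    using g1 h g0 h0 by (simp add: nn_integral_eq_integral ennreal_mult_less_top)
  finally show int: "integrable (lborel \<Otimes>\<^sub>M lborel) F"
    by (subst integrable_lborel_pair_iff) auto
  have s: "t \<notin> {0<..<1} \<Longrightarrow> F (t, s) = 0" for t s
    using F[of t s] supp[of t] by simp
  show "Lp_coeffs p (\<lambda>n. \<integral>p. F p * chr n (fst p + snd p) \<partial>(lborel \<Otimes>\<^sub>M lborel))"
    unfolding Lp_coeffs_iff[OF p]
    using folded_L1[OF assms(1) int s] folded_fourier[OF assms(1) int s] folded_measurable[OF assms(1)]
      folded_Lp[OF assms(1-3) p g0 h0 h g g1 F]
    by (intro exI[of _ "folded F"]) (auto simp: folded_outside)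
qed

lemma integral_product_chr:
  assumes [measurable]: "f \<in> borel_measurable borel" "g \<in> borel_measurable borel"
    and int: "integrable (lborel \<Otimes>\<^sub>M lborel) (\<lambda>p. f (fst p) * g (snd p))"
  shows "(\<integral>p. f (fst p) * g (snd p) * chr n (fst p + snd p) \<partial>(lborel \<Otimes>\<^sub>M lborel))
    = (\<integral>x. chr n x * f x \<partial>lborel) * (\<integral>x. chr n x * g x \<partial>lborel)"
proof -
  have int': "integrable (lborel \<Otimes>\<^sub>M lborel) (\<lambda>p. f (fst p) * g (snd p) * chr n (fst p + snd p))"
    by (rule Bochner_Integration.integrable_bound[OF int]) (auto simp: norm_mult)
  have "(\<integral>p. f (fst p) * g (snd p) * chr n (fst p + snd p) \<partial>(lborel \<Otimes>\<^sub>M lborel))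
     = (\<integral>x. \<integral>y. f x * g y * chr n (x + y) \<partial>lborel \<partial>lborel)"
    using lborel_pair.integral_fst[of "\<lambda>x y. f x * g y * chr n (x + y)"] int'
    by (simp add: case_prod_unfold)
  also have "\<dots> = (\<integral>x. (chr n x * f x) * (\<integral>y. chr n y * g y \<partial>lborel) \<partial>lborel)"
    by (intro Bochner_Integration.integral_cong refl, subst integral_mult_right_zero[symmetric])
       (simp add: chr_add mult_ac)
  finally show ?thesis by simp
qed

text \<open>The convolution theorem, as the case $F(t,s) = g(t) h(s)$ of folding.\<close>

lemma L1_coeffs_mult:
  assumes "L1_coeffs C a" "L1_coeffs D b" shows "L1_coeffs (C * D) (\<lambda>n. a n * b n)"
proof -
  obtain g where g: "g \<in> borel_measurable borel" "\<And>x. x \<notin> {0<..<1} \<Longrightarrow> g x = 0"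
     "integrable lborel g" "(\<integral>x. norm (g x) \<partial>lborel) \<le> C"
     "\<And>n. a n = (\<integral>x. chr n x * g x \<partial>lborel)" using assms(1) unfolding L1_coeffs_def by blast
  obtain h where h: "h \<in> borel_measurable borel" "\<And>x. x \<notin> {0<..<1} \<Longrightarrow> h x = 0"
     "integrable lborel h" "(\<integral>x. norm (h x) \<partial>lborel) \<le> D"
     "\<And>n. b n = (\<integral>x. chr n x * h x \<partial>lborel)" using assms(2) unfolding L1_coeffs_def by blast
  note [measurable] = g(1) h(1)
  let ?F = "\<lambda>p. g (fst p) * h (snd p)"
  have "(\<integral>\<^sup>+x. \<integral>\<^sup>+y. ennreal (norm (?F (x, y))) \<partial>lborel \<partial>lborel)
     = (\<integral>\<^sup>+t. ennreal (norm (g t)) \<partial>lborel) * (\<integral>\<^sup>+s. ennreal (norm (h s)) \<partial>lborel)"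
    by (simp add: nn_integral_cmult nn_integral_multc norm_mult ennreal_mult)
  also have eq: "\<dots> = ennreal (\<integral>x. norm (g x) \<partial>lborel) * ennreal (\<integral>x. norm (h x) \<partial>lborel)"
    using g(3) h(3) by (simp add: nn_integral_eq_integral)
  finally have nn: "(\<integral>\<^sup>+x. \<integral>\<^sup>+y. ennreal (norm (?F (x, y))) \<partial>lborel \<partial>lborel)
     = ennreal (\<integral>x. norm (g x) \<partial>lborel) * ennreal (\<integral>x. norm (h x) \<partial>lborel)" .
  have int: "integrable (lborel \<Otimes>\<^sub>M lborel) ?F"
    by (subst integrable_lborel_pair_iff, measurable, subst nn) (auto simp: ennreal_mult_less_top)
  have "L1_coeffs (\<integral>p. norm (?F p) \<partial>(lborel \<Otimes>\<^sub>M lborel)) (\<lambda>n. a n * b n)"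
    using L1_coeffs_folded[of ?F] int g(2) by (simp add: integral_product_chr g(5) h(5))
  moreover have "(\<integral>p. norm (?F p) \<partial>(lborel \<Otimes>\<^sub>M lborel)) = (\<integral>x. norm (g x) \<partial>lborel) * (\<integral>x. norm (h x) \<partial>lborel)"
    using lborel_pair.integral_fst[of "\<lambda>x y. norm (g x * h y)"] integrable_norm[OF int]
    by (simp add: case_prod_unfold norm_mult)
  moreover have "0 \<le> (\<integral>x. norm (g x) \<partial>lborel)" "0 \<le> (\<integral>x. norm (h x) \<partial>lborel)" by (auto intro!: integral_nonneg_AE)
  moreover have "(\<integral>x. norm (g x) \<partial>lborel) * (\<integral>x. norm (h x) \<partial>lborel) \<le> C * D"
    using g(4) h(4) calculation(3,4) by (intro mult_mono) linarith+
  ultimately show ?thesis by (metis L1_coeffs_mono)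
qed

text \<open>The coefficients of $L_p$ functions form an ideal in the algebra of coefficients of $L_1$
  functions.\<close>

lemma Lp_coeffs_mult:
  assumes p: "1 \<le> p" and "Lp_coeffs p a" "L1_coeffs D b" shows "Lp_coeffs p (\<lambda>n. a n * b n)"
proof -
  obtain g where g: "g \<in> borel_measurable borel" "\<And>x. x \<notin> {0<..<1} \<Longrightarrow> g x = 0"
     "integrable lborel (\<lambda>x. norm (g x) powr p)" "integrable lborel g"
     "\<And>n. a n = (\<integral>x. chr n x * g x \<partial>lborel)" using assms unfolding Lp_coeffs_iff[OF p] by blast
  obtain h where h: "h \<in> borel_measurable borel" "\<And>x. x \<notin> {0<..<1} \<Longrightarrow> h x = 0"
     "integrable lborel h"
     "\<And>n. b n = (\<integral>x. chr n x * h x \<partial>lborel)" using assms(3) unfolding L1_coeffs_def by blast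
  note [measurable] = g(1) h(1)
  let ?F = "\<lambda>p. g (fst p) * h (snd p)"
  have "integrable (lborel \<Otimes>\<^sub>M lborel) ?F"
    "Lp_coeffs p (\<lambda>n. \<integral>p. ?F p * chr n (fst p + snd p) \<partial>(lborel \<Otimes>\<^sub>M lborel))"
    using Lp_coeffs_folded[of ?F "\<lambda>x. norm (g x)" "\<lambda>x. norm (h x)" p] p g h by (auto simp: norm_mult)
  then show ?thesis by (simp add: integral_product_chr g(5) h(4))
qed

lemma AE_summable_L1:
  fixes f :: "nat \<Rightarrow> 'a \<Rightarrow> 'b::{banach, second_countable_topology}"
  assumes int: "\<And>k. integrable M (f k)" and "summable (\<lambda>k. \<integral>x. norm (f k x) \<partial>M)"
  shows "AE x in M. summable (\<lambda>k. norm (f k x))"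
proof -
  have [measurable]: "f k \<in> borel_measurable M" for k using int by auto
  have "(\<integral>\<^sup>+x. (\<Sum>k. ennreal (norm (f k x))) \<partial>M) = (\<Sum>k. \<integral>\<^sup>+x. ennreal (norm (f k x)) \<partial>M)"
    by (rule nn_integral_suminf) measurable
  also have "\<dots> = (\<Sum>k. ennreal (\<integral>x. norm (f k x) \<partial>M))"
    using int by (intro suminf_cong nn_integral_eq_integral) auto
  also have "\<dots> \<noteq> \<infinity>"
    using assms(2) by (simp add: ennreal_suminf_neq_top integral_nonneg_AE)
  finally have "AE x in M. (\<Sum>k. ennreal (norm (f k x))) \<noteq> \<infinity>"
    by (intro nn_integral_PInf_AE) auto
  then show ?thesis
    by eventually_elim (auto intro: summable_suminf_not_top)
qed

text \<open>Completeness of $L_1$, in the form that absolutely convergent series converge.\<close>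

lemma L1_coeffs_suminf:
  assumes a: "\<And>k::nat. L1_coeffs (C k) (a k)" and C: "summable C"
  shows "L1_coeffs (suminf C) (\<lambda>n. \<Sum>k. a k n)" and "summable (\<lambda>k. a k n)"
proof -
  have "\<forall>k. \<exists>g. g \<in> borel_measurable borel \<and> (\<forall>x. x \<notin> {0<..<1} \<longrightarrow> g x = 0) \<and>
     integrable lborel g \<and> (\<integral>x. norm (g x) \<partial>lborel) \<le> C k \<and>
     (\<forall>n. a k n = (\<integral>x. chr n x * g x \<partial>lborel))"
    using a unfolding L1_coeffs_def by blast
  then obtain g where g: "\<And>k. g k \<in> borel_measurable borel" "\<And>k x. x \<notin> {0<..<1} \<Longrightarrow> g k x = 0"
     "\<And>k. integrable lborel (g k)" "\<And>k. (\<integral>x. norm (g k x) \<partial>lborel) \<le> C k"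
     "\<And>k n. a k n = (\<integral>x. chr n x * g k x \<partial>lborel)" by metis
  show "summable (\<lambda>k. a k n)"
    by (rule summable_comparison_test[OF _ C]) (use L1_coeffs_bound[OF a] in auto)
  have sg: "summable (\<lambda>k. \<integral>x. norm (g k x) \<partial>lborel)"
    by (rule summable_comparison_test[OF _ C]) (use g(4) in \<open>auto simp: integral_nonneg_AE\<close>)
  have AE: "AE x in lborel. summable (\<lambda>k. norm (g k x))"
    by (rule AE_summable_L1[OF g(3) sg])
  define G where "G = (\<lambda>x. \<Sum>k. g k x)"
  have G: "integrable lborel G" unfolding G_def
    by (rule integrable_suminf) (use g AE sg in auto)
  have Gm: "G \<in> borel_measurable borel" using G by auto
  have "(\<integral>x. norm (G x) \<partial>lborel) \<le> (\<integral>x. (\<Sum>k. norm (g k x)) \<partial>lborel)"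
  proof (rule integral_mono_AE)
    show "integrable lborel (\<lambda>x. \<Sum>k. norm (g k x))"
      by (rule integrable_suminf) (use g AE sg in auto)
    show "AE x in lborel. norm (G x) \<le> (\<Sum>k. norm (g k x))"
      using AE by eventually_elim (simp add: G_def summable_norm)
  qed (use G in auto)
  also have "\<dots> = (\<Sum>k. \<integral>x. norm (g k x) \<partial>lborel)"
    by (rule integral_suminf) (use g AE sg in auto)
  also have "\<dots> \<le> suminf C" by (rule suminf_le[OF g(4) sg C])
  finally have 1: "(\<integral>x. norm (G x) \<partial>lborel) \<le> suminf C" .
  have 2: "(\<Sum>k. a k n) = (\<integral>x. chr n x * G x \<partial>lborel)" for n
  proof -
    have "(\<integral>x. chr n x * G x \<partial>lborel) = (\<integral>x. (\<Sum>k. chr n x * g k x) \<partial>lborel)"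
    proof (rule integral_cong_AE)
      show "AE x in lborel. chr n x * G x = (\<Sum>k. chr n x * g k x)"
        using AE by eventually_elim (simp add: G_def suminf_mult summable_norm_cancel)
    qed (use Gm g(1) in \<open>auto intro!: borel_measurable_suminf\<close>)
    also have "\<dots> = (\<Sum>k. \<integral>x. chr n x * g k x \<partial>lborel)"
      by (rule integral_suminf) (use g AE sg integrable_chr_mult in \<open>auto simp: norm_mult\<close>)
    finally show ?thesis by (simp add: g(5))
  qed
  show "L1_coeffs (suminf C) (\<lambda>n. \<Sum>k. a k n)" unfolding L1_coeffs_def
    by (intro exI[of _ G]) (use G Gm 1 2 g(2) in \<open>auto simp: G_def\<close>)
qed

lemma L1_coeffs_power:
  assumes "L1_coeffs C a" shows "L1_coeffs (C ^ Suc k) (\<lambda>n. a n ^ Suc k)"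
proof (induction k)
  case (Suc k)
  then show ?case using L1_coeffs_mult[OF assms Suc] by simp
qed (use assms in simp)

text \<open>The Neumann series in the convolution algebra.\<close>

lemma L1_coeffs_inverse_small:
  assumes r: "L1_coeffs C r" and C: "C < 1"
  obtains D s where "L1_coeffs D s" "\<And>n. 1 / (1 + r n) = 1 + s n"
proof -
  have C0: "0 \<le> C" using L1_coeffs_bound[OF r, of 0] norm_ge_zero order_trans by blast
  have sC: "summable (\<lambda>k. C ^ Suc k)"
    using C C0 by (simp add: summable_mult summable_geometric)
  have A: "L1_coeffs (C ^ Suc k) (\<lambda>n. (- r n) ^ Suc k)" for k
    using L1_coeffs_power[OF L1_coeffs_cmult[OF r, of "-1"], of k] by simp
  show ?thesis
  proof (rule that[OF L1_coeffs_suminf(1)[OF A sC]])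
    fix n
    have nr: "norm (- r n) < 1" using L1_coeffs_bound[OF r, of n] C by simp
    have "(\<Sum>k. (- r n) ^ Suc k) = - r n * (\<Sum>k. (- r n) ^ k)"
      using suminf_mult[OF summable_geometric[OF nr], of "- r n"] by simp
    also have "\<dots> = - r n / (1 + r n)" using suminf_geometric[OF nr] by simp
    finally have e: "(\<Sum>k. (- r n) ^ Suc k) = - r n / (1 + r n)" .
    have "1 + r n \<noteq> 0"
      using nr by (metis add_eq_0_iff norm_minus_cancel norm_one less_irrefl)
    then show "1 / (1 + r n) = 1 + (\<Sum>k. (- r n) ^ Suc k)" unfolding e
      by (simp add: field_simps)
  qed
qed

section \<open>Wiener's lemma\<close>

text \<open>A measurable function is an almost everywhere limit of continuous ones. For a bounded function the
  approximants can be clipped, so that dominated convergence and then the Weierstrass theorem apply.\<close>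

lemma poly_dense_bounded:
  fixes b :: "real \<Rightarrow> real"
  assumes b[measurable]: "b \<in> borel_measurable borel" and bd: "\<And>x. \<bar>b x\<bar> \<le> N" and e: "0 < e"
  obtains A :: "real poly" where "(\<integral>x. indicator {0<..<1} x * \<bar>b x - poly A x\<bar> \<partial>lborel) < e"
proof -
  have "b \<in> borel_measurable (lebesgue_on UNIV)"
    using measurable_completion[of b lborel borel] by simp
  then have "b measurable_on UNIV"
    by (subst measurable_on_iff_borel_measurable) auto
  then obtain Z g where Z: "negligible Z" "\<And>n. continuous_on UNIV (g n)"
    "\<And>x. x \<notin> Z \<Longrightarrow> (\<lambda>n. g n x) \<longlonglongrightarrow> b x"
    unfolding measurable_on_def by auto
  define f where "f = (\<lambda>n x. max (- N) (min N (g n x)) :: real)"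
  have f_cont: "continuous_on UNIV (f n)" for n
    unfolding f_def by (intro continuous_intros Z(2))
  have [measurable]: "f n \<in> borel_measurable borel" for n
    by (rule borel_measurable_continuous_onI[OF f_cont])
  have N: "0 \<le> N" using bd[of 0] by simp
  have "AE x in lebesgue. x \<notin> Z"
    using Z(1) by (simp add: negligible_iff_null_sets AE_not_in)
  then have AEZ: "AE x in lborel. x \<notin> Z" by (simp add: AE_completion_iff)
  have "(\<lambda>n. \<integral>x. indicator {0<..<1} x * \<bar>b x - f n x\<bar> \<partial>lborel) \<longlonglongrightarrow> (\<integral>x. 0 \<partial>(lborel :: real measure))"
  proof (rule integral_dominated_convergence)
    show "AE x in lborel. (\<lambda>n. indicator {0<..<1} x * \<bar>b x - f n x\<bar>) \<longlonglongrightarrow> 0"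
      using AEZ
    proof eventually_elim
      fix x assume "x \<notin> Z"
      then have "(\<lambda>n. f n x) \<longlonglongrightarrow> max (- N) (min N (b x))"
        unfolding f_def by (intro tendsto_intros Z(3))
      also have "max (- N) (min N (b x)) = b x" using bd[of x] by simp
      finally have "(\<lambda>n. indicator {0<..<1} x * \<bar>b x - f n x\<bar>) \<longlonglongrightarrow> indicator {0<..<1} x * \<bar>b x - b x\<bar>"
        by (intro tendsto_intros)
      then show "(\<lambda>n. indicator {0<..<1} x * \<bar>b x - f n x\<bar>) \<longlonglongrightarrow> 0" by simp
    qed
    show "integrable lborel (\<lambda>x. indicator {0<..<1::real} x * (2 * N))"
      by (intro integrable_mult_left integrable_real_indicator) auto
    show "AE x in lborel. norm (indicator {0<..<1} x * \<bar>b x - f n x\<bar>) \<le> indicator {0<..<1} x * (2 * N)" for n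
    proof (rule AE_I2)
      fix x
      have "\<bar>f n x\<bar> \<le> N" using N by (simp add: f_def)
      then show "norm (indicator {0<..<1} x * \<bar>b x - f n x\<bar>) \<le> indicator {0<..<1} x * (2 * N)"
        using bd[of x] by (auto simp: indicator_def abs_mult)
    qed
  qed measurable
  then have "(\<lambda>n. \<integral>x. indicator {0<..<1} x * \<bar>b x - f n x\<bar> \<partial>lborel) \<longlonglongrightarrow> 0" by simp
  then have "eventually (\<lambda>n. (\<integral>x. indicator {0<..<1} x * \<bar>b x - f n x\<bar> \<partial>lborel) < e/2) sequentially"
    using e by (intro order_tendstoD) auto
  then obtain n where n: "(\<integral>x. indicator {0<..<1} x * \<bar>b x - f n x\<bar> \<partial>lborel) < e/2"
    by (auto simp: eventually_sequentially)
  obtain r where r: "real_polynomial_function r" "\<And>x. x \<in> {0..1} \<Longrightarrow> \<bar>f n x - r x\<bar> < e/2"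
    using Stone_Weierstrass_real_polynomial_function[of "{0..1}" "f n" "e/2"] e f_cont[of n]
      continuous_on_subset[OF f_cont[of n], of "{0..1}"] by auto
  then obtain a k where ak: "r = (\<lambda>x. \<Sum>i\<le>k. a i * x^i)"
    using real_polynomial_function_iff_sum by blast
  define A where "A = (\<Sum>i\<le>k. monom (a i) i)"
  have A: "poly A x = r x" for x by (simp add: A_def ak poly_sum poly_monom)
  have [measurable]: "(\<lambda>x. poly A x) \<in> borel_measurable borel"
    by (intro borel_measurable_continuous_onI continuous_intros)
  have int1: "integrable lborel (\<lambda>x. indicator {0<..<1} x * \<bar>b x - f n x\<bar>)"
  proof (rule Bochner_Integration.integrable_bound)
    show "integrable lborel (\<lambda>x. indicator {0<..<1::real} x * (2 * N))"
      by (intro integrable_mult_left integrable_real_indicator) auto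
    show "AE x in lborel. norm (indicator {0<..<1} x * \<bar>b x - f n x\<bar>) \<le> norm (indicator {0<..<1} x * (2 * N))"
    proof (rule AE_I2)
      fix x
      have "\<bar>f n x\<bar> \<le> N" using N by (simp add: f_def)
      then show "norm (indicator {0<..<1} x * \<bar>b x - f n x\<bar>) \<le> norm (indicator {0<..<1} x * (2 * N))"
        using bd[of x] N by (auto simp: indicator_def abs_mult)
    qed
  qed measurable
  have int2: "integrable lborel (\<lambda>x. indicator {0<..<1::real} x * (e/2))"
    by (intro integrable_mult_left integrable_real_indicator) auto
  have le: "indicator {0<..<1} x * \<bar>b x - poly A x\<bar> \<le> indicator {0<..<1} x * \<bar>b x - f n x\<bar> + indicator {0<..<1} x * (e/2)" for x
    using r(2)[of x] abs_triangle_ineq[of "b x - f n x" "f n x - r x"] by (auto simp: indicator_def A)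
  have "(\<integral>x. indicator {0<..<1} x * \<bar>b x - poly A x\<bar> \<partial>lborel)
      \<le> (\<integral>x. indicator {0<..<1} x * \<bar>b x - f n x\<bar> + indicator {0<..<1} x * (e/2) \<partial>lborel)"
  proof (rule integral_mono)
    show int3: "integrable lborel (\<lambda>x. indicator {0<..<1} x * \<bar>b x - f n x\<bar> + indicator {0<..<1} x * (e/2))"
      using int1 int2 by simp
    show "integrable lborel (\<lambda>x. indicator {0<..<1} x * \<bar>b x - poly A x\<bar>)"
      by (rule Bochner_Integration.integrable_bound[OF int3])
         (use e le in \<open>auto simp: abs_mult\<close>)
  qed (rule le)
  also have "\<dots> = (\<integral>x. indicator {0<..<1} x * \<bar>b x - f n x\<bar> \<partial>lborel) + e/2"
    using int1 int2 by simp
  also have "\<dots> < e" using n by simp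
  finally show ?thesis by (rule that)
qed

lemma poly_bounded_unit_interval:
  fixes C :: "real poly"
  obtains K where "\<And>x. x \<in> {0..1} \<Longrightarrow> \<bar>poly C x\<bar> \<le> K"
proof -
  have "compact (poly C ` {0..1})"
    by (intro compact_continuous_image continuous_intros compact_Icc)
  then obtain K where K: "\<forall>y\<in>poly C ` {0..1}. norm y \<le> K"
    using compact_imp_bounded bounded_iff by metis
  show ?thesis by (rule that[of K]) (use K in simp)
qed

text \<open>Polynomials that vanish at both ends of the interval are dense as well. The boundary condition
  makes their periodic extensions continuous, and this is what gives summable Fourier coefficients below.\<close>

lemma poly_dense_L1:
  fixes g :: "real \<Rightarrow> real"
  assumes g[measurable]: "g \<in> borel_measurable borel" and supp: "\<And>x. x \<notin> {0<..<1} \<Longrightarrow> g x = 0"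
    and int: "integrable lborel g" and e: "0 < e"
  obtains A :: "real poly" where "poly A 0 = 0" "poly A 1 = 0"
    "(\<integral>x. \<bar>g x - indicator {0<..<1} x * poly A x\<bar> \<partial>lborel) < e"
proof -
  define w where "w = (\<lambda>x::real. x * (1 - x))"
  have [measurable]: "w \<in> borel_measurable borel" unfolding w_def by measurable
  have w: "0 < w x" "w x \<le> 1" if "x \<in> {0<..<1}" for x
    using that by (auto simp: w_def intro: mult_le_one)
  \<comment> \<open>Truncation at height $N x (1-x)$ keeps the quotient $g_N / (x(1-x))$ bounded; a polynomial close to the quotient, multiplied by $x(1-x)$, vanishes at both ends.\<close>
  define gN where "gN = (\<lambda>(N::nat) x. if \<bar>g x\<bar> \<le> real N * w x then g x else 0)"
  have [measurable]: "gN N \<in> borel_measurable borel" for N unfolding gN_def by measurable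
  have "(\<lambda>N. \<integral>x. \<bar>g x - gN N x\<bar> \<partial>lborel) \<longlonglongrightarrow> (\<integral>x. 0 \<partial>(lborel :: real measure))"
  proof (rule integral_dominated_convergence)
    show "integrable lborel (\<lambda>x. \<bar>g x\<bar>)" using int by simp
    show "AE x in lborel. (\<lambda>N. \<bar>g x - gN N x\<bar>) \<longlonglongrightarrow> 0"
    proof (rule AE_I2)
      fix x
      show "(\<lambda>N. \<bar>g x - gN N x\<bar>) \<longlonglongrightarrow> 0"
      proof (cases "x \<in> {0<..<1}")
        case True
        have "eventually (\<lambda>N. \<bar>g x - gN N x\<bar> = 0) sequentially"
          unfolding eventually_sequentially
        proof (intro exI allI impI)
          fix n assume "nat \<lceil>\<bar>g x\<bar> / w x\<rceil> \<le> n"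
          then have "\<bar>g x\<bar> / w x \<le> real n" by linarith
          then show "\<bar>g x - gN n x\<bar> = 0" using w[OF True] by (simp add: gN_def field_simps)
        qed
        then show ?thesis by (rule tendsto_eventually)
      next
        case False
        then have "g x = 0" by (rule supp)
        then have "gN N x = 0" for N unfolding gN_def by auto
        with \<open>g x = 0\<close> show ?thesis by simp
      qed
    qed
  qed (auto simp: gN_def)
  then have "(\<lambda>N. \<integral>x. \<bar>g x - gN N x\<bar> \<partial>lborel) \<longlonglongrightarrow> 0" by simp
  then have "eventually (\<lambda>N. (\<integral>x. \<bar>g x - gN N x\<bar> \<partial>lborel) < e/2) sequentially"
    using e by (intro order_tendstoD) auto
  then obtain N where N: "(\<integral>x. \<bar>g x - gN N x\<bar> \<partial>lborel) < e/2"
    by (auto simp: eventually_sequentially)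
  define b where "b = (\<lambda>x. if x \<in> {0<..<1} then gN N x / w x else 0)"
  have [measurable]: "b \<in> borel_measurable borel" unfolding b_def by measurable
  have bN: "\<bar>b x\<bar> \<le> real N" for x
    using w[of x] by (auto simp: b_def gN_def field_simps abs_mult)
  obtain C where C: "(\<integral>x. indicator {0<..<1} x * \<bar>b x - poly C x\<bar> \<partial>lborel) < e/2"
    using poly_dense_bounded[of b "real N" "e/2"] bN e by auto
  define A where "A = [:0, 1, -1:] * C"
  have A: "poly A x = w x * poly C x" for x by (simp add: A_def w_def algebra_simps)
  have [measurable]: "(\<lambda>x. poly C x) \<in> borel_measurable borel"
    by (intro borel_measurable_continuous_onI continuous_intros)
  have intC: "integrable lborel (\<lambda>x. indicator {0<..<1} x * \<bar>b x - poly C x\<bar>)"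
  proof -
    obtain K where K: "\<And>x. x \<in> {0..1} \<Longrightarrow> \<bar>poly C x\<bar> \<le> K"
      by (rule poly_bounded_unit_interval[of C]) blast
    have "integrable lborel (\<lambda>x. indicator {0<..<1} x *\<^sub>R \<bar>b x - poly C x\<bar>)"
    proof (rule integrableI_bounded_set_indicator[where B="real N + K"])
      show "AE x in lborel. x \<in> {0<..<1} \<longrightarrow> norm \<bar>b x - poly C x\<bar> \<le> real N + K"
      proof (intro AE_I2 impI)
        fix x :: real assume "x \<in> {0<..<1}"
        then have "\<bar>poly C x\<bar> \<le> K" by (intro K) auto
        then show "norm \<bar>b x - poly C x\<bar> \<le> real N + K" using bN[of x] by simp
      qed
    qed auto
    then show ?thesis by simp
  qed
  have le: "\<bar>g x - indicator {0<..<1} x * poly A x\<bar> \<le> \<bar>g x - gN N x\<bar> + indicator {0<..<1} x * \<bar>b x - poly C x\<bar>" for x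
  proof (cases "x \<in> {0<..<1}")
    case True
    then have "gN N x - poly A x = w x * (b x - poly C x)"
      using w[OF True] by (simp add: b_def A field_simps)
    then have "\<bar>gN N x - poly A x\<bar> = w x * \<bar>b x - poly C x\<bar>"
      using w[OF True] by (simp add: abs_mult)
    also have "\<dots> \<le> \<bar>b x - poly C x\<bar>" using w[OF True] by (simp add: mult_left_le_one_le)
    finally show ?thesis using True by simp
  qed (simp add: supp)
  have intg: "integrable lborel (\<lambda>x. \<bar>g x - gN N x\<bar>)"
    by (rule Bochner_Integration.integrable_bound[OF int]) (auto simp: gN_def)
  have "(\<integral>x. \<bar>g x - indicator {0<..<1} x * poly A x\<bar> \<partial>lborel)
      \<le> (\<integral>x. \<bar>g x - gN N x\<bar> + indicator {0<..<1} x * \<bar>b x - poly C x\<bar> \<partial>lborel)"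
  proof (rule integral_mono)
    show int3: "integrable lborel (\<lambda>x. \<bar>g x - gN N x\<bar> + indicator {0<..<1} x * \<bar>b x - poly C x\<bar>)"
      using intg intC by simp
    have "(\<lambda>x. \<bar>g x - indicator {0<..<1} x * poly A x\<bar>) \<in> borel_measurable borel"
      unfolding A by measurable
    then show "integrable lborel (\<lambda>x. \<bar>g x - indicator {0<..<1} x * poly A x\<bar>)"
      by (intro Bochner_Integration.integrable_bound[OF int3]) (use le in auto)
  qed (rule le)
  also have "\<dots> < e" using intg intC N C by simp
  finally show ?thesis by (intro that[of A]) (auto simp: A w_def)
qed

lemma chr_has_vector_derivative:
  "(chr n has_vector_derivative (- (2 * pi * n * \<i>) * chr n x)) (at x within S)"
  unfolding chr_def
  by (rule has_vector_derivative_eq_rhs)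
     (auto intro!: derivative_eq_intros simp: has_vector_derivative_def fun_eq_iff scaleR_conv_of_real)

text \<open>Integration by parts twice; the boundary terms of the first one vanish.\<close>

lemma fourier_poly_decay:
  fixes A :: "real poly"
  assumes A0: "poly A 0 = 0" "poly A 1 = 0"
  obtains K where "0 \<le> K" "\<And>n. n \<noteq> 0 \<Longrightarrow>
    norm (\<integral>x. chr n x * of_real (indicator {0<..<1} x * poly A x) \<partial>lborel) \<le> K / (of_int n)\<^sup>2"
proof -
  define B where "B = pderiv A"
  define D where "D = pderiv B"
  obtain M where M: "\<And>x. x \<in> {0..1} \<Longrightarrow> \<bar>poly D x\<bar> \<le> M"
    by (rule poly_bounded_unit_interval[of D]) blast
  define K where "K = \<bar>poly B 0\<bar> + \<bar>poly B 1\<bar> + M"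
  have M0: "0 \<le> M" using M[of 0] by simp
  note chr_deriv = chr_has_vector_derivative
  have P: "((\<lambda>x. complex_of_real (poly E x)) has_vector_derivative of_real (poly (pderiv E) x)) (at x within S)" for E :: "real poly" and x S
    by (intro has_vector_derivative_of_real) (use poly_DERIV[of E x] in \<open>auto intro: has_vector_derivative_at_within simp: has_real_derivative_iff_has_vector_derivative\<close>)
  have cont: "continuous_on S (chr n)" for n S
    unfolding chr_def by (intro continuous_intros)
  show ?thesis
  proof (rule that[of K])
    show "0 \<le> K" using M0 by (simp add: K_def)
    fix n :: int assume n: "n \<noteq> 0"
    define w where "w = 2 * pi * of_int n * \<i>"
    have w0: "w \<noteq> 0" using n by (simp add: w_def)
    have nw: "norm w = 2 * pi * \<bar>of_int n\<bar>" by (simp add: w_def norm_mult)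
    \<comment> \<open>Up to the remainder with the second derivative, an antiderivative of the integrand.\<close>
    define W where "W = (\<lambda>x. - (chr n x * (of_real (poly A x) / w + of_real (poly B x) / w^2)))"
    have W: "(W has_vector_derivative (chr n x * of_real (poly A x) - chr n x * of_real (poly D x) / w^2)) (at x within {0..1})" for x
    proof -
      have d1: "((\<lambda>x. of_real (poly A x) / w + of_real (poly B x) / w^2) has_vector_derivative
            (of_real (poly B x) / w + of_real (poly D x) / w^2)) (at x within {0..1})"
        using has_vector_derivative_add[OF
          has_vector_derivative_mult_left[OF P[of A x "{0..1}"], of "1/w"]
          has_vector_derivative_mult_left[OF P[of B x "{0..1}"], of "1/w^2"]]
        by (simp add: B_def D_def)
      have "(W has_vector_derivative - (chr n x * (of_real (poly B x) / w + of_real (poly D x) / w^2)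
           + (- w * chr n x) * (of_real (poly A x) / w + of_real (poly B x) / w^2))) (at x within {0..1})"
        unfolding W_def
        by (intro has_vector_derivative_minus has_vector_derivative_mult d1)
           (use chr_deriv[of n x] in \<open>simp add: w_def\<close>)
      moreover have "- (chr n x * (of_real (poly B x) / w + of_real (poly D x) / w^2)
           + (- w * chr n x) * (of_real (poly A x) / w + of_real (poly B x) / w^2))
         = chr n x * of_real (poly A x) - chr n x * of_real (poly D x) / w^2"
        using w0 by (simp add: field_simps power2_eq_square)
      ultimately show ?thesis by simp
    qed
    have ftc: "((\<lambda>x. chr n x * of_real (poly A x) - chr n x * of_real (poly D x) / w^2) has_integral (W 1 - W 0)) {0..1}"
      by (rule fundamental_theorem_of_calculus) (use W in auto)
    have W01: "W 1 - W 0 = (of_real (poly B 0) - of_real (poly B 1)) / w^2"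
      using chr_of_int[of n 1] chr_of_int[of n 0] A0 by (simp add: W_def diff_divide_distrib)
    have iD: "(\<lambda>x. chr n x * of_real (poly D x) / w^2) integrable_on {0..1}"
      by (intro integrable_continuous_interval continuous_intros cont) (use w0 in auto)
    have nD: "norm (integral {0..1} (\<lambda>x. chr n x * of_real (poly D x) / w^2)) \<le> (M / norm w ^ 2) * (1 - 0)"
    proof (rule integral_bound)
      show "continuous_on {0..1} (\<lambda>x. chr n x * of_real (poly D x) / w^2)"
        by (intro continuous_intros cont) (use w0 in auto)
      show "norm (chr n x * of_real (poly D x) / w^2) \<le> M / norm w ^ 2" if "x \<in> {0..1}" for x
        using M[OF that] by (simp add: norm_mult norm_divide norm_power divide_right_mono)
    qed simp
    have iA: "((\<lambda>x. chr n x * of_real (poly A x)) has_integral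
        (W 1 - W 0 + integral {0..1} (\<lambda>x. chr n x * of_real (poly D x) / w^2))) {0..1}"
      using has_integral_add[OF ftc integrable_integral[OF iD]] by simp
    have L: "(\<integral>x. chr n x * of_real (indicator {0<..<1} x * poly A x) \<partial>lborel)
        = integral {0..1} (\<lambda>x. chr n x * of_real (poly A x))"
    proof -
      have "set_integrable lborel {0..1} (\<lambda>x. chr n x * of_real (poly A x))"
        by (intro borel_integrable_atLeastAtMost') (intro continuous_intros cont)
      then have "set_lebesgue_integral lborel {0..1} (\<lambda>x. chr n x * of_real (poly A x))
         = integral {0..1} (\<lambda>x. chr n x * of_real (poly A x))"
        by (rule set_borel_integral_eq_integral)
      moreover have "set_lebesgue_integral lborel {0..1} (\<lambda>x. chr n x * of_real (poly A x))
        = (\<integral>x. chr n x * of_real (indicator {0<..<1} x * poly A x) \<partial>lborel)"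
        unfolding set_lebesgue_integral_def
        by (intro Bochner_Integration.integral_cong refl) (auto simp: indicator_def A0 order_less_le)
      ultimately show ?thesis by simp
    qed
    have n2: "norm w ^ 2 \<ge> (of_int n)\<^sup>2"
    proof -
      have "1 \<le> 2 * pi" using pi_gt3 by simp
      then have "1 * \<bar>of_int n\<bar> \<le> norm w" unfolding nw by (intro mult_right_mono) auto
      then have "\<bar>of_int n\<bar>\<^sup>2 \<le> norm w ^ 2" by (intro power_mono) auto
      then show ?thesis by simp
    qed
    have "norm (\<integral>x. chr n x * of_real (indicator {0<..<1} x * poly A x) \<partial>lborel)
       \<le> norm (W 1 - W 0) + norm (integral {0..1} (\<lambda>x. chr n x * of_real (poly D x) / w^2))"
      unfolding L integral_unique[OF iA] by (rule norm_triangle_ineq)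
    also have "\<dots> \<le> (\<bar>poly B 0\<bar> + \<bar>poly B 1\<bar>) / norm w ^ 2 + M / norm w ^ 2"
    proof (rule add_mono)
      have "norm (complex_of_real (poly B 0) - of_real (poly B 1)) \<le> \<bar>poly B 0\<bar> + \<bar>poly B 1\<bar>"
        using norm_triangle_ineq4[of "complex_of_real (poly B 0)" "of_real (poly B 1)"] by simp
      then show "norm (W 1 - W 0) \<le> (\<bar>poly B 0\<bar> + \<bar>poly B 1\<bar>) / norm w ^ 2"
        unfolding W01 by (simp add: norm_divide norm_power divide_right_mono)
    qed (use nD in simp)
    also have "\<dots> = K / norm w ^ 2" by (simp add: K_def add_divide_distrib)
    also have "\<dots> \<le> K / (of_int n)\<^sup>2"
      using n n2 w0 \<open>0 \<le> K\<close> by (intro divide_left_mono) auto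
    finally show "norm (\<integral>x. chr n x * of_real (indicator {0<..<1} x * poly A x) \<partial>lborel) \<le> K / (of_int n)\<^sup>2" .
  qed
qed

lemma chr_orthogonal:
  "(\<integral>x. chr n x * (indicator {0<..<1} x *\<^sub>R cnj (chr m x)) \<partial>lborel) = (if n = m then 1 else 0)"
proof -
  have eq: "chr n x * (indicator {0<..<1} x *\<^sub>R cnj (chr m x)) = indicator {0<..<1} x *\<^sub>R chr (n - m) x" for x
    by (simp add: chr_def cis_cnj cis_mult algebra_simps indicator_def)
  show ?thesis
  proof (cases "n = m")
    case True
    have "(\<integral>x. indicator {0<..<1::real} x *\<^sub>R (1::complex) \<partial>lborel) = 1"
      by (subst integral_scaleR_left) (auto intro: integrable_real_indicator simp: measure_def)
    moreover have "chr 0 x = 1" for x by (simp add: chr_def)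
    ultimately show ?thesis using True unfolding eq by simp
  next
    case False
    define w where "w = 2 * pi * of_int (n - m) * \<i>"
    have w0: "w \<noteq> 0" using False by (simp add: w_def)
    have d: "((\<lambda>x. - chr (n - m) x / w) has_vector_derivative chr (n - m) x) (at x within {0..1})" for x
    proof -
      have "((\<lambda>x. chr (n - m) x * (- 1 / w)) has_vector_derivative
          (- (2 * pi * of_int (n - m) * \<i>) * chr (n - m) x) * (- 1 / w)) (at x within {0..1})"
        by (rule has_vector_derivative_mult_left[OF chr_has_vector_derivative])
      moreover have "(- (2 * pi * of_int (n - m) * \<i>) * chr (n - m) x) * (- 1 / w) = chr (n - m) x"
        unfolding w_def[symmetric] using w0 by simp
      ultimately show ?thesis by simp
    qed
    have "(chr (n - m) has_integral (- chr (n - m) 1 / w - (- chr (n - m) 0 / w))) {0..1}"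
      by (rule fundamental_theorem_of_calculus) (use d in auto)
    then have i: "integral {0..1} (chr (n - m)) = 0"
      using chr_of_int[of "n - m" 1] chr_of_int[of "n - m" 0] by (simp add: integral_unique)
    have c: "continuous_on {0..1} (chr (n - m))" unfolding chr_def by (intro continuous_intros)
    have "set_integrable lborel {0..1} (chr (n - m))"
      by (intro borel_integrable_atLeastAtMost') (rule c)
    then have "set_lebesgue_integral lborel {0..1} (chr (n - m)) = 0"
      using i by (simp add: set_borel_integral_eq_integral(2))
    moreover have "(\<integral>x. indicator {0<..<1} x *\<^sub>R chr (n - m) x \<partial>lborel)
        = set_lebesgue_integral lborel {0..1} (chr (n - m))"
      unfolding set_lebesgue_integral_def
    proof (rule integral_cong_AE)
      show "AE x in lborel. indicator {0<..<1} x *\<^sub>R chr (n - m) x = indicator {0..1} x *\<^sub>R chr (n - m) x"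
        using AE_lborel_singleton[of 0] AE_lborel_singleton[of 1]
        by eventually_elim (auto simp: indicator_def)
    qed measurable
    ultimately show ?thesis using False unfolding eq by simp
  qed
qed

lemma int_decode_lower: "real k \<le> 2 * \<bar>real_of_int (int_decode k)\<bar>"
proof -
  obtain n where k: "k = int_encode n" by (metis int_decode_inverse)
  show ?thesis unfolding k int_encode_inverse
    by (auto simp: int_encode_def sum_encode_def)
qed

text \<open>A sequence of order $n^{-2}$ is absolutely summable, hence the coefficients of a uniformly
  convergent trigonometric series.\<close>

lemma L1_coeffs_of_decay:
  assumes b: "\<And>n. n \<noteq> 0 \<Longrightarrow> norm (b n) \<le> K / (of_int n)\<^sup>2"
  shows "\<exists>C. L1_coeffs C b"
proof -
  define a where "a = (\<lambda>k n. if n = int_decode k then b n else 0)"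
  have A: "L1_coeffs (norm (b (int_decode k))) (a k)" for k
  proof -
    define m where "m = int_decode k"
    define u where "u = (\<lambda>x. indicator {0<..<1} x *\<^sub>R cnj (chr m x))"
    have [measurable]: "(\<lambda>x. cnj (chr m x)) \<in> borel_measurable borel"
      by (intro borel_measurable_continuous_onI) (auto simp: chr_def intro!: continuous_intros)
    have [measurable]: "u \<in> borel_measurable borel" unfolding u_def by measurable
    have int: "integrable lborel u" unfolding u_def
      by (rule integrableI_bounded_set_indicator[where B=1]) auto
    have supp: "u x = 0" if "x \<notin> {0<..<1}" for x using that by (simp add: u_def)
    have "(\<integral>x. norm (b m * u x) \<partial>lborel) = (\<integral>x. norm (b m) * indicator {0<..<1::real} x \<partial>lborel)"
      by (intro Bochner_Integration.integral_cong refl) (auto simp: norm_mult indicator_def u_def)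
    also have "\<dots> = norm (b m)" by (simp add: measure_def)
    finally have n: "(\<integral>x. norm (b m * u x) \<partial>lborel) = norm (b m)" .
    have f: "(\<integral>x. chr n x * (b m * u x) \<partial>lborel) = a k n" for n
    proof -
      have "(\<integral>x. chr n x * (b m * u x) \<partial>lborel) = b m * (\<integral>x. chr n x * u x \<partial>lborel)"
        by (subst integral_mult_right_zero[symmetric]) (simp add: mult_ac)
      then show ?thesis unfolding u_def chr_orthogonal by (simp add: a_def m_def)
    qed
    show ?thesis unfolding L1_coeffs_def m_def[symmetric]
      by (intro exI[of _ "\<lambda>x. b m * u x"]) (use int n f supp in auto)
  qed
  have sum: "summable (\<lambda>k. norm (b (int_decode k)))"
  proof (rule summable_comparison_test)
    have "summable (\<lambda>k. (4 * K) * (1 / (real k)\<^sup>2))"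
      using inverse_power_summable[of 2, where 'a=real] by (intro summable_mult) (simp add: field_simps)
    then show "summable (\<lambda>k. 4 * K / (real k)\<^sup>2)" by simp
    show "\<exists>N. \<forall>k\<ge>N. norm (norm (b (int_decode k))) \<le> 4 * K / (real k)\<^sup>2"
    proof (intro exI allI impI)
      fix k :: nat assume "1 \<le> k"
      let ?n = "int_decode k"
      have l: "real k \<le> 2 * \<bar>of_int ?n\<bar>" by (rule int_decode_lower)
      then have n0: "?n \<noteq> 0" using \<open>1 \<le> k\<close> by auto
      have "0 \<le> K / (of_int ?n)\<^sup>2" using b[OF n0] norm_ge_zero order_trans by blast
      then have K: "0 \<le> K" using n0 by (simp add: zero_le_divide_iff)
      have "(real k)\<^sup>2 \<le> (2 * \<bar>of_int ?n\<bar>)\<^sup>2" using l by (intro power_mono) auto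
      then have "(real k)\<^sup>2 \<le> 4 * (of_int ?n)\<^sup>2" by (simp add: power_mult_distrib)
      then have "4 * K / (4 * (of_int ?n)\<^sup>2) \<le> 4 * K / (real k)\<^sup>2"
        using K \<open>1 \<le> k\<close> n0 by (intro divide_left_mono) auto
      then show "norm (norm (b ?n)) \<le> 4 * K / (real k)\<^sup>2" using b[OF n0] by simp
    qed
  qed
  have "b = (\<lambda>n. \<Sum>k. a k n)"
  proof
    fix n
    have "(\<Sum>k. a k n) = (\<Sum>k\<in>{int_encode n}. a k n)"
      by (rule suminf_finite) (auto simp: a_def)
    then show "b n = (\<Sum>k. a k n)" by (simp add: a_def)
  qed
  then show ?thesis using L1_coeffs_suminf(1)[OF A sum] by auto
qed

text \<open>Up to an error of arbitrarily small $L_1$ norm, every coefficient sequence is of order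
  $n^{-2}$.\<close>

lemma L1_coeffs_split:
  assumes a: "L1_coeffs C a" and e: "0 < e"
  obtains r b K where "L1_coeffs e r" "\<And>n. a n = r n + b n" "0 \<le> K" "\<And>n. n \<noteq> 0 \<Longrightarrow> norm (b n) \<le> K / (of_int n)\<^sup>2"
proof -
  obtain g where g: "g \<in> borel_measurable borel" "\<And>x. x \<notin> {0<..<1} \<Longrightarrow> g x = 0"
     "integrable lborel g" "\<And>n. a n = (\<integral>x. chr n x * g x \<partial>lborel)" using assms unfolding L1_coeffs_def by blast
  note [measurable] = g(1)
  obtain A where A: "poly A 0 = 0" "poly A 1 = 0"
    "(\<integral>x. \<bar>Re (g x) - indicator {0<..<1} x * poly A x\<bar> \<partial>lborel) < e/2"
    using poly_dense_L1[of "\<lambda>x. Re (g x)" "e/2"] g e by auto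
  obtain B where B: "poly B 0 = 0" "poly B 1 = 0"
    "(\<integral>x. \<bar>Im (g x) - indicator {0<..<1} x * poly B x\<bar> \<partial>lborel) < e/2"
    using poly_dense_L1[of "\<lambda>x. Im (g x)" "e/2"] g e by auto
  have [measurable]: "(\<lambda>x. poly A x) \<in> borel_measurable borel" "(\<lambda>x. poly B x) \<in> borel_measurable borel"
    by (intro borel_measurable_continuous_onI continuous_intros)+
  have intp: "integrable lborel (\<lambda>x. indicator {0<..<1} x * poly A x)" for A :: "real poly"
  proof -
    obtain K where K: "\<And>x. x \<in> {0..1} \<Longrightarrow> \<bar>poly A x\<bar> \<le> K"
      by (rule poly_bounded_unit_interval[of A]) blast
    have [measurable]: "(\<lambda>x. poly A x) \<in> borel_measurable borel"
      by (intro borel_measurable_continuous_onI continuous_intros)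
    have "integrable lborel (\<lambda>x. indicator {0<..<1} x *\<^sub>R poly A x)"
      by (rule integrableI_bounded_set_indicator[where B="K"]) (use K in auto)
    then show ?thesis by simp
  qed
  define u where "u = (\<lambda>x. complex_of_real (indicator {0<..<1} x * poly A x))"
  define v where "v = (\<lambda>x. complex_of_real (indicator {0<..<1} x * poly B x))"
  have [measurable]: "u \<in> borel_measurable borel" "v \<in> borel_measurable borel" unfolding u_def v_def by measurable
  have uv: "integrable lborel u" "integrable lborel v"
    unfolding u_def v_def by (intro integrable_of_real intp)+
  obtain K1 where K1: "0 \<le> K1" "\<And>n. n \<noteq> 0 \<Longrightarrow> norm (\<integral>x. chr n x * u x \<partial>lborel) \<le> K1 / (of_int n)\<^sup>2"
    using fourier_poly_decay[OF A(1,2)] unfolding u_def by metis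
  obtain K2 where K2: "0 \<le> K2" "\<And>n. n \<noteq> 0 \<Longrightarrow> norm (\<integral>x. chr n x * v x \<partial>lborel) \<le> K2 / (of_int n)\<^sup>2"
    using fourier_poly_decay[OF B(1,2)] unfolding v_def by metis
  define b where "b = (\<lambda>n. (\<integral>x. chr n x * u x \<partial>lborel) + \<i> * (\<integral>x. chr n x * v x \<partial>lborel))"
  define R where "R = (\<lambda>x. g x - (u x + \<i> * v x))"
  have Rint: "integrable lborel R" unfolding R_def using g(3) uv by auto
  have [measurable]: "R \<in> borel_measurable borel" unfolding R_def by measurable
  have "(\<integral>x. norm (R x) \<partial>lborel) \<le> (\<integral>x. \<bar>Re (g x) - indicator {0<..<1} x * poly A x\<bar>
        + \<bar>Im (g x) - indicator {0<..<1} x * poly B x\<bar> \<partial>lborel)"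
  proof (rule integral_mono)
    show "integrable lborel (\<lambda>x. \<bar>Re (g x) - indicator {0<..<1} x * poly A x\<bar>
        + \<bar>Im (g x) - indicator {0<..<1} x * poly B x\<bar>)"
      using g(3) intp by auto
    show "norm (R x) \<le> \<bar>Re (g x) - indicator {0<..<1} x * poly A x\<bar>
        + \<bar>Im (g x) - indicator {0<..<1} x * poly B x\<bar>" for x
      using cmod_le[of "R x"] by (simp add: R_def u_def v_def)
  qed (use Rint in simp)
  also have "\<dots> = (\<integral>x. \<bar>Re (g x) - indicator {0<..<1} x * poly A x\<bar> \<partial>lborel)
        + (\<integral>x. \<bar>Im (g x) - indicator {0<..<1} x * poly B x\<bar> \<partial>lborel)"
    using g(3) intp by (intro Bochner_Integration.integral_add) auto
  also have "\<dots> \<le> e" using A B by simp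
  finally have Re: "(\<integral>x. norm (R x) \<partial>lborel) \<le> e" .
  have rn: "(\<integral>x. chr n x * R x \<partial>lborel) = a n - b n" for n
  proof -
    have "chr n x * R x = chr n x * g x - (chr n x * u x + \<i> * (chr n x * v x))" for x
      by (simp add: R_def algebra_simps)
    moreover have "integrable lborel (\<lambda>x. chr n x * g x)" "integrable lborel (\<lambda>x. chr n x * u x)"
       "integrable lborel (\<lambda>x. chr n x * v x)"
      using g uv by (auto intro: integrable_chr_mult)
    ultimately show ?thesis by (simp add: g(4) b_def)
  qed
  show ?thesis
  proof (rule that[of "\<lambda>n. a n - b n" b "K1 + K2"])
    show "L1_coeffs e (\<lambda>n. a n - b n)"
      unfolding L1_coeffs_def
      by (intro exI[of _ R]) (use Rint Re rn g(2) in \<open>auto simp: R_def u_def v_def\<close>)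
    fix n :: int assume "n \<noteq> 0"
    have "norm (b n) \<le> norm (\<integral>x. chr n x * u x \<partial>lborel) + norm (\<integral>x. chr n x * v x \<partial>lborel)"
      unfolding b_def by (rule order_trans[OF norm_triangle_ineq]) (simp add: norm_mult)
    then show "norm (b n) \<le> (K1 + K2) / (of_int n)\<^sup>2"
      using K1(2)[OF \<open>n \<noteq> 0\<close>] K2(2)[OF \<open>n \<noteq> 0\<close>] by (simp add: add_divide_distrib)
  qed (use K1 K2 in auto)
qed

text \<open>As $b_n$ tends to zero and no $1 + b_n$ vanishes, these numbers are bounded away from zero; so the
  division does not affect the order of decay.\<close>

lemma decay_inverse:
  assumes b: "\<And>n. n \<noteq> 0 \<Longrightarrow> norm (b n) \<le> K / (of_int n)\<^sup>2" and K: "0 \<le> K"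
    and nz: "\<And>n. 1 + b n \<noteq> 0"
  obtains C where "L1_coeffs C (\<lambda>n. b n / (1 + b n))"
proof -
  obtain N :: nat where N: "2 * K \<le> real N" by (meson real_arch_simple)
  define S where "S = {- int N .. int N}"
  define c where "c = Min (insert (1/2) ((\<lambda>n. norm (1 + b n)) ` S))"
  have fin: "finite (insert (1/2) ((\<lambda>n. norm (1 + b n)) ` S))" by (simp add: S_def)
  have c: "0 < c" unfolding c_def using nz by (subst Min_gr_iff[OF fin]) auto
  have cl: "c \<le> norm (1 + b n)" for n
  proof (cases "n \<in> S")
    case True
    then show ?thesis unfolding c_def by (intro Min_le[OF fin]) auto
  next
    case False
    then have n: "n \<noteq> 0" "real N \<le> \<bar>of_int n\<bar>" "1 \<le> \<bar>of_int n :: real\<bar>" by (auto simp: S_def)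
    have "2 * K \<le> \<bar>of_int n\<bar> * 1" using N n by simp
    also have "\<dots> \<le> \<bar>of_int n\<bar> * \<bar>of_int n\<bar>" using n by (intro mult_left_mono) auto
    also have "\<dots> = (of_int n)\<^sup>2" by (simp add: power2_eq_square)
    finally have "K / (of_int n)\<^sup>2 \<le> 1/2" using n by (simp add: divide_le_eq)
    then have "norm (b n) \<le> 1/2" using b[OF n(1)] by linarith
    then have "1/2 \<le> norm (1 + b n)"
      using norm_triangle_ineq4[of "1 + b n" "b n"] by simp
    moreover have "c \<le> 1/2" unfolding c_def by (intro Min_le[OF fin]) auto
    ultimately show ?thesis by simp
  qed
  have "norm (b n / (1 + b n)) \<le> (K / c) / (of_int n)\<^sup>2" if "n \<noteq> 0" for n
  proof -
    have "norm (b n / (1 + b n)) = norm (b n) / norm (1 + b n)" by (rule norm_divide)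
    also have "\<dots> \<le> (K / (of_int n)\<^sup>2) / c"
      using b[OF that] c cl[of n] K by (intro frac_le) auto
    finally show ?thesis by (simp add: mult.commute)
  qed
  then have "\<exists>C. L1_coeffs C (\<lambda>n. b n / (1 + b n))" by (rule L1_coeffs_of_decay)
  then show ?thesis using that by blast
qed

text \<open>The small part of \<open>L1_coeffs_split\<close> is inverted by the Neumann series. After division by it
  what remains is one plus a sequence of order $n^{-2}$, for which inversion is elementary.\<close>

theorem wiener_lemma:
  assumes a: "L1_coeffs C a" and nz: "\<And>n. 1 + a n \<noteq> 0"
  obtains D s where "L1_coeffs D s" "\<And>n. 1 / (1 + a n) = 1 + s n"
proof -
  obtain r b K where r: "L1_coeffs (1/2) r" and ab: "\<And>n. a n = r n + b n" and K: "0 \<le> K"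
    "\<And>n. n \<noteq> 0 \<Longrightarrow> norm (b n) \<le> K / (of_int n)\<^sup>2"
    using L1_coeffs_split[OF a, of "1/2"] by auto
  obtain D s where s: "L1_coeffs D s" "\<And>n. 1 / (1 + r n) = 1 + s n"
    using L1_coeffs_inverse_small[OF r] by auto
  have r1: "1 + r n \<noteq> 0" for n
  proof
    assume "1 + r n = 0"
    then have "r n = -1" by (simp add: eq_neg_iff_add_eq_0 add.commute)
    then show False using L1_coeffs_bound[OF r, of n] by simp
  qed
  \<comment> \<open>The quotient of $1 + a_n$ by $1 + r_n$ is $1 + b'_n$.\<close>
  define b' where "b' = (\<lambda>n. b n * (1 + s n))"
  have b1: "(1 + r n) * (1 + b' n) = 1 + a n" for n
  proof -
    have "(1 + r n) * (1 + s n) = 1" using r1[of n] s(2)[of n] by (metis nonzero_eq_divide_eq mult.commute)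
    moreover have "(1 + r n) * (1 + b' n) = (1 + r n) + b n * ((1 + r n) * (1 + s n))"
      by (simp add: b'_def algebra_simps)
    ultimately show ?thesis using ab[of n] by simp
  qed
  have nb: "1 + b' n \<noteq> 0" for n using b1[of n] nz[of n] by auto
  have D: "0 \<le> D" using L1_coeffs_bound[OF s(1), of 0] norm_ge_zero order_trans by blast
  have kb: "norm (b' n) \<le> (K * (1 + D)) / (of_int n)\<^sup>2" if "n \<noteq> 0" for n
  proof -
    have "norm (1 + s n) \<le> 1 + D"
      using norm_triangle_ineq[of 1 "s n"] L1_coeffs_bound[OF s(1), of n] by simp
    then have "norm (b n) * norm (1 + s n) \<le> (K / (of_int n)\<^sup>2) * (1 + D)"
      using K D by (intro mult_mono K(2)[OF that]) auto
    then show ?thesis by (simp add: b'_def norm_mult)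
  qed
  obtain E where E: "L1_coeffs E (\<lambda>n. b' n / (1 + b' n))"
    using decay_inverse[OF kb _ nb] K D by auto
  let ?t = "\<lambda>n. b' n / (1 + b' n)"
  have "L1_coeffs (D + (norm (-1::complex) * E + norm (-1::complex) * (D * E))) (\<lambda>n. s n + (-1 * ?t n + -1 * (s n * ?t n)))"
    by (intro L1_coeffs_add s(1) L1_coeffs_cmult E L1_coeffs_mult)
  moreover have "1 / (1 + a n) = 1 + (s n + (-1 * ?t n + -1 * (s n * ?t n)))" for n
  proof -
    have "1 / (1 + a n) = (1 / (1 + r n)) * (1 / (1 + b' n))"
      unfolding b1[of n, symmetric] by simp
    also have "1 / (1 + b' n) = 1 - ?t n" using nb[of n] by (simp add: field_simps)
    finally show ?thesis unfolding s(2) by (simp add: algebra_simps add_divide_distrib)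
  qed
  ultimately show ?thesis by (rule that)
qed

section \<open>The linear Volterra system and its kernel\<close>

definition phase :: "real \<Rightarrow> real \<Rightarrow> complex" where
  "phase l t = cis (- (2 * l * t))"

lemma norm_phase [simp]: "norm (phase l t) = 1"
  by (simp add: phase_def)

lemma phase_measurable [measurable]: "phase l \<in> borel_measurable borel"
  by (intro borel_measurable_continuous_onI) (auto simp: phase_def[abs_def] intro!: continuous_intros)

lemma phase_add: "phase l (s + t) = phase l s * phase l t"
  by (simp add: phase_def cis_mult algebra_simps)

lemma cnj_phase: "cnj (phase l t) = phase l (- t)"
  by (simp add: phase_def cis_cnj)

lemma indicator_atMost_measurable [measurable (raw)]:
  fixes f g :: "'a \<Rightarrow> real"
  assumes [measurable]: "f \<in> borel_measurable M" "g \<in> borel_measurable M"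
  shows "(\<lambda>x. indicator {..f x} (g x) :: ennreal) \<in> borel_measurable M"
    and "(\<lambda>x. indicator {..f x} (g x) :: real) \<in> borel_measurable M"
  unfolding indicator_def atMost_iff by measurable

lemma indicator_greaterThanAtMost_measurable [measurable (raw)]:
  fixes f g h :: "'a \<Rightarrow> real"
  assumes [measurable]: "f \<in> borel_measurable M" "g \<in> borel_measurable M" "h \<in> borel_measurable M"
  shows "(\<lambda>x. indicator {f x<..h x} (g x) :: ennreal) \<in> borel_measurable M"
  unfolding indicator_def greaterThanAtMost_iff by measurable

lemma nn_integral_shift:
  fixes f :: "real \<Rightarrow> ennreal"
  assumes [measurable]: "f \<in> borel_measurable borel"
  shows "(\<integral>\<^sup>+s. f (s + t) \<partial>lborel) = (\<integral>\<^sup>+s. f s \<partial>lborel)"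
  by (subst (2) nn_integral_real_affine[where c=1 and t=t]) (auto simp: add.commute)

lemma nn_integral_reflect:
  fixes f :: "real \<Rightarrow> ennreal"
  assumes [measurable]: "f \<in> borel_measurable borel"
  shows "(\<integral>\<^sup>+s. f (- s) \<partial>lborel) = (\<integral>\<^sup>+s. f s \<partial>lborel)"
  by (subst (2) nn_integral_real_affine[where c="-1" and t=0]) auto

lemma integral_shift:
  fixes f :: "real \<Rightarrow> complex"
  shows "(\<integral>s. f (s + t) \<partial>lborel) = (\<integral>s. f s \<partial>lborel)"
  by (subst (2) lborel_integral_real_affine[where c=1 and t=t]) (auto simp: add.commute)

lemma integral_reflect_line:
  fixes f :: "real \<Rightarrow> complex"
  shows "(\<integral>s. f (- s) \<partial>lborel) = (\<integral>s. f s \<partial>lborel)"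
  by (subst (2) lborel_integral_real_affine[where c="-1" and t=0]) auto

text \<open>The potential enters only through the complex function $q = q_2 - i q_1$.\<close>

locale potential =
  fixes q :: "real \<Rightarrow> complex"
  assumes q_meas [measurable]: "q \<in> borel_measurable borel"
    and q_supp: "\<And>x. x \<notin> {0<..<1} \<Longrightarrow> q x = 0"
    and q_int: "integrable lborel q"
begin

definition Phi :: "real \<Rightarrow> real" where
  "Phi x = (\<integral>t. indicator {..x} t * norm (q t) \<partial>lborel)"

lemma q_restrict_int: "integrable lborel (\<lambda>t. indicator {..x} t * norm (q t))"
  by (rule Bochner_Integration.integrable_bound[OF q_int]) (auto simp: indicator_def)

lemma Phi_nonneg: "0 \<le> Phi x"
  unfolding Phi_def by (intro integral_nonneg_AE) auto

lemma Phi_nn: "(\<integral>\<^sup>+t. indicator {..x} t * ennreal (norm (q t)) \<partial>lborel) = ennreal (Phi x)"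
proof -
  have "(\<integral>\<^sup>+t. indicator {..x} t * ennreal (norm (q t)) \<partial>lborel)
      = (\<integral>\<^sup>+t. ennreal (indicator {..x} t * norm (q t)) \<partial>lborel)"
    by (intro nn_integral_cong) (auto simp: indicator_def)
  also have "\<dots> = ennreal (Phi x)" unfolding Phi_def
    by (intro nn_integral_eq_integral q_restrict_int) auto
  finally show ?thesis .
qed

lemma Phi_mono: "x \<le> y \<Longrightarrow> Phi x \<le> Phi y"
  unfolding Phi_def by (intro integral_mono q_restrict_int) (auto simp: indicator_def)

lemma Phi_measurable [measurable]: "Phi \<in> borel_measurable borel"
  by (rule borel_measurable_mono) (simp add: mono_def Phi_mono)

text \<open>This says $(k+1) \int_0^x \Phi' \Phi^k = \Phi(x)^{k+1}$ for the absolutely continuous $\Phi$. It is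
  proved without differentiation: insert the formula for $k$ into the integral for $k + 1$ and
  interchange the order of integration. The two orderings of the variables add up to
  $\Phi(x) \int \Phi' \Phi^k$.\<close>

lemma Phi_power:
  "of_nat (Suc k) * (\<integral>\<^sup>+t. indicator {..x} t * ennreal (norm (q t)) * ennreal (Phi t) ^ k \<partial>lborel)
     = ennreal (Phi x) ^ Suc k"
proof (induction k arbitrary: x)
  case 0
  then show ?case by (simp add: Phi_nn)
next
  case (Suc k)
  let ?f = "\<lambda>t. ennreal (norm (q t))"
  let ?F = "\<lambda>t. ennreal (Phi t)"
  define R where "R = (\<integral>\<^sup>+t. indicator {..x} t * ?f t * ?F t ^ Suc k \<partial>lborel)"
  have "R = (\<integral>\<^sup>+t. of_nat (Suc k) * (\<integral>\<^sup>+r. indicator {..x} t * ?f t * (indicator {..t} r * ?f r * ?F r ^ k) \<partial>lborel) \<partial>lborel)"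
    unfolding R_def
  proof (rule nn_integral_cong)
    fix t
    have "indicator {..x} t * ?f t * ?F t ^ Suc k
        = of_nat (Suc k) * (indicator {..x} t * ?f t * (\<integral>\<^sup>+r. indicator {..t} r * ?f r * ?F r ^ k \<partial>lborel))"
      unfolding Suc.IH[of t, symmetric] by (simp only: mult_ac)
    also have "indicator {..x} t * ?f t * (\<integral>\<^sup>+r. indicator {..t} r * ?f r * ?F r ^ k \<partial>lborel)
        = (\<integral>\<^sup>+r. indicator {..x} t * ?f t * (indicator {..t} r * ?f r * ?F r ^ k) \<partial>lborel)"
      by (rule nn_integral_cmult[symmetric]) measurable
    finally show "indicator {..x} t * ?f t * ?F t ^ Suc k
        = of_nat (Suc k) * (\<integral>\<^sup>+r. indicator {..x} t * ?f t * (indicator {..t} r * ?f r * ?F r ^ k) \<partial>lborel)" .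
  qed
  also have "\<dots> = of_nat (Suc k) * (\<integral>\<^sup>+t. \<integral>\<^sup>+r. indicator {..x} t * ?f t * (indicator {..t} r * ?f r * ?F r ^ k) \<partial>lborel \<partial>lborel)"
    by (rule nn_integral_cmult) measurable
  also have "(\<integral>\<^sup>+t. \<integral>\<^sup>+r. indicator {..x} t * ?f t * (indicator {..t} r * ?f r * ?F r ^ k) \<partial>lborel \<partial>lborel)
     = (\<integral>\<^sup>+r. \<integral>\<^sup>+t. indicator {..x} t * ?f t * (indicator {..t} r * ?f r * ?F r ^ k) \<partial>lborel \<partial>lborel)"
    by (rule nn_integral_swap[where F="\<lambda>(t,r). indicator {..x} t * ?f t * (indicator {..t} r * ?f r * ?F r ^ k)",
          simplified, symmetric]) measurable
  also have "\<dots> = (\<integral>\<^sup>+r. indicator {..x} r * ?f r * ?F r ^ k * (\<integral>\<^sup>+t. indicator {r<..x} t * ?f t \<partial>lborel) \<partial>lborel)"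
  proof (rule nn_integral_cong)
    fix r
    have "(\<integral>\<^sup>+t. indicator {..x} t * ?f t * (indicator {..t} r * ?f r * ?F r ^ k) \<partial>lborel)
       = (\<integral>\<^sup>+t. (indicator {..x} r * ?f r * ?F r ^ k) * (indicator {r<..x} t * ?f t) \<partial>lborel)"
      using AE_lborel_singleton[of r]
      by (intro nn_integral_cong_AE) (auto elim!: eventually_mono simp: indicator_def mult_ac)
    also have "\<dots> = indicator {..x} r * ?f r * ?F r ^ k * (\<integral>\<^sup>+t. indicator {r<..x} t * ?f t \<partial>lborel)"
      by (rule nn_integral_cmult) measurable
    finally show "(\<integral>\<^sup>+t. indicator {..x} t * ?f t * (indicator {..t} r * ?f r * ?F r ^ k) \<partial>lborel) = \<dots>" .
  qed
  finally have R1: "R = of_nat (Suc k) * (\<integral>\<^sup>+r. indicator {..x} r * ?f r * ?F r ^ k * (\<integral>\<^sup>+t. indicator {r<..x} t * ?f t \<partial>lborel) \<partial>lborel)" .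
  \<comment> \<open>The other ordering of the two variables.\<close>
  have R2: "of_nat (Suc k) * R = of_nat (Suc k) * (\<integral>\<^sup>+r. indicator {..x} r * ?f r * ?F r ^ k * ?F r \<partial>lborel)"
    by (simp add: R_def mult_ac)
  have m: "(\<lambda>r. \<integral>\<^sup>+t. indicator {r<..x} t * ?f t \<partial>lborel) \<in> borel_measurable borel"
    by measurable
  have "of_nat (Suc (Suc k)) * R = R + of_nat (Suc k) * R"
    by (simp add: algebra_simps)
  also have "\<dots> = of_nat (Suc k) * ((\<integral>\<^sup>+r. indicator {..x} r * ?f r * ?F r ^ k * (\<integral>\<^sup>+t. indicator {r<..x} t * ?f t \<partial>lborel) \<partial>lborel)
      + (\<integral>\<^sup>+r. indicator {..x} r * ?f r * ?F r ^ k * ?F r \<partial>lborel))"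
    unfolding R2 by (subst (1) R1) (simp only: distrib_left)
  also have "(\<integral>\<^sup>+r. indicator {..x} r * ?f r * ?F r ^ k * (\<integral>\<^sup>+t. indicator {r<..x} t * ?f t \<partial>lborel) \<partial>lborel)
      + (\<integral>\<^sup>+r. indicator {..x} r * ?f r * ?F r ^ k * ?F r \<partial>lborel)
      = (\<integral>\<^sup>+r. indicator {..x} r * ?f r * ?F r ^ k * (\<integral>\<^sup>+t. indicator {r<..x} t * ?f t \<partial>lborel)
           + indicator {..x} r * ?f r * ?F r ^ k * ?F r \<partial>lborel)"
    using m by (intro nn_integral_add[symmetric]) measurable
  also have "\<dots> = (\<integral>\<^sup>+r. (indicator {..x} r * ?f r * ?F r ^ k) * ?F x \<partial>lborel)"
  proof (rule nn_integral_cong)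
    fix r
    have "(\<integral>\<^sup>+t. indicator {r<..x} t * ?f t \<partial>lborel) + ?F r = ?F x" if "r \<le> x"
    proof -
      have "?F x = (\<integral>\<^sup>+t. indicator {r<..x} t * ?f t + indicator {..r} t * ?f t \<partial>lborel)"
        unfolding Phi_nn[symmetric] using that by (intro nn_integral_cong) (auto simp: indicator_def)
      also have "\<dots> = (\<integral>\<^sup>+t. indicator {r<..x} t * ?f t \<partial>lborel) + ?F r"
        by (subst nn_integral_add) (auto simp: Phi_nn)
      finally show ?thesis by simp
    qed
    then show "indicator {..x} r * ?f r * ?F r ^ k * (\<integral>\<^sup>+t. indicator {r<..x} t * ?f t \<partial>lborel)
           + indicator {..x} r * ?f r * ?F r ^ k * ?F r = (indicator {..x} r * ?f r * ?F r ^ k) * ?F x"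
      by (cases "r \<le> x") (auto simp: distrib_left[symmetric])
  qed
  also have "\<dots> = (\<integral>\<^sup>+r. indicator {..x} r * ?f r * ?F r ^ k \<partial>lborel) * ?F x"
    by (rule nn_integral_multc) measurable
  finally have "of_nat (Suc (Suc k)) * R = of_nat (Suc k) * ((\<integral>\<^sup>+r. indicator {..x} r * ?f r * ?F r ^ k \<partial>lborel) * ?F x)" .
  also have "\<dots> = ?F x ^ Suc k * ?F x"
    by (simp only: mult.assoc[symmetric] Suc.IH)
  finally show ?case unfolding R_def by (simp only: power_Suc2)
qed

text \<open>One integration against $2|q|$ raises the index in $(2\Phi)^k/k!$; this is why the Picard series
  converges absolutely.\<close>

lemma Phi_fact:
  "(\<integral>\<^sup>+t. indicator {..x} t * ennreal (2 * norm (q t)) * ennreal ((2 * Phi t) ^ k / fact k) \<partial>lborel)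
     = ennreal ((2 * Phi x) ^ Suc k / fact (Suc k))"
proof -
  define I where "I = (\<integral>\<^sup>+t. indicator {..x} t * ennreal (norm (q t)) * ennreal (Phi t) ^ k \<partial>lborel)"
  have k: "of_nat (Suc k) * I = ennreal (Phi x ^ Suc k)"
    unfolding I_def Phi_power by (rule ennreal_power) (rule Phi_nonneg)
  have "(\<integral>\<^sup>+t. indicator {..x} t * ennreal (2 * norm (q t)) * ennreal ((2 * Phi t) ^ k / fact k) \<partial>lborel)
     = (\<integral>\<^sup>+t. ennreal (2 ^ Suc k / fact k) * (indicator {..x} t * ennreal (norm (q t)) * ennreal (Phi t) ^ k) \<partial>lborel)"
  proof (rule nn_integral_cong)
    fix t
    have e: "ennreal (2 * norm (q t)) * ennreal ((2 * Phi t) ^ k / fact k)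
       = ennreal (2 ^ Suc k / fact k) * (ennreal (norm (q t)) * ennreal (Phi t) ^ k)"
      using Phi_nonneg[of t]
      by (simp add: ennreal_power ennreal_mult[symmetric] power_mult_distrib field_simps)
    show "indicator {..x} t * ennreal (2 * norm (q t)) * ennreal ((2 * Phi t) ^ k / fact k)
       = ennreal (2 ^ Suc k / fact k) * (indicator {..x} t * ennreal (norm (q t)) * ennreal (Phi t) ^ k)"
      using e by (auto simp: indicator_def)
  qed
  also have "\<dots> = ennreal (2 ^ Suc k / fact k) * I"
    unfolding I_def by (rule nn_integral_cmult) measurable
  also have "ennreal (2 ^ Suc k / fact k) = ennreal (2 ^ Suc k / fact (Suc k)) * of_nat (Suc k)"
    by (simp add: ennreal_of_nat_eq_real_of_nat ennreal_mult[symmetric] field_simps del: of_nat_Suc)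
  also have "\<dots> * I = ennreal (2 ^ Suc k / fact (Suc k)) * ennreal (Phi x ^ Suc k)"
    by (simp only: mult.assoc k)
  also have "\<dots> = ennreal ((2 * Phi x) ^ Suc k / fact (Suc k))"
    using Phi_nonneg[of x] by (simp add: ennreal_mult[symmetric] power_mult_distrib)
  finally show ?thesis .
qed

text \<open>The terms of the Picard series for $P$ and $D$, started from $P = D = 1$, are integrals of
  $e^{-2 i \lambda s}$ against these kernels (\<open>iter_kernel\<close>). In a pair $(x,s)$ the first component is the point of
  the interval and the second the frequency variable. The recursion is the Volterra system with the factor
  $e^{\mp 2 i \lambda t}$ absorbed into a translation of $s$, and conjugation into a reflection; it does not
  contain $\lambda$. The constant term would be a point mass and is left out, so index zero belongs to the first
  iterate.\<close>

fun kerP :: "nat \<Rightarrow> real \<times> real \<Rightarrow> complex" and kerD :: "nat \<Rightarrow> real \<times> real \<Rightarrow> complex" where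
  "kerP 0 = (\<lambda>p. indicator {..fst p} (snd p) *\<^sub>R q (snd p) + indicator {..fst p} (- snd p) *\<^sub>R cnj (q (- snd p)))"
| "kerD 0 = (\<lambda>p. indicator {..fst p} (- snd p) *\<^sub>R (2 * cnj (q (- snd p))))"
| "kerP (Suc k) = (\<lambda>p. \<integral>t. indicator {..fst p} t *\<^sub>R (q t * kerD k (t, snd p - t) + cnj (q t * kerD k (t, - snd p - t))) \<partial>lborel)"
| "kerD (Suc k) = (\<lambda>p. \<integral>t. indicator {..fst p} t *\<^sub>R (2 * cnj (q t) * kerP k (t, snd p + t)) \<partial>lborel)"

text \<open>The same recursion with $|q|$ in place of $q$ and its conjugate. Values in the extended reals make
  all integrals meaningful at every point.\<close>

fun majP :: "nat \<Rightarrow> real \<times> real \<Rightarrow> ennreal" and majD :: "nat \<Rightarrow> real \<times> real \<Rightarrow> ennreal" where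
  "majP 0 = (\<lambda>p. indicator {..fst p} (snd p) * ennreal (norm (q (snd p))) + indicator {..fst p} (- snd p) * ennreal (norm (q (- snd p))))"
| "majD 0 = (\<lambda>p. indicator {..fst p} (- snd p) * ennreal (2 * norm (q (- snd p))))"
| "majP (Suc k) = (\<lambda>p. \<integral>\<^sup>+t. indicator {..fst p} t * ennreal (norm (q t)) * (majD k (t, snd p - t) + majD k (t, - snd p - t)) \<partial>lborel)"
| "majD (Suc k) = (\<lambda>p. \<integral>\<^sup>+t. indicator {..fst p} t * ennreal (2 * norm (q t)) * majP k (t, snd p + t) \<partial>lborel)"

lemma ker_measurable_aux:
  "kerP k \<in> borel_measurable (borel \<Otimes>\<^sub>M borel) \<and> kerD k \<in> borel_measurable (borel \<Otimes>\<^sub>M borel)"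
proof (induction k)
  case 0
  show ?case unfolding kerP.simps kerD.simps by (intro conjI) measurable
next
  case (Suc k)
  then have [measurable]: "kerP k \<in> borel_measurable (borel \<Otimes>\<^sub>M borel)" "kerD k \<in> borel_measurable (borel \<Otimes>\<^sub>M borel)"
    by auto
  show ?case unfolding kerP.simps kerD.simps by (intro conjI) measurable
qed

lemma ker_measurable [measurable]:
  "kerP k \<in> borel_measurable (borel \<Otimes>\<^sub>M borel)" "kerD k \<in> borel_measurable (borel \<Otimes>\<^sub>M borel)"
  using ker_measurable_aux by auto

lemma maj_measurable_aux:
  "majP k \<in> borel_measurable (borel \<Otimes>\<^sub>M borel) \<and> majD k \<in> borel_measurable (borel \<Otimes>\<^sub>M borel)"
proof (induction k)
  case 0
  show ?case unfolding majP.simps majD.simps by (intro conjI) measurable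
next
  case (Suc k)
  then have [measurable]: "majP k \<in> borel_measurable (borel \<Otimes>\<^sub>M borel)" "majD k \<in> borel_measurable (borel \<Otimes>\<^sub>M borel)"
    by auto
  show ?case unfolding majP.simps majD.simps by (intro conjI) measurable
qed

lemma maj_measurable [measurable]:
  "majP k \<in> borel_measurable (borel \<Otimes>\<^sub>M borel)" "majD k \<in> borel_measurable (borel \<Otimes>\<^sub>M borel)"
  using maj_measurable_aux by auto

lemma ennreal_norm_cnj_add_le:
  "ennreal (norm (a + cnj b)) \<le> ennreal (norm a) + ennreal (norm b)"
  using norm_triangle_ineq[of a "cnj b"] by (simp add: ennreal_plus[symmetric] ennreal_leI del: ennreal_plus)

lemma ker_le_maj:
  "ennreal (norm (kerP k p)) \<le> majP k p \<and> ennreal (norm (kerD k p)) \<le> majD k p"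
proof (induction k arbitrary: p)
  case 0
  have "ennreal (norm (kerP 0 p)) \<le> majP 0 p"
    using ennreal_norm_cnj_add_le[of "indicator {..fst p} (snd p) *\<^sub>R q (snd p)" "indicator {..fst p} (- snd p) *\<^sub>R q (- snd p)"]
    by (simp add: ennreal_mult'' ennreal_indicator)
  moreover have "ennreal (norm (kerD 0 p)) \<le> majD 0 p"
    by (simp add: norm_mult indicator_def)
  ultimately show ?case by simp
next
  case (Suc k)
  have "ennreal (norm (kerP (Suc k) p)) \<le> (\<integral>\<^sup>+t. ennreal (norm (indicator {..fst p} t *\<^sub>R (q t * kerD k (t, snd p - t) + cnj (q t * kerD k (t, - snd p - t))))) \<partial>lborel)"
    unfolding kerP.simps by (rule ennreal_norm_integral_le)
  also have "\<dots> \<le> majP (Suc k) p"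
    unfolding majP.simps
  proof (rule nn_integral_mono)
    fix t
    have "ennreal (norm (q t * kerD k (t, snd p - t) + cnj (q t * kerD k (t, - snd p - t))))
       \<le> ennreal (norm (q t)) * ennreal (norm (kerD k (t, snd p - t))) + ennreal (norm (q t)) * ennreal (norm (kerD k (t, - snd p - t)))"
      by (rule order_trans[OF ennreal_norm_cnj_add_le]) (simp add: norm_mult ennreal_mult)
    also have "\<dots> \<le> ennreal (norm (q t)) * (majD k (t, snd p - t) + majD k (t, - snd p - t))"
      unfolding distrib_left using Suc.IH by (intro add_mono mult_left_mono) auto
    finally show "ennreal (norm (indicator {..fst p} t *\<^sub>R (q t * kerD k (t, snd p - t) + cnj (q t * kerD k (t, - snd p - t)))))
       \<le> indicator {..fst p} t * ennreal (norm (q t)) * (majD k (t, snd p - t) + majD k (t, - snd p - t))"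
      by (auto simp: indicator_def)
  qed
  finally have 1: "ennreal (norm (kerP (Suc k) p)) \<le> majP (Suc k) p" .
  have "ennreal (norm (kerD (Suc k) p)) \<le> (\<integral>\<^sup>+t. ennreal (norm (indicator {..fst p} t *\<^sub>R (2 * cnj (q t) * kerP k (t, snd p + t)))) \<partial>lborel)"
    unfolding kerD.simps by (rule ennreal_norm_integral_le)
  also have "\<dots> \<le> majD (Suc k) p"
    unfolding majD.simps
  proof (rule nn_integral_mono)
    fix t
    have "ennreal (norm (2 * cnj (q t) * kerP k (t, snd p + t))) = ennreal (2 * norm (q t)) * ennreal (norm (kerP k (t, snd p + t)))"
      by (simp add: norm_mult ennreal_mult)
    also have "\<dots> \<le> ennreal (2 * norm (q t)) * majP k (t, snd p + t)"
      using Suc.IH by (intro mult_left_mono) auto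
    finally show "ennreal (norm (indicator {..fst p} t *\<^sub>R (2 * cnj (q t) * kerP k (t, snd p + t))))
       \<le> indicator {..fst p} t * ennreal (2 * norm (q t)) * majP k (t, snd p + t)"
      by (auto simp: indicator_def)
  qed
  finally have 2: "ennreal (norm (kerD (Suc k) p)) \<le> majD (Suc k) p" .
  show ?case using 1 2 by simp
qed

text \<open>Monotonicity in the upper limit of integration turns the value at $x = 1$ into a majorant that is
  uniform in $x$.\<close>

lemma maj_mono:
  assumes "x \<le> y" shows "majD k (x, s) \<le> majD k (y, s)"
proof (cases k)
  case 0
  then show ?thesis using assms by (auto simp: indicator_def)
next
  case (Suc m)
  show ?thesis unfolding Suc majD.simps
    using assms by (intro nn_integral_mono mult_right_mono) (auto simp: indicator_def)
qed

text \<open>Adding $t$ to a frequency in $[-2t, 0]$, with or without a reflection afterwards, gives one in $[-t, t]$,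
  and subtracting $t$ leads back to $[-2t, 0]$. So the frequencies stay bounded although the number of terms
  grows.\<close>

lemma maj_support:
  "(\<forall>x s. x < \<bar>s\<bar> \<longrightarrow> majP k (x, s) = 0) \<and> (\<forall>x s. (s < - 2 * x \<or> 0 < s) \<longrightarrow> majD k (x, s) = 0)"
proof (induction k)
  case 0
  have z: "q y = 0" if "y \<le> 0" for y using that by (intro q_supp) simp
  have "majP 0 (x, s) = 0" if "x < \<bar>s\<bar>" for x s
    using that z[of s] z[of "-s"] by (cases "s \<le> 0") (auto simp: indicator_def)
  moreover have "majD 0 (x, s) = 0" if "s < - 2 * x \<or> 0 < s" for x s
    using that z[of "-s"] by (cases "0 \<le> s") (auto simp: indicator_def)
  ultimately show ?case by blast
next
  case (Suc k)
  have "majP (Suc k) (x, s) = 0" if "x < \<bar>s\<bar>" for x s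
  proof -
    have "indicator {..x} t * ennreal (norm (q t)) * (majD k (t, s - t) + majD k (t, - s - t)) = 0" for t
    proof (cases "t \<le> x")
      case True
      then have "majD k (t, s - t) = 0" "majD k (t, - s - t) = 0"
        using that Suc.IH by (auto simp: abs_if split: if_splits)
      then show ?thesis by simp
    qed simp
    then show ?thesis unfolding majP.simps fst_conv snd_conv by (simp only: nn_integral_const mult_zero_left)
  qed
  moreover have "majD (Suc k) (x, s) = 0" if "s < - 2 * x \<or> 0 < s" for x s
  proof -
    have "indicator {..x} t * ennreal (2 * norm (q t)) * majP k (t, s + t) = 0" for t
    proof (cases "t \<le> x")
      case True
      then have "t < \<bar>s + t\<bar>" using that by linarith
      then have "majP k (t, s + t) = 0" using Suc.IH by blast
      then show ?thesis by simp
    qed simp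
    then show ?thesis unfolding majD.simps fst_conv snd_conv by (simp only: nn_integral_const mult_zero_left)
  qed
  ultimately show ?case by blast
qed

lemma nn_integral_shear:
  fixes G :: "real \<times> real \<Rightarrow> ennreal" and w :: "real \<Rightarrow> ennreal"
  assumes [measurable]: "G \<in> borel_measurable (borel \<Otimes>\<^sub>M borel)" "w \<in> borel_measurable borel"
  shows "(\<integral>\<^sup>+s. \<integral>\<^sup>+t. w t * G (t, s - t) \<partial>lborel \<partial>lborel) = (\<integral>\<^sup>+t. w t * (\<integral>\<^sup>+s. G (t, s) \<partial>lborel) \<partial>lborel)"
    and "(\<integral>\<^sup>+s. \<integral>\<^sup>+t. w t * G (t, s + t) \<partial>lborel \<partial>lborel) = (\<integral>\<^sup>+t. w t * (\<integral>\<^sup>+s. G (t, s) \<partial>lborel) \<partial>lborel)"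
    and "(\<integral>\<^sup>+s. \<integral>\<^sup>+t. w t * G (t, - s - t) \<partial>lborel \<partial>lborel) = (\<integral>\<^sup>+t. w t * (\<integral>\<^sup>+s. G (t, s) \<partial>lborel) \<partial>lborel)"
proof -
  have sw: "(\<integral>\<^sup>+s. \<integral>\<^sup>+t. w t * G (t, f (s, t)) \<partial>lborel \<partial>lborel) = (\<integral>\<^sup>+t. w t * (\<integral>\<^sup>+s. G (t, f (s, t)) \<partial>lborel) \<partial>lborel)"
    if [measurable]: "f \<in> borel_measurable (borel \<Otimes>\<^sub>M borel)" for f :: "real \<times> real \<Rightarrow> real"
  proof -
    have "(\<integral>\<^sup>+s. \<integral>\<^sup>+t. w t * G (t, f (s, t)) \<partial>lborel \<partial>lborel) = (\<integral>\<^sup>+t. \<integral>\<^sup>+s. w t * G (t, f (s, t)) \<partial>lborel \<partial>lborel)"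
      by (rule nn_integral_swap[where F="\<lambda>(s,t). w t * G (t, f (s, t))", simplified, symmetric]) measurable
    also have "\<dots> = (\<integral>\<^sup>+t. w t * (\<integral>\<^sup>+s. G (t, f (s, t)) \<partial>lborel) \<partial>lborel)"
      by (intro nn_integral_cong nn_integral_cmult) measurable
    finally show ?thesis .
  qed
  have a: "(\<integral>\<^sup>+s. G (t, s - t) \<partial>lborel) = (\<integral>\<^sup>+s. G (t, s) \<partial>lborel)" for t
    using nn_integral_shift[of "\<lambda>s. G (t, s)" "- t"] by simp
  have b: "(\<integral>\<^sup>+s. G (t, s + t) \<partial>lborel) = (\<integral>\<^sup>+s. G (t, s) \<partial>lborel)" for t
    using nn_integral_shift[of "\<lambda>s. G (t, s)" "t"] by simp
  have c: "(\<integral>\<^sup>+s. G (t, - s - t) \<partial>lborel) = (\<integral>\<^sup>+s. G (t, s) \<partial>lborel)" for t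
    using nn_integral_reflect[of "\<lambda>s. G (t, s - t)"] a[of t] by simp
  show "(\<integral>\<^sup>+s. \<integral>\<^sup>+t. w t * G (t, s - t) \<partial>lborel \<partial>lborel) = (\<integral>\<^sup>+t. w t * (\<integral>\<^sup>+s. G (t, s) \<partial>lborel) \<partial>lborel)"
    using sw[of "\<lambda>p. fst p - snd p"] by (simp add: a)
  show "(\<integral>\<^sup>+s. \<integral>\<^sup>+t. w t * G (t, s + t) \<partial>lborel \<partial>lborel) = (\<integral>\<^sup>+t. w t * (\<integral>\<^sup>+s. G (t, s) \<partial>lborel) \<partial>lborel)"
    using sw[of "\<lambda>p. fst p + snd p"] by (simp add: b)
  show "(\<integral>\<^sup>+s. \<integral>\<^sup>+t. w t * G (t, - s - t) \<partial>lborel \<partial>lborel) = (\<integral>\<^sup>+t. w t * (\<integral>\<^sup>+s. G (t, s) \<partial>lborel) \<partial>lborel)"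
    using sw[of "\<lambda>p. - fst p - snd p"] by (simp add: c)
qed

text \<open>Translations and reflections of $s$ do not change the mass, so the masses obey the scalar recursion
  solved by \<open>Phi_fact\<close>.\<close>

lemma maj_mass:
  "(\<integral>\<^sup>+s. majP k (x, s) \<partial>lborel) = ennreal ((2 * Phi x) ^ Suc k / fact (Suc k))
   \<and> (\<integral>\<^sup>+s. majD k (x, s) \<partial>lborel) = ennreal ((2 * Phi x) ^ Suc k / fact (Suc k))"
proof (induction k arbitrary: x)
  case 0
  have r: "(\<integral>\<^sup>+s. indicator {..x} (- s) * ennreal (norm (q (- s))) \<partial>lborel) = ennreal (Phi x)"
    using nn_integral_reflect[of "\<lambda>s. indicator {..x} s * ennreal (norm (q s))"] by (simp add: Phi_nn)
  have "(\<integral>\<^sup>+s. majP 0 (x, s) \<partial>lborel) = ennreal (Phi x) + ennreal (Phi x)"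
    by (simp add: nn_integral_add Phi_nn r)
  also have "\<dots> = ennreal (2 * Phi x)" using Phi_nonneg[of x] by (simp add: ennreal_plus[symmetric] del: ennreal_plus)
  finally have 1: "(\<integral>\<^sup>+s. majP 0 (x, s) \<partial>lborel) = ennreal (2 * Phi x)" .
  have "(\<integral>\<^sup>+s. majD 0 (x, s) \<partial>lborel) = (\<integral>\<^sup>+s. ennreal 2 * (indicator {..x} (- s) * ennreal (norm (q (- s)))) \<partial>lborel)"
    by (intro nn_integral_cong) (auto simp: indicator_def ennreal_mult)
  also have "\<dots> = ennreal 2 * ennreal (Phi x)" unfolding r[symmetric] by (rule nn_integral_cmult) measurable
  also have "\<dots> = ennreal (2 * Phi x)" using Phi_nonneg[of x] by (simp add: ennreal_mult)
  finally show ?case using 1 by simp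
next
  case (Suc k)
  let ?m = "\<lambda>t. ennreal ((2 * Phi t) ^ Suc k / fact (Suc k))"
  let ?w = "\<lambda>t. indicator {..x} t * ennreal (norm (q t))"
  have "(\<integral>\<^sup>+s. majP (Suc k) (x, s) \<partial>lborel)
     = (\<integral>\<^sup>+s. (\<integral>\<^sup>+t. ?w t * majD k (t, s - t) \<partial>lborel) + (\<integral>\<^sup>+t. ?w t * majD k (t, - s - t) \<partial>lborel) \<partial>lborel)"
    unfolding majP.simps by (intro nn_integral_cong) (simp add: distrib_left nn_integral_add)
  also have "\<dots> = (\<integral>\<^sup>+s. \<integral>\<^sup>+t. ?w t * majD k (t, s - t) \<partial>lborel \<partial>lborel) + (\<integral>\<^sup>+s. \<integral>\<^sup>+t. ?w t * majD k (t, - s - t) \<partial>lborel \<partial>lborel)"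
    by (rule nn_integral_add) measurable
  also have "\<dots> = (\<integral>\<^sup>+t. ?w t * ?m t \<partial>lborel) + (\<integral>\<^sup>+t. ?w t * ?m t \<partial>lborel)"
    by (subst nn_integral_shear, measurable, subst nn_integral_shear, measurable) (simp only: Suc.IH)
  also have "\<dots> = (\<integral>\<^sup>+t. ?w t * ?m t + ?w t * ?m t \<partial>lborel)"
    by (rule nn_integral_add[symmetric]) measurable
  also have "\<dots> = (\<integral>\<^sup>+t. indicator {..x} t * ennreal (2 * norm (q t)) * ?m t \<partial>lborel)"
    by (intro nn_integral_cong) (simp add: ennreal_mult mult_2[symmetric] mult_ac del: fact_Suc power_Suc)
  also have "\<dots> = ennreal ((2 * Phi x) ^ Suc (Suc k) / fact (Suc (Suc k)))" by (rule Phi_fact)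
  finally have 1: "(\<integral>\<^sup>+s. majP (Suc k) (x, s) \<partial>lborel) = ennreal ((2 * Phi x) ^ Suc (Suc k) / fact (Suc (Suc k)))" .
  have "(\<integral>\<^sup>+s. majD (Suc k) (x, s) \<partial>lborel) = (\<integral>\<^sup>+t. indicator {..x} t * ennreal (2 * norm (q t)) * ?m t \<partial>lborel)"
    unfolding majD.simps fst_conv snd_conv
    by (subst nn_integral_shear, measurable) (simp only: Suc.IH)
  also have "\<dots> = ennreal ((2 * Phi x) ^ Suc (Suc k) / fact (Suc (Suc k)))" by (rule Phi_fact)
  finally show ?case using 1 by simp
qed

text \<open>One Picard step for the system $P' = 2\,\mathrm{Re}(q e^{-2 i \lambda x} D)$,
  $D' = 2 \overline q e^{2 i \lambda x} P$.\<close>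

definition stepP :: "real \<Rightarrow> (real \<Rightarrow> complex) \<Rightarrow> real \<Rightarrow> complex" where
  "stepP l D x = (\<integral>t. indicator {..x} t *\<^sub>R (q t * phase l t * D t) \<partial>lborel)
     + cnj (\<integral>t. indicator {..x} t *\<^sub>R (q t * phase l t * D t) \<partial>lborel)"

definition stepD :: "real \<Rightarrow> (real \<Rightarrow> complex) \<Rightarrow> real \<Rightarrow> complex" where
  "stepD l P x = 2 * (\<integral>t. indicator {..x} t *\<^sub>R (cnj (q t * phase l t) * P t) \<partial>lborel)"

fun iterP :: "real \<Rightarrow> (real \<Rightarrow> complex) \<Rightarrow> (real \<Rightarrow> complex) \<Rightarrow> nat \<Rightarrow> real \<Rightarrow> complex"
  and iterD :: "real \<Rightarrow> (real \<Rightarrow> complex) \<Rightarrow> (real \<Rightarrow> complex) \<Rightarrow> nat \<Rightarrow> real \<Rightarrow> complex" where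
  "iterP l P D 0 = P"
| "iterD l P D 0 = D"
| "iterP l P D (Suc k) = stepP l (iterD l P D k)"
| "iterD l P D (Suc k) = stepD l (iterP l P D k)"

lemma step_measurable [measurable]:
  assumes [measurable]: "f \<in> borel_measurable borel"
  shows "stepP l f \<in> borel_measurable borel" "stepD l f \<in> borel_measurable borel"
  unfolding stepP_def[abs_def] stepD_def[abs_def] by measurable

lemma iter_measurable_aux:
  assumes [measurable]: "P \<in> borel_measurable borel" "D \<in> borel_measurable borel"
  shows "iterP l P D k \<in> borel_measurable borel \<and> iterD l P D k \<in> borel_measurable borel"
proof (induction k)
  case (Suc k)
  then have [measurable]: "iterP l P D k \<in> borel_measurable borel" "iterD l P D k \<in> borel_measurable borel" by auto
  show ?case unfolding iterP.simps iterD.simps by (intro conjI) measurable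
qed simp

lemma iter_measurable [measurable]:
  assumes "P \<in> borel_measurable borel" "D \<in> borel_measurable borel"
  shows "iterP l P D k \<in> borel_measurable borel" "iterD l P D k \<in> borel_measurable borel"
  using iter_measurable_aux[OF assms] by auto

lemma nn_step_bound:
  assumes f: "\<And>t. norm (f t) \<le> B * ((2 * Phi t) ^ k / fact k)" and B: "0 \<le> B"
  shows "(\<integral>\<^sup>+t. indicator {..x} t * (ennreal (2 * norm (q t)) * ennreal (norm (f t))) \<partial>lborel)
      \<le> ennreal (B * ((2 * Phi x) ^ Suc k / fact (Suc k)))"
proof -
  have "(\<integral>\<^sup>+t. indicator {..x} t * (ennreal (2 * norm (q t)) * ennreal (norm (f t))) \<partial>lborel)
     \<le> (\<integral>\<^sup>+t. ennreal B * (indicator {..x} t * ennreal (2 * norm (q t)) * ennreal ((2 * Phi t) ^ k / fact k)) \<partial>lborel)"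
  proof (rule nn_integral_mono)
    fix t
    have "ennreal (norm (f t)) \<le> ennreal B * ennreal ((2 * Phi t) ^ k / fact k)"
      using f[of t] B Phi_nonneg[of t] by (simp add: ennreal_mult[symmetric] ennreal_leI)
    then have "ennreal (2 * norm (q t)) * ennreal (norm (f t)) \<le> ennreal (2 * norm (q t)) * (ennreal B * ennreal ((2 * Phi t) ^ k / fact k))"
      by (rule mult_left_mono) simp
    then show "indicator {..x} t * (ennreal (2 * norm (q t)) * ennreal (norm (f t)))
       \<le> ennreal B * (indicator {..x} t * ennreal (2 * norm (q t)) * ennreal ((2 * Phi t) ^ k / fact k))"
      by (auto simp: indicator_def mult_ac)
  qed
  also have "\<dots> = ennreal B * (\<integral>\<^sup>+t. indicator {..x} t * ennreal (2 * norm (q t)) * ennreal ((2 * Phi t) ^ k / fact k) \<partial>lborel)"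
    by (rule nn_integral_cmult) measurable
  also have "\<dots> = ennreal (B * ((2 * Phi x) ^ Suc k / fact (Suc k)))"
    unfolding Phi_fact by (rule ennreal_mult[symmetric]) (use B Phi_nonneg[of x] in auto)
  finally show ?thesis .
qed

lemma step_bound:
  assumes f: "\<And>t. norm (f t) \<le> B * ((2 * Phi t) ^ k / fact k)" and B: "0 \<le> B"
  shows "norm (stepP l f x) \<le> B * ((2 * Phi x) ^ Suc k / fact (Suc k))"
    and "norm (stepD l f x) \<le> B * ((2 * Phi x) ^ Suc k / fact (Suc k))"
proof -
  have R0: "0 \<le> B * ((2 * Phi x) ^ Suc k / fact (Suc k))" using B Phi_nonneg[of x] by simp
  have key: "2 * norm (\<integral>t. indicator {..x} t *\<^sub>R g t \<partial>lborel) \<le> B * ((2 * Phi x) ^ Suc k / fact (Suc k))"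
    if g: "\<And>t. norm (g t) = norm (q t) * norm (f t)" for g :: "real \<Rightarrow> complex"
  proof (cases "integrable lborel (\<lambda>t. indicator {..x} t *\<^sub>R g t)")
    case True
    have "ennreal (norm (\<integral>t. indicator {..x} t *\<^sub>R g t \<partial>lborel)) \<le> (\<integral>\<^sup>+t. ennreal (norm (indicator {..x} t *\<^sub>R g t)) \<partial>lborel)"
      by (rule ennreal_norm_integral_le)
    then have "2 * ennreal (norm (\<integral>t. indicator {..x} t *\<^sub>R g t \<partial>lborel)) \<le> 2 * (\<integral>\<^sup>+t. ennreal (norm (indicator {..x} t *\<^sub>R g t)) \<partial>lborel)"
      by (rule mult_left_mono) simp
    also have "\<dots> = (\<integral>\<^sup>+t. 2 * ennreal (norm (indicator {..x} t *\<^sub>R g t)) \<partial>lborel)"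
      using measurable_compose[OF borel_measurable_integrable[OF True] borel_measurable_norm]
      by (intro nn_integral_cmult[symmetric]) simp
    also have "\<dots> = (\<integral>\<^sup>+t. indicator {..x} t * (ennreal (2 * norm (q t)) * ennreal (norm (f t))) \<partial>lborel)"
      by (intro nn_integral_cong) (simp add: g indicator_def ennreal_mult mult_ac)
    also have "\<dots> \<le> ennreal (B * ((2 * Phi x) ^ Suc k / fact (Suc k)))"
      by (rule nn_step_bound[OF f B])
    finally have "ennreal (2 * norm (\<integral>t. indicator {..x} t *\<^sub>R g t \<partial>lborel)) \<le> ennreal (B * ((2 * Phi x) ^ Suc k / fact (Suc k)))"
      by (simp add: ennreal_mult)
    then show ?thesis using R0 by (simp add: ennreal_le_iff del: power_Suc fact_Suc)
  qed (use R0 in \<open>simp add: not_integrable_integral_eq\<close>)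
  let ?z = "\<integral>t. indicator {..x} t *\<^sub>R (q t * phase l t * f t) \<partial>lborel"
  have "norm (stepP l f x) \<le> 2 * norm ?z"
    unfolding stepP_def using norm_triangle_ineq[of ?z "cnj ?z"] by simp
  also have "\<dots> \<le> B * ((2 * Phi x) ^ Suc k / fact (Suc k))"
    by (rule key) (simp add: norm_mult)
  finally show "norm (stepP l f x) \<le> B * ((2 * Phi x) ^ Suc k / fact (Suc k))" .
  have "norm (stepD l f x) = 2 * norm (\<integral>t. indicator {..x} t *\<^sub>R (cnj (q t * phase l t) * f t) \<partial>lborel)"
    unfolding stepD_def by (simp add: norm_mult)
  also have "\<dots> \<le> B * ((2 * Phi x) ^ Suc k / fact (Suc k))"
    by (rule key) (simp add: norm_mult)
  finally show "norm (stepD l f x) \<le> B * ((2 * Phi x) ^ Suc k / fact (Suc k))" .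
qed

lemma iter_bound:
  assumes P: "\<And>t. norm (P t) \<le> B" and D: "\<And>t. norm (D t) \<le> B"
  shows "(\<forall>x. norm (iterP l P D k x) \<le> B * ((2 * Phi x) ^ k / fact k))
     \<and> (\<forall>x. norm (iterD l P D k x) \<le> B * ((2 * Phi x) ^ k / fact k))"
proof (induction k)
  case 0
  then show ?case using P D by simp
next
  case (Suc k)
  have B: "0 \<le> B" using P[of 0] norm_ge_zero order_trans by blast
  show ?case unfolding iterP.simps iterD.simps using step_bound[OF _ B] Suc by blast
qed

lemma iter_tendsto_0:
  assumes "\<And>t. norm (P t) \<le> B" "\<And>t. norm (D t) \<le> B"
  shows "(\<lambda>k. iterP l P D k x) \<longlonglongrightarrow> 0" "(\<lambda>k. iterD l P D k x) \<longlonglongrightarrow> 0"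
proof -
  have "(\<lambda>k. (2 * Phi x) ^ k / fact k) \<longlonglongrightarrow> 0"
    using summable_exp[of "2 * Phi x"] by (intro summable_LIMSEQ_zero) (simp add: divide_inverse mult.commute)
  then have z: "(\<lambda>k. B * ((2 * Phi x) ^ k / fact k)) \<longlonglongrightarrow> 0"
    by (rule tendsto_mult_right_zero)
  show "(\<lambda>k. iterP l P D k x) \<longlonglongrightarrow> 0"
    by (rule Lim_null_comparison[OF _ z]) (use iter_bound[OF assms] in auto)
  show "(\<lambda>k. iterD l P D k x) \<longlonglongrightarrow> 0"
    by (rule Lim_null_comparison[OF _ z]) (use iter_bound[OF assms] in auto)
qed

lemma integrable_q_mult:
  assumes [measurable]: "f \<in> borel_measurable borel" and "\<And>t. t \<in> {0<..<1} \<Longrightarrow> norm (f t) \<le> B"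
  shows "integrable lborel (\<lambda>t. indicator {..x} t *\<^sub>R (q t * f t))"
proof (rule Bochner_Integration.integrable_bound)
  show "integrable lborel (\<lambda>t. \<bar>B\<bar> *\<^sub>R q t)" using q_int by simp
  show "AE t in lborel. norm (indicator {..x} t *\<^sub>R (q t * f t)) \<le> norm (\<bar>B\<bar> *\<^sub>R q t)"
  proof (rule AE_I2)
    fix t
    show "norm (indicator {..x} t *\<^sub>R (q t * f t)) \<le> norm (\<bar>B\<bar> *\<^sub>R q t)"
    proof (cases "t \<in> {0<..<1}")
      case True
      have "norm (q t) * norm (f t) \<le> norm (q t) * \<bar>B\<bar>" using assms(2)[OF True] by (intro mult_left_mono) auto
      then show ?thesis by (auto simp: norm_mult indicator_def mult.commute)
    qed (simp add: q_supp)
  qed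
qed measurable

lemma step_add:
  assumes [measurable]: "f \<in> borel_measurable borel" "g \<in> borel_measurable borel"
    and f: "\<And>t. t \<in> {0<..<1} \<Longrightarrow> norm (f t) \<le> A" and g: "\<And>t. t \<in> {0<..<1} \<Longrightarrow> norm (g t) \<le> B"
    and h: "\<And>t. t \<in> {0<..<1} \<Longrightarrow> h t = f t + g t"
  shows "stepP l h x = stepP l f x + stepP l g x" "stepD l h x = stepD l f x + stepD l g x"
proof -
  have *: "(\<integral>t. indicator {..x} t *\<^sub>R (q t * phase l t * h t) \<partial>lborel)
     = (\<integral>t. indicator {..x} t *\<^sub>R (q t * phase l t * f t) \<partial>lborel) + (\<integral>t. indicator {..x} t *\<^sub>R (q t * phase l t * g t) \<partial>lborel)"
  proof -
    have "(\<integral>t. indicator {..x} t *\<^sub>R (q t * phase l t * h t) \<partial>lborel)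
      = (\<integral>t. indicator {..x} t *\<^sub>R (q t * phase l t * f t) + indicator {..x} t *\<^sub>R (q t * phase l t * g t) \<partial>lborel)"
    proof (rule Bochner_Integration.integral_cong[OF refl])
      fix t
      show "indicator {..x} t *\<^sub>R (q t * phase l t * h t) = indicator {..x} t *\<^sub>R (q t * phase l t * f t) + indicator {..x} t *\<^sub>R (q t * phase l t * g t)"
        by (cases "t \<in> {0<..<1}") (simp_all add: h q_supp indicator_def distrib_left)
    qed
    also have "\<dots> = (\<integral>t. indicator {..x} t *\<^sub>R (q t * phase l t * f t) \<partial>lborel) + (\<integral>t. indicator {..x} t *\<^sub>R (q t * phase l t * g t) \<partial>lborel)"
      using integrable_q_mult[of "\<lambda>t. phase l t * f t" A x] integrable_q_mult[of "\<lambda>t. phase l t * g t" B x] f g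
      by (intro Bochner_Integration.integral_add) (simp_all add: mult.assoc norm_mult)
    finally show ?thesis .
  qed
  show "stepP l h x = stepP l f x + stepP l g x"
    unfolding stepP_def * by simp
  have i: "integrable lborel (\<lambda>t. indicator {..x} t *\<^sub>R (cnj (q t * phase l t) * f t))"
    if [measurable]: "f \<in> borel_measurable borel" and f: "\<And>t. t \<in> {0<..<1} \<Longrightarrow> norm (f t) \<le> A" for f A
  proof -
    have "integrable lborel (\<lambda>t. indicator {..x} t *\<^sub>R (q t * (phase l t * f t)))"
      by (rule integrable_q_mult[of _ A]) (use f in \<open>auto simp: norm_mult\<close>)
    then show ?thesis
      by (rule Bochner_Integration.integrable_bound) (auto simp: norm_mult indicator_def)
  qed
  have "(\<integral>t. indicator {..x} t *\<^sub>R (cnj (q t * phase l t) * h t) \<partial>lborel)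
     = (\<integral>t. indicator {..x} t *\<^sub>R (cnj (q t * phase l t) * f t) + indicator {..x} t *\<^sub>R (cnj (q t * phase l t) * g t) \<partial>lborel)"
  proof (rule Bochner_Integration.integral_cong[OF refl])
    fix t
    show "indicator {..x} t *\<^sub>R (cnj (q t * phase l t) * h t) = indicator {..x} t *\<^sub>R (cnj (q t * phase l t) * f t) + indicator {..x} t *\<^sub>R (cnj (q t * phase l t) * g t)"
      by (cases "t \<in> {0<..<1}") (simp_all add: h q_supp indicator_def distrib_left)
  qed
  also have "\<dots> = (\<integral>t. indicator {..x} t *\<^sub>R (cnj (q t * phase l t) * f t) \<partial>lborel) + (\<integral>t. indicator {..x} t *\<^sub>R (cnj (q t * phase l t) * g t) \<partial>lborel)"
    by (intro Bochner_Integration.integral_add i[OF assms(1) f] i[OF assms(2) g])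
  finally show "stepD l h x = stepD l f x + stepD l g x"
    unfolding stepD_def by (simp add: distrib_left)
qed

text \<open>Applying a power of the step operator to the equation $(P, D) = (c, c) + \mbox{step}$ shows that
  consecutive iterates of a solution differ by an iterate of the constant. Only values of $P$ and $D$ where $q$ does
  not vanish matter for a step, so the equation is assumed on the unit interval only.\<close>

lemma iter_remainder:
  assumes [measurable]: "P \<in> borel_measurable borel" "D \<in> borel_measurable borel"
    and bd: "\<And>t. norm (P t) \<le> B" "\<And>t. norm (D t) \<le> B"
    and eqP: "\<And>x. x \<in> {0..1} \<Longrightarrow> P x = c + stepP l D x" and eqD: "\<And>x. x \<in> {0..1} \<Longrightarrow> D x = c + stepD l P x"
  shows "(\<forall>x\<in>{0..1}. iterP l P D k x = iterP l (\<lambda>_. c) (\<lambda>_. c) k x + iterP l P D (Suc k) x)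
     \<and> (\<forall>x\<in>{0..1}. iterD l P D k x = iterD l (\<lambda>_. c) (\<lambda>_. c) k x + iterD l P D (Suc k) x)"
proof (induction k)
  case 0
  then show ?case using eqP eqD by simp
next
  case (Suc k)
  have bnd: "\<exists>A. \<forall>t\<in>{0<..<1}. norm (iterP l P D k t) \<le> A \<and> norm (iterD l P D k t) \<le> A"
    if "\<And>t. norm (P t) \<le> B" "\<And>t. norm (D t) \<le> B" for P D B k
  proof (intro exI ballI)
    fix t :: real assume t: "t \<in> {0<..<1}"
    have B: "0 \<le> B" using that(1)[of 0] norm_ge_zero order_trans by blast
    have "B * ((2 * Phi t) ^ k / fact k) \<le> B * ((2 * Phi 1) ^ k / fact k)"
      using B Phi_nonneg[of t] Phi_mono[of t 1] t by (intro mult_left_mono divide_right_mono power_mono) auto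
    then show "norm (iterP l P D k t) \<le> B * ((2 * Phi 1) ^ k / fact k) \<and> norm (iterD l P D k t) \<le> B * ((2 * Phi 1) ^ k / fact k)"
      using iter_bound[where P=P and D=D and B=B and l=l and k=k, OF that, THEN conjunct1, rule_format, of t]
        iter_bound[where P=P and D=D and B=B and l=l and k=k, OF that, THEN conjunct2, rule_format, of t] by linarith
  qed
  obtain A1 where A1: "\<And>t. t\<in>{0<..<1} \<Longrightarrow> norm (iterP l (\<lambda>_. c) (\<lambda>_. c) k t) \<le> A1"
     "\<And>t. t\<in>{0<..<1} \<Longrightarrow> norm (iterD l (\<lambda>_. c) (\<lambda>_. c) k t) \<le> A1"
    using bnd[of "\<lambda>_. c" "norm c" "\<lambda>_. c" k, OF order_refl order_refl] by blast
  obtain A2 where A2: "\<And>t. t\<in>{0<..<1} \<Longrightarrow> norm (iterP l P D (Suc k) t) \<le> A2"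
     "\<And>t. t\<in>{0<..<1} \<Longrightarrow> norm (iterD l P D (Suc k) t) \<le> A2"
    using bnd[of P B D "Suc k", OF bd] by blast
  have mp: "iterP l P D (Suc k) \<in> borel_measurable borel" "iterD l P D (Suc k) \<in> borel_measurable borel"
    "iterP l (\<lambda>_. c) (\<lambda>_. c) k \<in> borel_measurable borel" "iterD l (\<lambda>_. c) (\<lambda>_. c) k \<in> borel_measurable borel"
    by (intro iter_measurable; measurable)+
  have "iterP l P D (Suc k) x = iterP l (\<lambda>_. c) (\<lambda>_. c) (Suc k) x + iterP l P D (Suc (Suc k)) x" for x
    unfolding iterP.simps(2)[of l P D "Suc k"] iterP.simps(2)[of l P D k] iterP.simps(2)[of l "\<lambda>_. c"]
    by (rule step_add(1)[OF mp(4) mp(2) A1(2) A2(2)]) (use Suc in auto)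
  moreover have "iterD l P D (Suc k) x = iterD l (\<lambda>_. c) (\<lambda>_. c) (Suc k) x + iterD l P D (Suc (Suc k)) x" for x
    unfolding iterD.simps(2)[of l P D "Suc k"] iterD.simps(2)[of l P D k] iterD.simps(2)[of l "\<lambda>_. c"]
    by (rule step_add(2)[OF mp(3) mp(1) A1(1) A2(1)]) (use Suc in auto)
  ultimately show ?case by blast
qed

lemma iter_sums:
  assumes "P \<in> borel_measurable borel" "D \<in> borel_measurable borel"
    and bd: "\<And>t. norm (P t) \<le> B" "\<And>t. norm (D t) \<le> B"
    and eqP: "\<And>x. x \<in> {0..1} \<Longrightarrow> P x = c + stepP l D x" and eqD: "\<And>x. x \<in> {0..1} \<Longrightarrow> D x = c + stepD l P x"
    and x: "x \<in> {0..1}"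
  shows "(\<lambda>k. iterP l (\<lambda>_. c) (\<lambda>_. c) k x) sums P x" "(\<lambda>k. iterD l (\<lambda>_. c) (\<lambda>_. c) k x) sums D x"
proof -
  note sp = iter_remainder[OF assms(1-6)]
  have "(\<Sum>k<N. iterP l (\<lambda>_. c) (\<lambda>_. c) k x) = P x - iterP l P D N x" for N
  proof (induction N)
    case (Suc N)
    then show ?case using sp[of N] x by (auto simp: algebra_simps)
  qed simp
  then show "(\<lambda>k. iterP l (\<lambda>_. c) (\<lambda>_. c) k x) sums P x"
    unfolding sums_def using tendsto_diff[OF tendsto_const[of "P x"] iter_tendsto_0(1)[where P=P and D=D and B=B and l=l and x=x, OF bd]] by simp
  have "(\<Sum>k<N. iterD l (\<lambda>_. c) (\<lambda>_. c) k x) = D x - iterD l P D N x" for N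
  proof (induction N)
    case (Suc N)
    then show ?case using sp[of N] x by (auto simp: algebra_simps)
  qed simp
  then show "(\<lambda>k. iterD l (\<lambda>_. c) (\<lambda>_. c) k x) sums D x"
    unfolding sums_def using tendsto_diff[OF tendsto_const[of "D x"] iter_tendsto_0(2)[where P=P and D=D and B=B and l=l and x=x, OF bd]] by simp
qed

lemma iter_zero: "iterP l (\<lambda>_. 0) (\<lambda>_. 0) k x = 0 \<and> iterD l (\<lambda>_. 0) (\<lambda>_. 0) k x = 0"
proof (induction k arbitrary: x)
  case (Suc k)
  then have "iterP l (\<lambda>_. 0) (\<lambda>_. 0) k = (\<lambda>_. 0)" "iterD l (\<lambda>_. 0) (\<lambda>_. 0) k = (\<lambda>_. 0)" by auto
  then show ?case by (simp add: stepP_def stepD_def)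
qed simp

text \<open>A solution of the homogeneous system equals each of its own iterates, and these tend to zero.\<close>

lemma homogeneous_unique:
  assumes "P \<in> borel_measurable borel" "D \<in> borel_measurable borel"
    and bd: "\<And>t. norm (P t) \<le> B" "\<And>t. norm (D t) \<le> B"
    and eqP: "\<And>x. x \<in> {0..1} \<Longrightarrow> P x = stepP l D x" and eqD: "\<And>x. x \<in> {0..1} \<Longrightarrow> D x = stepD l P x"
    and x: "x \<in> {0..1}"
  shows "P x = 0"
proof -
  have "(\<lambda>k. iterP l (\<lambda>_. 0) (\<lambda>_. 0) k x) sums P x"
    by (rule iter_sums(1)[OF assms(1-4)]) (use eqP eqD x in auto)
  then have "(\<lambda>k. 0) sums P x" by (simp add: iter_zero)
  then show ?thesis using sums_unique2 sums_zero by blast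
qed

end

text \<open>The convolution theorem with a kernel $G$ that depends on the integration variable: multiplication by
  $e^{-2 i \lambda c t}$ becomes translation by $c t$ on the side of the kernel.\<close>

lemma shear_fourier:
  fixes G :: "real \<times> real \<Rightarrow> complex" and w :: "real \<Rightarrow> complex"
  assumes [measurable]: "G \<in> borel_measurable (borel \<Otimes>\<^sub>M borel)" "w \<in> borel_measurable borel"
    and fin: "(\<integral>\<^sup>+t. ennreal (norm (w t)) * (\<integral>\<^sup>+s. ennreal (norm (G (t, s))) \<partial>lborel) \<partial>lborel) < \<infinity>"
  shows "(\<integral>t. w t * phase l (c * t) * (\<integral>s. G (t, s) * phase l s \<partial>lborel) \<partial>lborel)
       = (\<integral>s. (\<integral>t. w t * G (t, s - c * t) \<partial>lborel) * phase l s \<partial>lborel)"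
    and "AE s in lborel. integrable lborel (\<lambda>t. w t * G (t, s - c * t))"
    and "integrable lborel (\<lambda>s. (\<integral>t. w t * G (t, s - c * t) \<partial>lborel) * phase l s)"
proof -
  let ?H = "\<lambda>p. w (fst p) * G (fst p, snd p - c * fst p)"
  let ?HE = "\<lambda>p. w (fst p) * G (fst p, snd p - c * fst p) * phase l (snd p)"
  have sh: "(\<integral>\<^sup>+s. ennreal (norm (G (t, s - c * t))) \<partial>lborel) = (\<integral>\<^sup>+s. ennreal (norm (G (t, s))) \<partial>lborel)" for t
    using nn_integral_shift[of "\<lambda>s. ennreal (norm (G (t, s)))" "- (c * t)"] by simp
  have "(\<integral>\<^sup>+t. \<integral>\<^sup>+s. ennreal (norm (?H (t, s))) \<partial>lborel \<partial>lborel)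
     = (\<integral>\<^sup>+t. ennreal (norm (w t)) * (\<integral>\<^sup>+s. ennreal (norm (G (t, s))) \<partial>lborel) \<partial>lborel)"
  proof (rule nn_integral_cong)
    fix t
    have "(\<integral>\<^sup>+s. ennreal (norm (?H (t, s))) \<partial>lborel) = (\<integral>\<^sup>+s. ennreal (norm (w t)) * ennreal (norm (G (t, s - c * t))) \<partial>lborel)"
      by (simp add: norm_mult ennreal_mult)
    also have "\<dots> = ennreal (norm (w t)) * (\<integral>\<^sup>+s. ennreal (norm (G (t, s - c * t))) \<partial>lborel)"
      by (rule nn_integral_cmult) measurable
    finally show "(\<integral>\<^sup>+s. ennreal (norm (?H (t, s))) \<partial>lborel) = ennreal (norm (w t)) * (\<integral>\<^sup>+s. ennreal (norm (G (t, s))) \<partial>lborel)"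
      by (simp add: sh)
  qed
  then have H: "integrable (lborel \<Otimes>\<^sub>M lborel) ?H"
    using fin by (subst integrable_lborel_pair_iff) auto
  have HE: "integrable (lborel \<Otimes>\<^sub>M lborel) ?HE"
    by (rule Bochner_Integration.integrable_bound[OF H]) (auto simp: norm_mult)
  have eq: "w t * phase l (c * t) * (\<integral>s. G (t, s) * phase l s \<partial>lborel) = (\<integral>s. w t * G (t, s - c * t) * phase l s \<partial>lborel)" for t
  proof -
    have "(\<integral>s. G (t, s) * phase l s \<partial>lborel) = (\<integral>s. G (t, s - c * t) * phase l (s - c * t) \<partial>lborel)"
      using integral_shift[of "\<lambda>s. G (t, s) * phase l s" "- (c * t)"] by simp
    then have "w t * phase l (c * t) * (\<integral>s. G (t, s) * phase l s \<partial>lborel)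
       = (\<integral>s. w t * phase l (c * t) * (G (t, s - c * t) * phase l (s - c * t)) \<partial>lborel)"
      by simp
    also have "\<dots> = (\<integral>s. w t * G (t, s - c * t) * phase l s \<partial>lborel)"
    proof (rule Bochner_Integration.integral_cong[OF refl])
      fix s
      have "phase l (c * t) * phase l (s - c * t) = phase l s" by (simp add: phase_add[symmetric])
      then show "w t * phase l (c * t) * (G (t, s - c * t) * phase l (s - c * t)) = w t * G (t, s - c * t) * phase l s"
        by (metis (no_types, opaque_lifting) mult.assoc mult.commute)
    qed
    finally show ?thesis .
  qed
  have "(\<integral>t. w t * phase l (c * t) * (\<integral>s. G (t, s) * phase l s \<partial>lborel) \<partial>lborel)
     = (\<integral>t. \<integral>s. w t * G (t, s - c * t) * phase l s \<partial>lborel \<partial>lborel)"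
    unfolding eq ..
  also have "\<dots> = (\<integral>s. \<integral>t. w t * G (t, s - c * t) * phase l s \<partial>lborel \<partial>lborel)"
    using lborel_pair.Fubini_integral[of "\<lambda>t s. w t * G (t, s - c * t) * phase l s"] HE
    by (simp add: case_prod_unfold)
  also have "\<dots> = (\<integral>s. (\<integral>t. w t * G (t, s - c * t) \<partial>lborel) * phase l s \<partial>lborel)"
    by simp
  finally show "(\<integral>t. w t * phase l (c * t) * (\<integral>s. G (t, s) * phase l s \<partial>lborel) \<partial>lborel)
       = (\<integral>s. (\<integral>t. w t * G (t, s - c * t) \<partial>lborel) * phase l s \<partial>lborel)" .
  show "AE s in lborel. integrable lborel (\<lambda>t. w t * G (t, s - c * t))"
    using lborel_pair.AE_integrable_snd[of "\<lambda>t s. w t * G (t, s - c * t)"] H by (simp add: case_prod_unfold)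
  show "integrable lborel (\<lambda>s. (\<integral>t. w t * G (t, s - c * t) \<partial>lborel) * phase l s)"
    using lborel_pair.integrable_snd[of "\<lambda>t s. w t * G (t, s - c * t) * phase l s"] HE by (simp add: case_prod_unfold)
qed

context potential
begin

lemma ker_section_mass:
  "(\<integral>\<^sup>+s. ennreal (norm (kerP k (x, s))) \<partial>lborel) \<le> ennreal ((2 * Phi x) ^ Suc k / fact (Suc k))"
  "(\<integral>\<^sup>+s. ennreal (norm (kerD k (x, s))) \<partial>lborel) \<le> ennreal ((2 * Phi x) ^ Suc k / fact (Suc k))"
  using maj_mass[of k x] ker_le_maj[of k]
  by (metis (no_types, lifting) nn_integral_mono)+

lemma ker_shear_finite:
  assumes w: "\<And>t. norm (w t) \<le> 2 * norm (q t)" "\<And>t. x < t \<Longrightarrow> w t = 0"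
  shows "(\<integral>\<^sup>+t. ennreal (norm (w t)) * (\<integral>\<^sup>+s. ennreal (norm (kerP k (t, s))) \<partial>lborel) \<partial>lborel) < \<infinity>"
    and "(\<integral>\<^sup>+t. ennreal (norm (w t)) * (\<integral>\<^sup>+s. ennreal (norm (kerD k (t, s))) \<partial>lborel) \<partial>lborel) < \<infinity>"
proof -
  have *: "(\<integral>\<^sup>+t. ennreal (norm (w t)) * F t \<partial>lborel) < \<infinity>"
    if F: "\<And>t. F t \<le> ennreal ((2 * Phi t) ^ Suc k / fact (Suc k))" for F
  proof -
    have "(\<integral>\<^sup>+t. ennreal (norm (w t)) * F t \<partial>lborel)
       \<le> (\<integral>\<^sup>+t. indicator {..x} t * ennreal (2 * norm (q t)) * ennreal ((2 * Phi t) ^ Suc k / fact (Suc k)) \<partial>lborel)"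
    proof (rule nn_integral_mono)
      fix t
      show "ennreal (norm (w t)) * F t \<le> indicator {..x} t * ennreal (2 * norm (q t)) * ennreal ((2 * Phi t) ^ Suc k / fact (Suc k))"
        using w[of t] F[of t] by (cases "t \<le> x") (auto intro!: mult_mono ennreal_leI)
    qed
    also have "\<dots> < \<infinity>" unfolding Phi_fact by simp
    finally show ?thesis .
  qed
  show "(\<integral>\<^sup>+t. ennreal (norm (w t)) * (\<integral>\<^sup>+s. ennreal (norm (kerP k (t, s))) \<partial>lborel) \<partial>lborel) < \<infinity>"
    by (rule *) (rule ker_section_mass)
  show "(\<integral>\<^sup>+t. ennreal (norm (w t)) * (\<integral>\<^sup>+s. ennreal (norm (kerD k (t, s))) \<partial>lborel) \<partial>lborel) < \<infinity>"
    by (rule *) (rule ker_section_mass)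
qed

abbreviation one :: "real \<Rightarrow> complex" where "one \<equiv> \<lambda>_. 1"

text \<open>Fubini's theorem turns each Picard step into one step of the kernel recursion. The integral that
  defines a kernel converges for almost every frequency only, hence equality of the integrands is almost
  everywhere.\<close>

lemma iter_kernel:
  "iterP l one one (Suc k) x = (\<integral>s. kerP k (x, s) * phase l s \<partial>lborel)
   \<and> iterD l one one (Suc k) x = (\<integral>s. kerD k (x, s) * phase l s \<partial>lborel)"
proof (induction k arbitrary: x)
  case 0
  let ?z = "\<integral>t. indicator {..x} t *\<^sub>R (q t * phase l t) \<partial>lborel"
  have z: "cnj ?z = (\<integral>s. (indicator {..x} (- s) *\<^sub>R cnj (q (- s))) * phase l s \<partial>lborel)"
  proof -
    have "cnj ?z = (\<integral>t. cnj (indicator {..x} t *\<^sub>R (q t * phase l t)) \<partial>lborel)"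
      by (rule Bochner_Integration.integral_cnj[symmetric])
    also have "\<dots> = (\<integral>s. cnj (indicator {..x} (- s) *\<^sub>R (q (- s) * phase l (- s))) \<partial>lborel)"
      by (rule integral_reflect_line[symmetric])
    also have "\<dots> = (\<integral>s. (indicator {..x} (- s) *\<^sub>R cnj (q (- s))) * phase l s \<partial>lborel)"
      by (intro Bochner_Integration.integral_cong refl) (simp add: cnj_phase)
    finally show ?thesis .
  qed
  have i1: "integrable lborel (\<lambda>s. (indicator {..x} s *\<^sub>R q s) * phase l s)"
    by (rule Bochner_Integration.integrable_bound[OF q_int]) (auto simp: norm_mult indicator_def)
  have q': "integrable lborel (\<lambda>s. q (- s))"
    using lborel_integrable_real_affine[OF q_int, of "-1" 0] by simp
  have i2: "integrable lborel (\<lambda>s. (indicator {..x} (- s) *\<^sub>R cnj (q (- s))) * phase l s)"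
    by (rule Bochner_Integration.integrable_bound[OF q']) (auto simp: norm_mult indicator_def)
  have "iterP l one one (Suc 0) x = (\<integral>s. (indicator {..x} s *\<^sub>R q s) * phase l s \<partial>lborel)
      + (\<integral>s. (indicator {..x} (- s) *\<^sub>R cnj (q (- s))) * phase l s \<partial>lborel)"
    using z by (simp add: stepP_def)
  also have "\<dots> = (\<integral>s. (indicator {..x} s *\<^sub>R q s) * phase l s + (indicator {..x} (- s) *\<^sub>R cnj (q (- s))) * phase l s \<partial>lborel)"
    by (rule Bochner_Integration.integral_add[symmetric, OF i1 i2])
  also have "\<dots> = (\<integral>s. kerP 0 (x, s) * phase l s \<partial>lborel)"
    unfolding kerP.simps fst_conv snd_conv distrib_right ..
  finally have 1: "iterP l one one (Suc 0) x = (\<integral>s. kerP 0 (x, s) * phase l s \<partial>lborel)" .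
  have "iterD l one one (Suc 0) x = 2 * cnj ?z"
    unfolding iterD.simps iterP.simps stepD_def by (subst Bochner_Integration.integral_cnj[symmetric]) simp
  also have "\<dots> = (\<integral>s. 2 * ((indicator {..x} (- s) *\<^sub>R cnj (q (- s))) * phase l s) \<partial>lborel)"
    unfolding z by (rule integral_mult_right_zero[symmetric])
  also have "\<dots> = (\<integral>s. kerD 0 (x, s) * phase l s \<partial>lborel)"
    by (intro Bochner_Integration.integral_cong refl) simp
  finally show ?case using 1 by simp
next
  case (Suc k)
  define w where "w = (\<lambda>t. indicator {..x} t *\<^sub>R q t)"
  define v where "v = (\<lambda>t. indicator {..x} t *\<^sub>R (2 * cnj (q t)))"
  have [measurable]: "w \<in> borel_measurable borel" "v \<in> borel_measurable borel" unfolding w_def v_def by measurable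
  have wf: "(\<integral>\<^sup>+t. ennreal (norm (w t)) * (\<integral>\<^sup>+s. ennreal (norm (kerD k (t, s))) \<partial>lborel) \<partial>lborel) < \<infinity>"
    by (rule ker_shear_finite[of _ x]) (auto simp: w_def indicator_def)
  have vf: "(\<integral>\<^sup>+t. ennreal (norm (v t)) * (\<integral>\<^sup>+s. ennreal (norm (kerP k (t, s))) \<partial>lborel) \<partial>lborel) < \<infinity>"
    by (rule ker_shear_finite[of _ x]) (auto simp: v_def indicator_def norm_mult)
  note shw = shear_fourier(1,3)[OF ker_measurable(2) \<open>w \<in> _\<close> wf, where l=l and c=1, simplified]
    and shw_AE = shear_fourier(2)[OF ker_measurable(2) \<open>w \<in> _\<close> wf, where c=1, simplified]
  note shv = shear_fourier(1)[OF ker_measurable(1) \<open>v \<in> _\<close> vf, where l=l and c="-1", simplified]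
  define Z where "Z = (\<lambda>s. \<integral>t. w t * kerD k (t, s - t) \<partial>lborel)"
  let ?z = "\<integral>t. indicator {..x} t *\<^sub>R (q t * phase l t * iterD l one one (Suc k) t) \<partial>lborel"
  have zeq: "?z = (\<integral>s. Z s * phase l s \<partial>lborel)"
  proof -
    have "?z = (\<integral>t. w t * phase l t * (\<integral>s. kerD k (t, s) * phase l s \<partial>lborel) \<partial>lborel)"
      using Suc.IH by (intro Bochner_Integration.integral_cong refl) (simp add: w_def del: iterD.simps)
    then show ?thesis using shw(1) by (simp add: Z_def)
  qed
  have czeq: "cnj ?z = (\<integral>s. cnj (Z (- s)) * phase l s \<partial>lborel)"
  proof -
    have "cnj ?z = (\<integral>s. cnj (Z s * phase l s) \<partial>lborel)" unfolding zeq by (rule Bochner_Integration.integral_cnj[symmetric])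
    also have "\<dots> = (\<integral>s. cnj (Z (- s) * phase l (- s)) \<partial>lborel)" by (rule integral_reflect_line[symmetric])
    also have "\<dots> = (\<integral>s. cnj (Z (- s)) * phase l s \<partial>lborel)" by (simp add: cnj_phase)
    finally show ?thesis .
  qed
  have Zi: "integrable lborel (\<lambda>s. Z s * phase l s)" using shw(2) by (simp add: Z_def)
  have Zi': "integrable lborel (\<lambda>s. cnj (Z (- s)) * phase l s)"
  proof -
    have "integrable lborel (\<lambda>s. cnj (Z s * phase l s))" by (rule Bochner_Integration.integrable_cnj[OF Zi])
    from lborel_integrable_real_affine[OF this, of "-1" 0] show ?thesis by (simp add: cnj_phase)
  qed
  \<comment> \<open>The two parts of the kernel can be separated only where both are integrable.\<close>
  have AE1: "AE s in lborel. integrable lborel (\<lambda>t. w t * kerD k (t, s - t))" using shw_AE .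
  have AE2: "AE s in lborel. integrable lborel (\<lambda>t. w t * kerD k (t, - s - t))"
  proof -
    have "AE s in distr lborel borel uminus. integrable lborel (\<lambda>t. w t * kerD k (t, s - t))"
      unfolding lborel_distr_uminus by (rule AE1)
    then show ?thesis by (rule AE_distrD[rotated]) measurable
  qed
  have "stepP l (iterD l one one (Suc k)) x = (\<integral>s. Z s * phase l s \<partial>lborel) + (\<integral>s. cnj (Z (- s)) * phase l s \<partial>lborel)"
    unfolding stepP_def using zeq czeq by (simp only:)
  also have "\<dots> = (\<integral>s. Z s * phase l s + cnj (Z (- s)) * phase l s \<partial>lborel)"
    by (rule Bochner_Integration.integral_add[symmetric, OF Zi Zi'])
  also have "\<dots> = (\<integral>s. kerP (Suc k) (x, s) * phase l s \<partial>lborel)"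
  proof (rule integral_cong_AE)
    show "(\<lambda>s. Z s * phase l s + cnj (Z (- s)) * phase l s) \<in> borel_measurable lborel"
      using Zi Zi' by auto
    show "AE s in lborel. Z s * phase l s + cnj (Z (- s)) * phase l s = kerP (Suc k) (x, s) * phase l s"
      using AE1 AE2
    proof eventually_elim
      fix s assume a: "integrable lborel (\<lambda>t. w t * kerD k (t, s - t))" and b: "integrable lborel (\<lambda>t. w t * kerD k (t, - s - t))"
      have "kerP (Suc k) (x, s) = (\<integral>t. w t * kerD k (t, s - t) + cnj (w t * kerD k (t, - s - t)) \<partial>lborel)"
        unfolding kerP.simps fst_conv snd_conv
        by (intro Bochner_Integration.integral_cong refl) (simp add: w_def indicator_def)
      also have "\<dots> = Z s + (\<integral>t. cnj (w t * kerD k (t, - s - t)) \<partial>lborel)"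
        unfolding Z_def by (rule Bochner_Integration.integral_add[OF a Bochner_Integration.integrable_cnj[OF b]])
      also have "(\<integral>t. cnj (w t * kerD k (t, - s - t)) \<partial>lborel) = cnj (Z (- s))"
        unfolding Z_def by (rule Bochner_Integration.integral_cnj)
      finally show "Z s * phase l s + cnj (Z (- s)) * phase l s = kerP (Suc k) (x, s) * phase l s"
        by (simp add: distrib_right)
    qed
  qed measurable
  finally have 1: "iterP l one one (Suc (Suc k)) x = (\<integral>s. kerP (Suc k) (x, s) * phase l s \<partial>lborel)"
    by (simp only: iterP.simps)
  have "stepD l (iterP l one one (Suc k)) x = (\<integral>t. 2 * (indicator {..x} t *\<^sub>R (cnj (q t * phase l t) * iterP l one one (Suc k) t)) \<partial>lborel)"
    unfolding stepD_def by (rule integral_mult_right_zero[symmetric])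
  also have "\<dots> = (\<integral>t. v t * phase l (- t) * (\<integral>s. kerP k (t, s) * phase l s \<partial>lborel) \<partial>lborel)"
    using Suc.IH by (intro Bochner_Integration.integral_cong refl) (simp add: v_def cnj_phase del: iterP.simps)
  also have "\<dots> = (\<integral>s. (\<integral>t. v t * kerP k (t, s + t) \<partial>lborel) * phase l s \<partial>lborel)"
    using shv by simp
  also have "\<dots> = (\<integral>s. kerD (Suc k) (x, s) * phase l s \<partial>lborel)"
    unfolding kerD.simps fst_conv snd_conv v_def by simp
  finally have 2: "iterD l one one (Suc (Suc k)) x = (\<integral>s. kerD (Suc k) (x, s) * phase l s \<partial>lborel)"
    by (simp only: iterD.simps)
  show ?case using 1 2 by blast
qed

text \<open>The kernel is the sum of the kernels of all iterates. Its majorant $h$ is the sum of the majorants at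
  $x = 1$; on the null set where this sum is infinite the kernel is set to zero, which makes the bound hold
  everywhere.\<close>

theorem solution_kernel:
  obtains d :: "real \<times> real \<Rightarrow> complex" and h :: "real \<Rightarrow> real"
  where "d \<in> borel_measurable (borel \<Otimes>\<^sub>M borel)" "h \<in> borel_measurable borel"
    "\<And>s. 0 \<le> h s" "integrable lborel h" "\<And>t s. norm (d (t, s)) \<le> h s"
    "\<And>t s. 2 < \<bar>s\<bar> \<Longrightarrow> d (t, s) = 0"
    "\<And>l P D B x. \<lbrakk>P \<in> borel_measurable borel; D \<in> borel_measurable borel;
       \<And>t. norm (P t) \<le> B; \<And>t. norm (D t) \<le> B;
       \<And>x. x \<in> {0..1} \<Longrightarrow> P x = 1 + stepP l D x;
       \<And>x. x \<in> {0..1} \<Longrightarrow> D x = 1 + stepD l P x; x \<in> {0..1}\<rbrakk>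
      \<Longrightarrow> D x = 1 + (\<integral>s. d (x, s) * phase l s \<partial>lborel)"
proof -
  define m where "m = (\<lambda>s. \<Sum>k. majD k (1, s))"
  have [measurable]: "m \<in> borel_measurable borel" unfolding m_def by measurable
  have m_int: "(\<integral>\<^sup>+s. m s \<partial>lborel) < \<infinity>"
  proof -
    have "(\<integral>\<^sup>+s. m s \<partial>lborel) = (\<Sum>k. \<integral>\<^sup>+s. majD k (1, s) \<partial>lborel)"
      unfolding m_def by (rule nn_integral_suminf) measurable
    also have "\<dots> = (\<Sum>k. ennreal ((2 * Phi 1) ^ Suc k / fact (Suc k)))"
      using maj_mass by simp
    also have "\<dots> < \<infinity>"
    proof -
      have "summable (\<lambda>k. (2 * Phi 1) ^ k / fact k)"
        using summable_exp[of "2 * Phi 1"] by (simp add: divide_inverse mult.commute)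
      then have "summable (\<lambda>k. (2 * Phi 1) ^ Suc k / fact (Suc k))"
        by (subst summable_Suc_iff)
      then show ?thesis
        using Phi_nonneg[of 1] by (simp add: ennreal_suminf_neq_top less_top[symmetric] del: power_Suc fact_Suc)
    qed
    finally show ?thesis .
  qed
  have m_AE: "AE s in lborel. m s \<noteq> \<infinity>"
    by (rule nn_integral_PInf_AE) (use m_int in auto)
  define h where "h = (\<lambda>s. enn2real (m s))"
  define d where "d = (\<lambda>p. if fst p \<le> 1 \<and> m (snd p) \<noteq> \<infinity> then \<Sum>k. kerD k p else 0)"
  have d_meas [measurable]: "d \<in> borel_measurable (borel \<Otimes>\<^sub>M borel)" unfolding d_def by measurable
  have nk: "norm (kerD k (t, s)) \<le> enn2real (majD k (1, s))" "majD k (1, s) \<noteq> \<infinity>"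
    if "t \<le> 1" "m s \<noteq> \<infinity>" for k t s
  proof -
    have "majD k (1, s) \<le> m s" unfolding m_def
      using sum_le_suminf[of "\<lambda>k. majD k (1, s)" "{k}"] by simp
    then show f: "majD k (1, s) \<noteq> \<infinity>" using that by (auto simp: top_unique)
    have "ennreal (norm (kerD k (t, s))) \<le> majD k (t, s)" using ker_le_maj by blast
    also have "\<dots> \<le> majD k (1, s)" by (rule maj_mono[OF that(1)])
    finally show "norm (kerD k (t, s)) \<le> enn2real (majD k (1, s))"
      using f by (metis enn2real_ennreal enn2real_mono infinity_ennreal_def less_top norm_ge_zero)
  qed
  have msum: "summable (\<lambda>k. enn2real (majD k (1, s)))" "(\<Sum>k. enn2real (majD k (1, s))) = h s"
    if "m s \<noteq> \<infinity>" for s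
  proof -
    have e: "ennreal (enn2real (majD k (1, s))) = majD k (1, s)" for k
      using nk(2)[of 1 s k] that by (simp add: less_top)
    show "summable (\<lambda>k. enn2real (majD k (1, s)))"
      by (rule summable_suminf_not_top) (use that e in \<open>auto simp: m_def\<close>)
    then have "m s = ennreal (\<Sum>k. enn2real (majD k (1, s)))"
      unfolding m_def using suminf_ennreal2[of "\<lambda>k. enn2real (majD k (1, s))"] by (simp add: e)
    then show "(\<Sum>k. enn2real (majD k (1, s))) = h s"
      using \<open>summable (\<lambda>k. enn2real (majD k (1, s)))\<close> by (simp add: h_def suminf_nonneg)
  qed
  have ksum: "summable (\<lambda>k. norm (kerD k (t, s)))" "(\<Sum>k. norm (kerD k (t, s))) \<le> h s"
    if "t \<le> 1" "m s \<noteq> \<infinity>" for t s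
  proof -
    show a: "summable (\<lambda>k. norm (kerD k (t, s)))"
      by (rule summable_comparison_test[OF _ msum(1)[OF that(2)]]) (use nk(1)[OF that] in auto)
    show "(\<Sum>k. norm (kerD k (t, s))) \<le> h s"
      unfolding msum(2)[OF that(2), symmetric] by (rule suminf_le[OF nk(1)[OF that] a msum(1)[OF that(2)]])
  qed
  show ?thesis
  proof (rule that[of d h])
    show "d \<in> borel_measurable (borel \<Otimes>\<^sub>M borel)" by (rule d_meas)
    show "h \<in> borel_measurable borel" unfolding h_def by measurable
    show h0: "0 \<le> h s" for s by (simp add: h_def)
    show "integrable lborel h"
      unfolding integrable_iff_bounded
    proof
      have "(\<integral>\<^sup>+s. ennreal (norm (h s)) \<partial>lborel) = (\<integral>\<^sup>+s. m s \<partial>lborel)"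
        using m_AE by (intro nn_integral_cong_AE) (auto elim!: eventually_mono simp: h_def less_top)
      then show "(\<integral>\<^sup>+s. ennreal (norm (h s)) \<partial>lborel) < \<infinity>" using m_int by simp
    qed (simp add: h_def)
    show "norm (d (t, s)) \<le> h s" for t s
    proof (cases "t \<le> 1 \<and> m s \<noteq> \<infinity>")
      case True
      then have "norm (\<Sum>k. kerD k (t, s)) \<le> (\<Sum>k. norm (kerD k (t, s)))"
        by (intro summable_norm ksum) auto
      then show ?thesis using True ksum(2)[of t s] by (simp add: d_def)
    next
      case False
      then show ?thesis using h0 unfolding d_def by auto
    qed
    show "d (t, s) = 0" if "2 < \<bar>s\<bar>" for t s
    proof (cases "t \<le> 1")
      case True
      have "kerD k (t, s) = 0" for k
      proof -
        have "s < - 2 * t \<or> 0 < s" using that True by linarith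
        then have "majD k (t, s) = 0" using maj_support[of k] by blast
        then show ?thesis using ker_le_maj[of k "(t, s)"] by simp
      qed
      then show ?thesis by (simp add: d_def)
    qed (simp add: d_def)
  next
    fix l B x :: real and P D :: "real \<Rightarrow> complex"
    assume A: "P \<in> borel_measurable borel" "D \<in> borel_measurable borel"
       "\<And>t. norm (P t) \<le> B" "\<And>t. norm (D t) \<le> B"
       "\<And>x. x \<in> {0..1} \<Longrightarrow> P x = 1 + stepP l D x"
       "\<And>x. x \<in> {0..1} \<Longrightarrow> D x = 1 + stepD l P x" "x \<in> {0..1}"
    have "(\<lambda>k. iterD l one one k x) sums D x" by (rule iter_sums(2)[OF A])
    then have s: "(\<lambda>k. iterD l one one (Suc k) x) sums (D x - 1)"
      by (subst sums_Suc_iff) simp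
    have ki: "integrable lborel (\<lambda>s. kerD k (x, s) * phase l s)" for k
    proof -
      have "integrable lborel (\<lambda>s. kerD k (x, s))"
        unfolding integrable_iff_bounded using ker_section_mass(2)[of k x] by (auto simp: le_less_trans)
      then show ?thesis by (rule Bochner_Integration.integrable_bound) (auto simp: norm_mult)
    qed
    have x1: "x \<le> 1" using A by simp
    have "(\<integral>s. d (x, s) * phase l s \<partial>lborel) = (\<integral>s. (\<Sum>k. kerD k (x, s) * phase l s) \<partial>lborel)"
    proof (rule integral_cong_AE)
      show "AE s in lborel. d (x, s) * phase l s = (\<Sum>k. kerD k (x, s) * phase l s)"
        using m_AE
      proof eventually_elim
        fix s assume "m s \<noteq> \<infinity>"
        then show "d (x, s) * phase l s = (\<Sum>k. kerD k (x, s) * phase l s)"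
          using x1 suminf_mult2[OF summable_norm_cancel[OF ksum(1)[of x s]], of "phase l s"] by (simp add: d_def)
      qed
      show "(\<lambda>s. d (x, s) * phase l s) \<in> borel_measurable lborel" by measurable
      show "(\<lambda>s. \<Sum>k. kerD k (x, s) * phase l s) \<in> borel_measurable lborel" by measurable
    qed
    also have "\<dots> = (\<Sum>k. \<integral>s. kerD k (x, s) * phase l s \<partial>lborel)"
    proof (rule integral_suminf[OF ki])
      show "AE s in lborel. summable (\<lambda>k. norm (kerD k (x, s) * phase l s))"
        using m_AE by eventually_elim (use x1 ksum(1) in \<open>simp add: norm_mult\<close>)
      show "summable (\<lambda>k. \<integral>s. norm (kerD k (x, s) * phase l s) \<partial>lborel)"
      proof (rule summable_comparison_test)
        have "summable (\<lambda>k. (2 * Phi x) ^ k / fact k)"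
          using summable_exp[of "2 * Phi x"] by (simp add: divide_inverse mult.commute)
        then show "summable (\<lambda>k. (2 * Phi x) ^ Suc k / fact (Suc k))"
          by (subst summable_Suc_iff)
        have "ennreal (\<integral>s. norm (kerD k (x, s) * phase l s) \<partial>lborel) \<le> ennreal ((2 * Phi x) ^ Suc k / fact (Suc k))" for k
          using nn_integral_eq_integral[OF integrable_norm[OF ki[of k]]] ker_section_mass(2)[of k x]
          by (simp add: norm_mult del: power_Suc fact_Suc)
        then have "(\<integral>s. norm (kerD k (x, s) * phase l s) \<partial>lborel) \<le> (2 * Phi x) ^ Suc k / fact (Suc k)" for k
          using Phi_nonneg[of x] by (subst (asm) ennreal_le_iff) auto
        then show "\<exists>N. \<forall>k\<ge>N. norm (\<integral>s. norm (kerD k (x, s) * phase l s) \<partial>lborel) \<le> (2 * Phi x) ^ Suc k / fact (Suc k)"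
          by (intro exI[of _ 0]) (auto simp: integral_nonneg_AE simp del: power_Suc fact_Suc)
      qed
    qed
    also have "\<dots> = (\<Sum>k. iterD l one one (Suc k) x)" using iter_kernel by (simp del: iterD.simps)
    also have "\<dots> = D x - 1" using s by (rule sums_unique[symmetric])
    finally show "D x = 1 + (\<integral>s. d (x, s) * phase l s \<partial>lborel)" by simp
  qed
qed

end

section \<open>Absolutely continuous functions\<close>

lemma AC01_obtain:
  assumes f: "f \<in> AC01" and e: "0 < e"
  obtains d where "0 < d" "\<And>(n::nat) a b. \<lbrakk>\<forall>k<n. 0 \<le> a k \<and> a k \<le> b k \<and> b k \<le> 1;
      disjoint_family_on (\<lambda>k. {a k<..<b k}) {..<n}; (\<Sum>k<n. b k - a k) < d\<rbrakk>
      \<Longrightarrow> (\<Sum>k<n. norm (f (b k) - f (a k))) < e"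
proof -
  obtain d where d: "0 < d" "\<forall>(n::nat) a b. (\<forall>k<n. 0 \<le> a k \<and> a k \<le> b k \<and> b k \<le> 1) \<and>
      disjoint_family_on (\<lambda>k. {a k<..<b k}) {..<n} \<and> (\<Sum>k<n. b k - a k) < d
      \<longrightarrow> (\<Sum>k<n. norm (f (b k) - f (a k))) < e"
    using spec[OF CollectD[OF f[unfolded AC01_def]], THEN mp, OF e] by (elim exE conjE)
  show ?thesis
    by (rule that[OF d(1)], rule d(2)[THEN spec, THEN spec, THEN spec, THEN mp]) (intro conjI)
qed

text \<open>The definition of absolute continuity, for families indexed by an arbitrary finite set, as
  needed for tagged divisions.\<close>

lemma AC01_finite_family:
  assumes f: "f \<in> AC01" and e: "0 < e"
  obtains d where "0 < d"
    "\<And>(I :: 'i set) u v. \<lbrakk>finite I; \<And>i. i \<in> I \<Longrightarrow> 0 \<le> u i \<and> u i \<le> v i \<and> v i \<le> 1;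
       disjoint_family_on (\<lambda>i. {u i<..<v i}) I; (\<Sum>i\<in>I. v i - u i) < d\<rbrakk>
      \<Longrightarrow> (\<Sum>i\<in>I. norm (f (v i) - f (u i))) < e"
proof -
  obtain d where d: "d > 0" "\<And>(n::nat) a b. \<lbrakk>\<forall>k<n. 0 \<le> a k \<and> a k \<le> b k \<and> b k \<le> 1;
      disjoint_family_on (\<lambda>k. {a k<..<b k}) {..<n}; (\<Sum>k<n. b k - a k) < d\<rbrakk>
      \<Longrightarrow> (\<Sum>k<n. norm (f (b k) - f (a k))) < e"
    by (rule AC01_obtain[OF f e]) blast
  show ?thesis
  proof (rule that[OF d(1)])
    fix I :: "'i set" and u v
    assume I: "finite I" "\<And>i. i \<in> I \<Longrightarrow> 0 \<le> u i \<and> u i \<le> v i \<and> v i \<le> 1"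
       "disjoint_family_on (\<lambda>i. {u i<..<v i}) I" "(\<Sum>i\<in>I. v i - u i) < d"
    obtain h where h: "bij_betw h {0..<card I} I" using ex_bij_betw_nat_finite[OF I(1)] by blast
    then have h': "bij_betw h {..<card I} I" by (simp add: atLeast0LessThan)
    have hI: "h k \<in> I" if "k < card I" for k using h' that by (auto simp: bij_betw_def)
    have sums: "(\<Sum>k<card I. F (h k)) = (\<Sum>i\<in>I. F i)" for F :: "'i \<Rightarrow> real"
      by (rule sum.reindex_bij_betw[OF h'])
    have "(\<Sum>k<card I. norm (f (v (h k)) - f (u (h k)))) < e"
    proof (rule d(2))
      show "disjoint_family_on (\<lambda>k. {u (h k)<..<v (h k)}) {..<card I}"
        unfolding disjoint_family_on_def
      proof (intro ballI impI)
        fix m n assume mn: "m \<in> {..<card I}" "n \<in> {..<card I}" "m \<noteq> n"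
        then have "h m \<noteq> h n" using h' by (auto simp: bij_betw_def inj_on_def)
        then show "{u (h m)<..<v (h m)} \<inter> {u (h n)<..<v (h n)} = {}"
          using I(3) hI mn unfolding disjoint_family_on_def by auto
      qed
      show "(\<Sum>k<card I. v (h k) - u (h k)) < d" using sums[of "\<lambda>i. v i - u i"] I(4) by simp
    qed (use I(2) hI in auto)
    then show "(\<Sum>i\<in>I. norm (f (v i) - f (u i))) < e"
      using sums[of "\<lambda>i. norm (f (v i) - f (u i))"] by simp
  qed
qed

lemma sum_lengths_le_open:
  fixes u v :: "'i \<Rightarrow> real"
  assumes fin: "finite I" and uv: "\<And>i. i \<in> I \<Longrightarrow> u i \<le> v i \<and> {u i<..<v i} \<subseteq> G"
    and dj: "disjoint_family_on (\<lambda>i. {u i<..<v i}) I" and G: "G \<in> sets lebesgue"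
  shows "ennreal (\<Sum>i\<in>I. v i - u i) \<le> emeasure lebesgue G"
proof -
  have "ennreal (\<Sum>i\<in>I. v i - u i) = (\<Sum>i\<in>I. ennreal (v i - u i))"
    using uv by (subst sum_ennreal) auto
  also have "\<dots> = (\<Sum>i\<in>I. emeasure lebesgue {u i<..<v i})"
    using uv by (intro sum.cong refl) auto
  also have "\<dots> = emeasure lebesgue (\<Union>i\<in>I. {u i<..<v i})"
    by (rule sum_emeasure[OF _ dj fin]) auto
  also have "\<dots> \<le> emeasure lebesgue G"
    using uv by (intro emeasure_mono G) auto
  finally show ?thesis .
qed

text \<open>The Newton--Leibniz formula for an absolutely continuous function, directly in the gauge
  integral. Around tags outside the exceptional set the gauge is given by differentiability. Around tags in it, the
  gauge keeps the intervals inside an open set of small measure, and absolute continuity bounds the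
  increments over these intervals.\<close>

theorem AC01_fundamental_theorem:
  assumes f: "f \<in> AC01" and N: "negligible N"
    and der: "\<And>x. x \<in> {0..1} - N \<Longrightarrow> (f has_vector_derivative f' x) (at x within {0..1})"
    and b: "0 \<le> b" "b \<le> 1"
  shows "(f' has_integral (f b - f 0)) {0..b}"
proof -
  \<comment> \<open>Values on a null set do not matter for the integral but would spoil the Riemann sums.\<close>
  define g where "g = (\<lambda>x. if x \<in> N then 0 else f' x)"
  have "(g has_integral (f b - f 0)) {0..b}"
    unfolding has_integral_real
  proof (intro allI impI)
    fix e :: real assume e: "0 < e"
    define e1 where "e1 = e / 4"
    have e1: "0 < e1" using e by (simp add: e1_def)
    obtain d where d: "0 < d" "\<And>(I :: (real \<times> real set) set) u v. \<lbrakk>finite I; \<And>i. i \<in> I \<Longrightarrow> 0 \<le> u i \<and> u i \<le> v i \<and> v i \<le> 1;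
       disjoint_family_on (\<lambda>i. {u i<..<v i}) I; (\<Sum>i\<in>I. v i - u i) < d\<rbrakk>
      \<Longrightarrow> (\<Sum>i\<in>I. norm (f (v i) - f (u i))) < e1"
      by (rule AC01_finite_family[OF f e1]) blast
    have N0: "N \<in> null_sets lebesgue" using N by (simp add: negligible_iff_null_sets)
    obtain G where G: "open G" "N \<subseteq> G" "emeasure lebesgue (G - N) < ennreal d"
      using sets_lebesgue_outer_open[of N d] N0 d(1) by (metis null_setsD2)
    have Gs: "G \<in> sets lebesgue" using G(1) by auto
    have Gd: "emeasure lebesgue G < ennreal d"
      using G(3) emeasure_Diff_null_set[OF N0 Gs] by simp
    have "\<exists>r>0. (x \<in> N \<longrightarrow> ball x r \<subseteq> G) \<and> (x \<in> {0..1} - N \<longrightarrow>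
         (\<forall>y\<in>{0..1}. norm (y - x) < r \<longrightarrow> norm (f y - f x - (y - x) *\<^sub>R f' x) \<le> e1 * norm (y - x)))" for x
    proof (cases "x \<in> N")
      case True
      then show ?thesis using G(1,2) unfolding open_contains_ball by blast
    next
      case False
      show ?thesis
      proof (cases "x \<in> {0..1}")
        case True
        then show ?thesis using der[of x] False e1
          unfolding has_vector_derivative_def has_derivative_within_alt by blast
      qed (use False in \<open>auto intro: exI[of _ 1]\<close>)
    qed
    then obtain r where r: "\<And>x. 0 < r x" "\<And>x. x \<in> N \<Longrightarrow> ball x (r x) \<subseteq> G"
      "\<And>x y. \<lbrakk>x \<in> {0..1} - N; y \<in> {0..1}; norm (y - x) < r x\<rbrakk> \<Longrightarrow> norm (f y - f x - (y - x) *\<^sub>R f' x) \<le> e1 * norm (y - x)"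
      by metis
    show "\<exists>\<gamma>. gauge \<gamma> \<and> (\<forall>p. p tagged_division_of {0..b} \<and> \<gamma> fine p \<longrightarrow>
        norm ((\<Sum>(x,k)\<in>p. measure lborel k *\<^sub>R g x) - (f b - f 0)) < e)"
    proof (intro exI[of _ "\<lambda>x. ball x (r x)"] conjI allI impI)
      show "gauge (\<lambda>x. ball x (r x))" using r(1) gauge_ball_dependent by blast
      fix p assume "p tagged_division_of {0..b} \<and> (\<lambda>x. ball x (r x)) fine p"
      then have p: "p tagged_division_of {0..b}" and fine: "(\<lambda>x. ball x (r x)) fine p" by auto
      have finp: "finite p" using p by auto
      have K: "\<exists>u v. K = {u..v} \<and> u \<le> x \<and> x \<le> v \<and> 0 \<le> u \<and> v \<le> b \<and> {u..v} \<subseteq> ball x (r x)" if "(x, K) \<in> p" for x K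
      proof -
        have "x \<in> K" "K \<subseteq> {0..b}" "\<exists>u v. K = cbox u v" "K \<subseteq> ball x (r x)"
          using p fine that by blast+
        then show ?thesis by auto
      qed
      define u where "u = (\<lambda>i::real \<times> real set. Inf (snd i))"
      define v where "v = (\<lambda>i::real \<times> real set. Sup (snd i))"
      have uv: "snd i = {u i..v i}" "u i \<le> fst i" "fst i \<le> v i" "0 \<le> u i" "v i \<le> b" "{u i..v i} \<subseteq> ball (fst i) (r (fst i))" if "i \<in> p" for i
        using K[of "fst i" "snd i"] that by (auto simp: u_def v_def)
      have cont: "measure lborel (snd i) = v i - u i" if "i \<in> p" for i
        using uv[OF that] by simp
      have fb: "f b - f 0 = (\<Sum>i\<in>p. f (v i) - f (u i))" "b = (\<Sum>i\<in>p. v i - u i)"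
        using additive_tagged_division_1[OF b(1) p, of f] additive_tagged_division_1[OF b(1) p, of "\<lambda>x. x"]
        by (auto simp: u_def v_def case_prod_unfold)
      have dj: "disjoint_family_on (\<lambda>i. {u i<..<v i}) p"
        unfolding disjoint_family_on_def
      proof (intro ballI impI)
        fix i j assume ij: "i \<in> p" "j \<in> p" "i \<noteq> j"
        have "interior (snd i) \<inter> interior (snd j) = {}"
          using tagged_division_ofD(5)[OF p, of "fst i" "snd i" "fst j" "snd j"] ij by simp
        then show "{u i<..<v i} \<inter> {u j<..<v j} = {}" using uv(1) ij by simp
      qed
      let ?A = "{i\<in>p. fst i \<in> N}"
      let ?t = "\<lambda>i. (v i - u i) *\<^sub>R g (fst i) - (f (v i) - f (u i))"
      have "(\<Sum>(x,k)\<in>p. measure lborel k *\<^sub>R g x) - (f b - f 0) = (\<Sum>i\<in>p. ?t i)"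
        unfolding fb(1) sum_subtractf by (simp add: case_prod_unfold cont cong: sum.cong)
      also have "\<dots> = (\<Sum>i\<in>?A. ?t i) + (\<Sum>i\<in>p - ?A. ?t i)"
        using finp by (subst sum.subset_diff[of ?A p]) auto
      finally have split: "(\<Sum>(x,k)\<in>p. measure lborel k *\<^sub>R g x) - (f b - f 0) = (\<Sum>i\<in>?A. ?t i) + (\<Sum>i\<in>p - ?A. ?t i)" .
      have "norm (\<Sum>i\<in>?A. ?t i) \<le> (\<Sum>i\<in>?A. norm (f (v i) - f (u i)))"
        by (rule sum_norm_le) (auto simp: g_def norm_minus_commute)
      also have "\<dots> < e1"
      proof (rule d(2))
        show djA: "disjoint_family_on (\<lambda>i. {u i<..<v i}) ?A"
          using dj by (rule disjoint_family_on_mono[rotated]) auto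
        have "ennreal (\<Sum>i\<in>?A. v i - u i) \<le> emeasure lebesgue G"
        proof (rule sum_lengths_le_open[OF _ _ djA Gs])
          fix i assume i: "i \<in> ?A"
          then have "{u i..v i} \<subseteq> G" using uv(6)[of i] r(2)[of "fst i"] by auto
          moreover have "u i \<le> v i" using uv(2,3)[of i] i by auto
          moreover have "{u i<..<v i} \<subseteq> {u i..v i}" by auto
          ultimately show "u i \<le> v i \<and> {u i<..<v i} \<subseteq> G" by blast
        qed (use finp in simp)
        with Gd have "ennreal (\<Sum>i\<in>?A. v i - u i) < ennreal d" by simp
        then show "(\<Sum>i\<in>?A. v i - u i) < d" by (meson ennreal_leI leD leI)
      next
        fix i assume "i \<in> ?A"
        then show "0 \<le> u i \<and> u i \<le> v i \<and> v i \<le> 1" using uv[of i] b by auto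
      qed (use finp in simp)
      finally have 1: "norm (\<Sum>i\<in>?A. ?t i) < e1" .
      have "norm (\<Sum>i\<in>p - ?A. ?t i) \<le> (\<Sum>i\<in>p - ?A. e1 * (v i - u i))"
      proof (rule sum_norm_le)
        fix i assume i: "i \<in> p - ?A"
        let ?x = "fst i"
        have x: "?x \<in> {0..1} - N" using i uv[of i] b by auto
        have inb: "norm (u i - ?x) < r ?x" "norm (v i - ?x) < r ?x"
        proof -
          have "u i \<in> {u i..v i}" "v i \<in> {u i..v i}" using uv[of i] i by auto
          then have "u i \<in> ball ?x (r ?x)" "v i \<in> ball ?x (r ?x)" using uv(6)[of i] i by blast+
          then show "norm (u i - ?x) < r ?x" "norm (v i - ?x) < r ?x" by (auto simp: dist_real_def)
        qed
        have "norm (f (u i) - f ?x - (u i - ?x) *\<^sub>R f' ?x) \<le> e1 * norm (u i - ?x)"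
             "norm (f (v i) - f ?x - (v i - ?x) *\<^sub>R f' ?x) \<le> e1 * norm (v i - ?x)"
          by (rule r(3)[OF x]; use inb uv[of i] i b in auto)+
        moreover have t: "?t i = (f (u i) - f ?x - (u i - ?x) *\<^sub>R f' ?x) - (f (v i) - f ?x - (v i - ?x) *\<^sub>R f' ?x)"
          using x by (simp add: g_def algebra_simps)
        have "norm (?t i) \<le> norm (f (u i) - f ?x - (u i - ?x) *\<^sub>R f' ?x) + norm (f (v i) - f ?x - (v i - ?x) *\<^sub>R f' ?x)"
          unfolding t by (rule norm_triangle_ineq4)
        ultimately have "norm (?t i) \<le> e1 * norm (u i - ?x) + e1 * norm (v i - ?x)" by linarith
        also have "\<dots> = e1 * (v i - u i)" using uv[of i] i by (simp add: algebra_simps)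
        finally show "norm (?t i) \<le> e1 * (v i - u i)" .
      qed
      also have "\<dots> \<le> (\<Sum>i\<in>p. e1 * (v i - u i))"
      proof (rule sum_mono2[OF finp])
        fix i assume "i \<in> p - (p - ?A)"
        then show "0 \<le> e1 * (v i - u i)" using uv[of i] e1 by auto
      qed auto
      also have "\<dots> = e1 * b" using fb(2) by (simp add: sum_distrib_left)
      also have "\<dots> \<le> e1" using b e1 by (simp add: mult_left_le)
      finally have 2: "norm (\<Sum>i\<in>p - ?A. ?t i) \<le> e1" .
      show "norm ((\<Sum>(x,k)\<in>p. measure lborel k *\<^sub>R g x) - (f b - f 0)) < e"
        unfolding split using norm_triangle_ineq[of "\<Sum>i\<in>?A. ?t i" "\<Sum>i\<in>p - ?A. ?t i"] 1 2 e by (simp add: e1_def)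
    qed
  qed
  then show ?thesis
    by (rule has_integral_spike[OF N, rotated]) (simp add: g_def)
qed

lemma AC01_continuous:
  assumes f: "f \<in> AC01" shows "continuous_on {0..1} f"
  unfolding continuous_on_iff
proof (intro ballI allI impI)
  fix x e :: real assume x: "x \<in> {0..1}" and e: "0 < e"
  obtain d where d: "0 < d" "\<And>(I :: nat set) u v. \<lbrakk>finite I; \<And>i. i \<in> I \<Longrightarrow> 0 \<le> u i \<and> u i \<le> v i \<and> v i \<le> 1;
       disjoint_family_on (\<lambda>i. {u i<..<v i}) I; (\<Sum>i\<in>I. v i - u i) < d\<rbrakk>
      \<Longrightarrow> (\<Sum>i\<in>I. norm (f (v i) - f (u i))) < e"
    by (rule AC01_finite_family[OF f e]) blast
  have key: "norm (f t - f s) < e" if "0 \<le> s" "s \<le> t" "t \<le> 1" "t - s < d" for s t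
    using d(2)[of "{0}" "\<lambda>_. s" "\<lambda>_. t"] that by (simp add: disjoint_family_on_def)
  show "\<exists>d>0. \<forall>y\<in>{0..1}. dist y x < d \<longrightarrow> dist (f y) (f x) < e"
  proof (intro exI[of _ d] conjI ballI impI)
    fix y :: real assume y: "y \<in> {0..1}" "dist y x < d"
    show "dist (f y) (f x) < e"
      using key[of x y] key[of y x] x y by (cases "x \<le> y") (auto simp: dist_norm norm_minus_commute dist_real_def)
  qed (rule d(1))
qed

lemma AC01_bounded:
  assumes "f \<in> AC01" obtains B where "0 \<le> B" "\<And>x. x \<in> {0..1} \<Longrightarrow> norm (f x) \<le> B"
proof -
  have "compact (f ` {0..1})" by (intro compact_continuous_image AC01_continuous assms compact_Icc)
  then obtain B where B: "\<forall>y\<in>f ` {0..1}. norm y \<le> B" using compact_imp_bounded bounded_iff by metis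
  show ?thesis by (rule that[of "max 0 B"]) (use B in \<open>auto simp: le_max_iff_disj\<close>)
qed

text \<open>All closure properties of absolutely continuous functions reduce to a bound for increments.\<close>

lemma AC01_comparison:
  assumes f: "f \<in> AC01" and g: "g \<in> AC01" and C: "0 \<le> C"
    and h: "\<And>x y. 0 \<le> x \<Longrightarrow> x \<le> y \<Longrightarrow> y \<le> 1 \<Longrightarrow> norm (h y - h x) \<le> C * (norm (f y - f x) + norm (g y - g x))"
  shows "h \<in> AC01"
  unfolding AC01_def
proof (intro CollectI allI impI)
  fix e :: real assume e: "0 < e"
  define e1 where "e1 = e / (2 * (C + 1))"
  have e1: "0 < e1" using e C by (simp add: e1_def)
  obtain d1 where d1: "d1 > 0" "\<And>(n::nat) a b. \<lbrakk>\<forall>k<n. 0 \<le> a k \<and> a k \<le> b k \<and> b k \<le> 1;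
      disjoint_family_on (\<lambda>k. {a k<..<b k}) {..<n}; (\<Sum>k<n. b k - a k) < d1\<rbrakk>
      \<Longrightarrow> (\<Sum>k<n. norm (f (b k) - f (a k))) < e1"
    by (rule AC01_obtain[OF f e1]) blast
  obtain d2 where d2: "d2 > 0" "\<And>(n::nat) a b. \<lbrakk>\<forall>k<n. 0 \<le> a k \<and> a k \<le> b k \<and> b k \<le> 1;
      disjoint_family_on (\<lambda>k. {a k<..<b k}) {..<n}; (\<Sum>k<n. b k - a k) < d2\<rbrakk>
      \<Longrightarrow> (\<Sum>k<n. norm (g (b k) - g (a k))) < e1"
    by (rule AC01_obtain[OF g e1]) blast
  show "\<exists>\<delta>>0. \<forall>(n::nat) a b. (\<forall>k<n. 0 \<le> a k \<and> a k \<le> b k \<and> b k \<le> 1) \<and>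
      disjoint_family_on (\<lambda>k. {a k<..<b k}) {..<n} \<and> (\<Sum>k<n. b k - a k) < \<delta>
      \<longrightarrow> (\<Sum>k<n. norm (h (b k) - h (a k))) < e"
  proof (intro exI[of _ "min d1 d2"] conjI allI impI)
    fix n :: nat and a b :: "nat \<Rightarrow> real"
    assume A: "(\<forall>k<n. 0 \<le> a k \<and> a k \<le> b k \<and> b k \<le> 1) \<and>
      disjoint_family_on (\<lambda>k. {a k<..<b k}) {..<n} \<and> (\<Sum>k<n. b k - a k) < min d1 d2"
    have "(\<Sum>k<n. norm (h (b k) - h (a k))) \<le> (\<Sum>k<n. C * (norm (f (b k) - f (a k)) + norm (g (b k) - g (a k))))"
      using A by (intro sum_mono h) auto
    also have "\<dots> = C * ((\<Sum>k<n. norm (f (b k) - f (a k))) + (\<Sum>k<n. norm (g (b k) - g (a k))))"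
      by (simp add: sum_distrib_left sum.distrib distrib_left)
    also have "\<dots> \<le> C * (e1 + e1)"
      using A d1(2)[of n a b] d2(2)[of n a b] C by (intro mult_left_mono add_mono) auto
    also have "\<dots> < (C + 1) * (e1 + e1)" using e1 by (intro mult_strict_right_mono) auto
    also have "\<dots> = e1 * (2 * (C + 1))" by (simp add: algebra_simps)
    also have "\<dots> = e" using C by (simp add: e1_def)
    finally show "(\<Sum>k<n. norm (h (b k) - h (a k))) < e" .
  qed (use d1 d2 in auto)
qed

lemma AC01_add: assumes "f \<in> AC01" "g \<in> AC01" shows "(\<lambda>x. f x + g x) \<in> AC01"
proof (rule AC01_comparison[OF assms, of 1])
  fix x y :: real
  have "f y + g y - (f x + g x) = (f y - f x) + (g y - g x)" by simp
  then show "norm (f y + g y - (f x + g x)) \<le> 1 * (norm (f y - f x) + norm (g y - g x))"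
    using norm_triangle_ineq by (metis mult_1)
qed simp

lemma AC01_cnj: assumes "f \<in> AC01" shows "(\<lambda>x. cnj (f x)) \<in> AC01"
  by (rule AC01_comparison[OF assms assms, of 1]) (simp_all flip: complex_cnj_diff)

lemma AC01_cmult: assumes "f \<in> AC01" shows "(\<lambda>x. c * f x) \<in> AC01"
proof (rule AC01_comparison[OF assms assms, of "norm c"])
  fix x y :: real
  have "norm (c * f y - c * f x) = norm c * norm (f y - f x)"
    by (simp add: norm_mult flip: right_diff_distrib)
  also have "\<dots> \<le> norm c * (norm (f y - f x) + norm (f y - f x))" by (intro mult_left_mono) auto
  finally show "norm (c * f y - c * f x) \<le> norm c * (norm (f y - f x) + norm (f y - f x))" .
qed simp

lemma AC01_mult: assumes f: "f \<in> AC01" and g: "g \<in> AC01" shows "(\<lambda>x. f x * g x) \<in> AC01"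
proof -
  obtain A where A: "0 \<le> A" "\<And>x. x \<in> {0..1} \<Longrightarrow> norm (f x) \<le> A" using AC01_bounded[OF f] by blast
  obtain B where B: "0 \<le> B" "\<And>x. x \<in> {0..1} \<Longrightarrow> norm (g x) \<le> B" using AC01_bounded[OF g] by blast
  show ?thesis
  proof (rule AC01_comparison[OF f g, of "A + B"])
    fix x y :: real assume xy: "0 \<le> x" "x \<le> y" "y \<le> 1"
    have "f y * g y - f x * g x = (f y - f x) * g y + f x * (g y - g x)" by (simp add: algebra_simps)
    then have "norm (f y * g y - f x * g x) \<le> norm (f y - f x) * norm (g y) + norm (f x) * norm (g y - g x)"
      using norm_triangle_ineq[of "(f y - f x) * g y" "f x * (g y - g x)"] by (simp add: norm_mult)
    also have "\<dots> \<le> norm (f y - f x) * (A + B) + (A + B) * norm (g y - g x)"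
      using A(2)[of x] B(2)[of y] A(1) B(1) xy by (intro add_mono mult_left_mono mult_right_mono) auto
    also have "\<dots> = (A + B) * (norm (f y - f x) + norm (g y - g x))" by (simp add: algebra_simps)
    finally show "norm (f y * g y - f x * g x) \<le> (A + B) * (norm (f y - f x) + norm (g y - g x))" .
  qed (use A B in simp)
qed

lemma AC01_lipschitz:
  assumes "\<And>x y. 0 \<le> x \<Longrightarrow> x \<le> y \<Longrightarrow> y \<le> 1 \<Longrightarrow> norm (f y - f x) \<le> C * (y - x)"
  shows "f \<in> AC01"
  unfolding AC01_def
proof (intro CollectI allI impI)
  fix e :: real assume e: "0 < e"
  show "\<exists>\<delta>>0. \<forall>(n::nat) a b. (\<forall>k<n. 0 \<le> a k \<and> a k \<le> b k \<and> b k \<le> 1) \<and>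
      disjoint_family_on (\<lambda>k. {a k<..<b k}) {..<n} \<and> (\<Sum>k<n. b k - a k) < \<delta>
      \<longrightarrow> (\<Sum>k<n. norm (f (b k) - f (a k))) < e"
  proof (intro exI[of _ "e / (\<bar>C\<bar> + 1)"] conjI allI impI)
    fix n :: nat and a b :: "nat \<Rightarrow> real"
    assume A: "(\<forall>k<n. 0 \<le> a k \<and> a k \<le> b k \<and> b k \<le> 1) \<and>
      disjoint_family_on (\<lambda>k. {a k<..<b k}) {..<n} \<and> (\<Sum>k<n. b k - a k) < e / (\<bar>C\<bar> + 1)"
    have "(\<Sum>k<n. norm (f (b k) - f (a k))) \<le> (\<Sum>k<n. (\<bar>C\<bar> + 1) * (b k - a k))"
    proof (rule sum_mono)
      fix k assume "k \<in> {..<n}"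
      then have k: "0 \<le> a k" "a k \<le> b k" "b k \<le> 1" using A by auto
      have "norm (f (b k) - f (a k)) \<le> C * (b k - a k)" by (rule assms[OF k])
      also have "\<dots> \<le> (\<bar>C\<bar> + 1) * (b k - a k)" using k by (intro mult_right_mono) auto
      finally show "norm (f (b k) - f (a k)) \<le> (\<bar>C\<bar> + 1) * (b k - a k)" .
    qed
    also have "\<dots> = (\<bar>C\<bar> + 1) * (\<Sum>k<n. b k - a k)" by (simp add: sum_distrib_left)
    also have "\<dots> < (\<bar>C\<bar> + 1) * (e / (\<bar>C\<bar> + 1))" using A by (intro mult_strict_left_mono) auto
    also have "\<dots> = e" by simp
    finally show "(\<Sum>k<n. norm (f (b k) - f (a k))) < e" .
  qed (use e in \<open>auto intro: divide_pos_pos\<close>)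
qed

section \<open>Quadratic quantities of solutions of the Dirac system\<close>

text \<open>With $a = u_1$ and $b = u_2$, the two sides are the derivative of $P$ by the product rule and the
  right-hand side of the linear system. The spectral parameter cancels because it acts as an infinitesimal rotation of
  $(u_1, u_2)$.\<close>

lemma P_derivative_algebra:
  fixes a b :: complex and q1 q2 t :: real
  assumes a': "a' = of_real q2 * a - of_real q1 * b - of_real t * b"
    and b': "b' = of_real t * a - of_real q1 * a - of_real q2 * b"
  shows "a * cnj a' + a' * cnj a + (b * cnj b' + b' * cnj b)
     = (of_real q2 - \<i> * of_real q1) * (cnj (a + \<i> * b) * (a - \<i> * b))
       + cnj ((of_real q2 - \<i> * of_real q1) * (cnj (a + \<i> * b) * (a - \<i> * b)))"
  unfolding a' b' by (simp add: complex_eq_iff algebra_simps)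

text \<open>For $D$ the same rotation produces a phase, which the factor $e^{2 i \lambda x}$ in $D$
  compensates.\<close>

lemma D_derivative_algebra:
  fixes a b :: complex and q1 q2 t :: real
  assumes a': "a' = of_real q2 * a - of_real q1 * b - of_real t * b"
    and b': "b' = of_real t * a - of_real q1 * a - of_real q2 * b"
  shows "2 * \<i> * of_real t * (cnj (a + \<i> * b) * (a - \<i> * b))
        + (cnj (a + \<i> * b) * (a' - \<i> * b') + cnj (a' + \<i> * b') * (a - \<i> * b))
     = 2 * (cnj (of_real q2 - \<i> * of_real q1) * (a * cnj a + b * cnj b))"
  unfolding a' b' by (simp add: complex_eq_iff algebra_simps)

lemma phase_has_vector_derivative:
  "((\<lambda>x. phase l (- x)) has_vector_derivative (2 * \<i> * of_real l * phase l (- x))) (at x within S)"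
  unfolding phase_def
  by (rule has_vector_derivative_eq_rhs)
     (auto intro!: derivative_eq_intros simp: has_vector_derivative_def fun_eq_iff scaleR_conv_of_real)

lemma AC01_phase: "(\<lambda>x. phase l (- x)) \<in> AC01"
proof (rule AC01_lipschitz)
  fix x y :: real assume xy: "0 \<le> x" "x \<le> y" "y \<le> 1"
  have "norm (phase l (- y) - phase l (- x)) \<le> (2 * \<bar>l\<bar>) * norm (y - x)"
  proof (rule differentiable_bound[where S=UNIV])
    show "((\<lambda>x. phase l (- x)) has_derivative (\<lambda>h. h *\<^sub>R (2 * \<i> * of_real l * phase l (- z)))) (at z within UNIV)" for z
      using phase_has_vector_derivative[of l z UNIV] unfolding has_vector_derivative_def .
    show "onorm (\<lambda>h. h *\<^sub>R (2 * \<i> * of_real l * phase l (- z))) \<le> 2 * \<bar>l\<bar>" for z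
      by (rule onorm_le) (simp add: norm_mult)
  qed auto
  then show "norm (phase l (- y) - phase l (- x)) \<le> (2 * \<bar>l\<bar>) * (y - x)" using xy by simp
qed

lemma AE_leb01_negligible:
  assumes "AE x in leb01. R x"
  obtains N where "negligible N" "\<And>x. x \<in> {0..1} - N \<Longrightarrow> x \<in> {0<..<1} \<and> R x"
proof -
  have "AE x in lebesgue. x \<in> {0<..<1} \<longrightarrow> R x"
    using assms by (subst (asm) AE_restrict_space_iff) auto
  then obtain N where N: "{x. \<not> (x \<in> {0<..<1} \<longrightarrow> R x)} \<subseteq> N" "N \<in> null_sets lebesgue"
    by (auto elim!: AE_E simp: null_sets_def)
  show ?thesis
  proof (rule that[of "N \<union> {0, 1}"])
    show "negligible (N \<union> {0, 1})"
      using N(2) by (intro negligible_Un) (auto simp: negligible_iff_null_sets)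
    fix x :: real assume x: "x \<in> {0..1} - (N \<union> {0, 1})"
    then have "x \<in> {0<..<1}" by (auto simp: less_le)
    then show "x \<in> {0<..<1} \<and> R x" using x N(1) by auto
  qed
qed

lemma matrix_vector_2:
  fixes A :: "complex^2^2" and v :: "complex^2"
  shows "(A *v v) $ i = A $ i $ 1 * v $ 1 + A $ i $ 2 * v $ 2"
  by (simp add: matrix_vector_mult_def UNIV_2)

lemma dirac_expr_components:
  assumes u: "(u has_vector_derivative u') (at x)"
    and eq: "of_real t *s u x = dirac_B *v u' + Qx *v u x"
    and Qx: "Qx = vector [vector [of_real q1, of_real q2], vector [of_real q2, - of_real q1]]"
  shows "((\<lambda>x. u x $ 1) has_vector_derivative (of_real q2 * u x $ 1 - of_real q1 * u x $ 2 - of_real t * u x $ 2)) (at x)"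
    and "((\<lambda>x. u x $ 2) has_vector_derivative (of_real t * u x $ 1 - of_real q1 * u x $ 1 - of_real q2 * u x $ 2)) (at x)"
proof -
  have 1: "of_real t * u x $ 1 = u' $ 2 + (of_real q1 * u x $ 1 + of_real q2 * u x $ 2)"
    using arg_cong[OF eq, of "\<lambda>v. v $ 1"] unfolding Qx
    by (simp add: matrix_vector_2 dirac_B_def)
  have 2: "of_real t * u x $ 2 = - u' $ 1 + (of_real q2 * u x $ 1 - of_real q1 * u x $ 2)"
    using arg_cong[OF eq, of "\<lambda>v. v $ 2"] unfolding Qx
    by (simp add: matrix_vector_2 dirac_B_def)
  have d: "((\<lambda>x. u x $ i) has_vector_derivative u' $ i) (at x)" for i
    by (rule bounded_linear.has_vector_derivative[OF bounded_linear_vec_nth u])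
  show "((\<lambda>x. u x $ 1) has_vector_derivative (of_real q2 * u x $ 1 - of_real q1 * u x $ 2 - of_real t * u x $ 2)) (at x)"
  proof -
    have "of_real q2 * u x $ 1 - of_real q1 * u x $ 2 - of_real t * u x $ 2 = u' $ 1"
      unfolding 2 by simp
    then show ?thesis using d[of 1] by simp
  qed
  show "((\<lambda>x. u x $ 2) has_vector_derivative (of_real t * u x $ 1 - of_real q1 * u x $ 1 - of_real q2 * u x $ 2)) (at x)"
  proof -
    have "of_real t * u x $ 1 - of_real q1 * u x $ 1 - of_real q2 * u x $ 2 = u' $ 2"
      unfolding 1 by simp
    then show ?thesis using d[of 2] by simp
  qed
qed

text \<open>The quantities $P$ and $D$, set to zero outside the unit interval, where the Dirac system says
  nothing about the solution.\<close>

definition solP :: "(real \<Rightarrow> complex^2) \<Rightarrow> real \<Rightarrow> complex" where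
  "solP u x = indicator {0..1} x *\<^sub>R (u x $ 1 * cnj (u x $ 1) + u x $ 2 * cnj (u x $ 2))"

definition solD :: "real \<Rightarrow> (real \<Rightarrow> complex^2) \<Rightarrow> real \<Rightarrow> complex" where
  "solD t u x = indicator {0..1} x *\<^sub>R (phase t (- x) * (cnj (u x $ 1 + \<i> * u x $ 2) * (u x $ 1 - \<i> * u x $ 2)))"

text \<open>Passage from the gauge integral over $[0,x]$ to the Lebesgue integral over the half line
  used in the Picard step.\<close>

lemma integral_eq_on_unit:
  fixes F :: "real \<Rightarrow> complex"
  assumes int: "integrable lborel (\<lambda>t. indicator {..x} t *\<^sub>R F t)" and supp: "\<And>t. t \<le> 0 \<Longrightarrow> F t = 0"
    and hk: "(F has_integral I) {0..x}"
  shows "(\<integral>t. indicator {..x} t *\<^sub>R F t \<partial>lborel) = I"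
proof -
  have "((\<lambda>t. indicator {..x} t *\<^sub>R F t) has_integral (\<integral>t. indicator {..x} t *\<^sub>R F t \<partial>lborel)) UNIV"
    by (rule has_integral_integral_lborel[OF int])
  moreover have "(\<lambda>t. indicator {..x} t *\<^sub>R F t) = (\<lambda>t. if t \<in> {0..x} then F t else 0)"
    using supp by (auto simp: indicator_def fun_eq_iff)
  ultimately have "(F has_integral (\<integral>t. indicator {..x} t *\<^sub>R F t \<partial>lborel)) {0..x}"
    by (simp only: has_integral_restrict_UNIV)
  then show ?thesis using hk by (rule has_integral_unique)
qed

locale dirac = potential q for q +
  fixes Q :: "real \<Rightarrow> complex^2^2" and q\<^sub>1 q\<^sub>2 :: "real \<Rightarrow> real"
  assumes Q_form: "AE x in leb01. Q x = vector [vector [of_real (q\<^sub>1 x), of_real (q\<^sub>2 x)],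
                                      vector [of_real (q\<^sub>2 x), - of_real (q\<^sub>1 x)]]"
    and q_form: "AE x in leb01. of_real (q\<^sub>2 x) - \<i> * of_real (q\<^sub>1 x) = q x"
begin

lemma solution_quadratic:
  assumes ac: "(\<lambda>x. u x $ 1) \<in> AC01" "(\<lambda>x. u x $ 2) \<in> AC01"
    and ode: "dirac_expr Q u (\<lambda>x. of_real t *s u x)" and u20: "u 0 $ 2 = 0"
  shows "solP u \<in> borel_measurable borel" "solD t u \<in> borel_measurable borel"
    and "\<exists>B. (\<forall>x. norm (solP u x) \<le> B) \<and> (\<forall>x. norm (solD t u x) \<le> B)"
    and "\<And>x. x \<in> {0..1} \<Longrightarrow> solP u x = u 0 $ 1 * cnj (u 0 $ 1) + stepP t (solD t u) x"
    and "\<And>x. x \<in> {0..1} \<Longrightarrow> solD t u x = u 0 $ 1 * cnj (u 0 $ 1) + stepD t (solP u) x"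
proof -
  define P where "P = (\<lambda>x. u x $ 1 * cnj (u x $ 1) + u x $ 2 * cnj (u x $ 2))"
  define D where "D = (\<lambda>x. phase t (- x) * (cnj (u x $ 1 + \<i> * u x $ 2) * (u x $ 1 - \<i> * u x $ 2)))"
  have sP: "solP u x = indicator {0..1} x *\<^sub>R P x" and sD: "solD t u x = indicator {0..1} x *\<^sub>R D x" for x
    by (simp_all add: solP_def solD_def P_def D_def)
  have P_ac: "P \<in> AC01" unfolding P_def by (intro AC01_add AC01_mult AC01_cnj ac)
  have D_ac: "D \<in> AC01"
  proof -
    have "(\<lambda>x. u x $ 1 + (- \<i>) * u x $ 2) \<in> AC01" by (intro AC01_add AC01_cmult ac)
    then have m: "(\<lambda>x. u x $ 1 - \<i> * u x $ 2) \<in> AC01" by simp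
    show ?thesis unfolding D_def
      by (intro AC01_mult AC01_phase AC01_cnj[of "\<lambda>x. u x $ 1 + \<i> * u x $ 2"] AC01_add AC01_cmult ac m)
  qed
  have "continuous_on {0..1} P" by (rule AC01_continuous[OF P_ac])
  then have "(\<lambda>x. indicator {0..1} x *\<^sub>R P x) \<in> borel_measurable borel"
    by (intro borel_measurable_continuous_on_indicator) auto
  then show mP [measurable]: "solP u \<in> borel_measurable borel" by (simp add: sP cong: measurable_cong)
  have "continuous_on {0..1} D" by (rule AC01_continuous[OF D_ac])
  then have "(\<lambda>x. indicator {0..1} x *\<^sub>R D x) \<in> borel_measurable borel"
    by (intro borel_measurable_continuous_on_indicator) auto
  then show mD [measurable]: "solD t u \<in> borel_measurable borel" by (simp add: sD cong: measurable_cong)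
  obtain B1 where B1: "0 \<le> B1" "\<And>x. x \<in> {0..1} \<Longrightarrow> norm (P x) \<le> B1" using AC01_bounded[OF P_ac] by blast
  obtain B2 where B2: "0 \<le> B2" "\<And>x. x \<in> {0..1} \<Longrightarrow> norm (D x) \<le> B2" using AC01_bounded[OF D_ac] by blast
  have bP: "norm (solP u x) \<le> B1 + B2" for x
    using B1 B2 by (cases "x \<in> {0..1}") (auto simp: sP add_increasing2)
  have bD: "norm (solD t u x) \<le> B1 + B2" for x
    using B1 B2 by (cases "x \<in> {0..1}") (auto simp: sD add_increasing)
  show "\<exists>B. (\<forall>x. norm (solP u x) \<le> B) \<and> (\<forall>x. norm (solD t u x) \<le> B)" using bP bD by blast
  have "AE x in leb01. (\<exists>u'. (u has_vector_derivative u') (at x) \<and> of_real t *s u x = dirac_B *v u' + Q x *v u x) \<and>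
      Q x = vector [vector [of_real (q\<^sub>1 x), of_real (q\<^sub>2 x)], vector [of_real (q\<^sub>2 x), - of_real (q\<^sub>1 x)]] \<and>
      of_real (q\<^sub>2 x) - \<i> * of_real (q\<^sub>1 x) = q x"
    using ode[unfolded dirac_expr_def] Q_form q_form by eventually_elim blast
  then obtain N where N: "negligible N" and NR: "\<And>x. x \<in> {0..1} - N \<Longrightarrow> x \<in> {0<..<1} \<and>
      (\<exists>u'. (u has_vector_derivative u') (at x) \<and> of_real t *s u x = dirac_B *v u' + Q x *v u x) \<and>
      Q x = vector [vector [of_real (q\<^sub>1 x), of_real (q\<^sub>2 x)], vector [of_real (q\<^sub>2 x), - of_real (q\<^sub>1 x)]] \<and>
      of_real (q\<^sub>2 x) - \<i> * of_real (q\<^sub>1 x) = q x"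
    by (rule AE_leb01_negligible) blast
  let ?G = "\<lambda>x. q x * phase t x * solD t u x"
  have der: "(P has_vector_derivative (?G x + cnj (?G x))) (at x within {0..1})"
    "(D has_vector_derivative (2 * (cnj (q x * phase t x) * solP u x))) (at x within {0..1})"
    if x: "x \<in> {0..1} - N" for x
  proof -
    obtain u' where u': "(u has_vector_derivative u') (at x)" "of_real t *s u x = dirac_B *v u' + Q x *v u x"
      and Qx: "Q x = vector [vector [of_real (q\<^sub>1 x), of_real (q\<^sub>2 x)], vector [of_real (q\<^sub>2 x), - of_real (q\<^sub>1 x)]]"
      and qx: "of_real (q\<^sub>2 x) - \<i> * of_real (q\<^sub>1 x) = q x" and x01: "x \<in> {0<..<1}"
      using NR[OF x] by blast
    define a where "a = u x $ 1"
    define b where "b = u x $ 2"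
    define a' where "a' = of_real (q\<^sub>2 x) * a - of_real (q\<^sub>1 x) * b - of_real t * b"
    define b' where "b' = of_real t * a - of_real (q\<^sub>1 x) * a - of_real (q\<^sub>2 x) * b"
    have da: "((\<lambda>x. u x $ 1) has_vector_derivative a') (at x within {0..1})"
      and db: "((\<lambda>x. u x $ 2) has_vector_derivative b') (at x within {0..1})"
      using dirac_expr_components[OF u' Qx] by (auto simp: a'_def b'_def a_def b_def intro: has_vector_derivative_at_within)
    note ca = has_vector_derivative_cnj[OF da] and cb = has_vector_derivative_cnj[OF db]
    have dP: "(P has_vector_derivative (a * cnj a' + a' * cnj a + (b * cnj b' + b' * cnj b))) (at x within {0..1})"
      unfolding P_def a_def b_def
      by (intro has_vector_derivative_add has_vector_derivative_mult da db ca cb)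
    have i: "((\<lambda>x. c * u x $ 2) has_vector_derivative c * b') (at x within {0..1})" for c
      by (rule has_vector_derivative_mult_right[OF db])
    have dp: "((\<lambda>x. u x $ 1 + \<i> * u x $ 2) has_vector_derivative (a' + \<i> * b')) (at x within {0..1})"
      and dm: "((\<lambda>x. u x $ 1 - \<i> * u x $ 2) has_vector_derivative (a' - \<i> * b')) (at x within {0..1})"
      by (intro has_vector_derivative_add has_vector_derivative_diff da i)+
    have dD: "(D has_vector_derivative (phase t (- x) * (cnj (a + \<i> * b) * (a' - \<i> * b') + cnj (a' + \<i> * b') * (a - \<i> * b))
         + 2 * \<i> * of_real t * phase t (- x) * (cnj (a + \<i> * b) * (a - \<i> * b)))) (at x within {0..1})"
      unfolding D_def a_def b_def
      by (intro has_vector_derivative_mult phase_has_vector_derivative dm has_vector_derivative_cnj dp)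
    have ph: "phase t x * phase t (- x) = 1" by (simp add: phase_add[symmetric]) (simp add: phase_def)
    have Dx: "phase t x * solD t u x = cnj (a + \<i> * b) * (a - \<i> * b)"
      using x01 ph by (simp add: sD D_def a_def b_def mult.assoc[symmetric])
    have Px: "solP u x = a * cnj a + b * cnj b" using x01 by (simp add: sP P_def a_def b_def)
    have "?G x = (of_real (q\<^sub>2 x) - \<i> * of_real (q\<^sub>1 x)) * (cnj (a + \<i> * b) * (a - \<i> * b))"
      unfolding qx mult.assoc Dx ..
    then have "a * cnj a' + a' * cnj a + (b * cnj b' + b' * cnj b) = ?G x + cnj (?G x)"
      using P_derivative_algebra[OF a'_def b'_def] by simp
    then show "(P has_vector_derivative (?G x + cnj (?G x))) (at x within {0..1})" using dP by simp
    have "phase t (- x) * (cnj (a + \<i> * b) * (a' - \<i> * b') + cnj (a' + \<i> * b') * (a - \<i> * b))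
         + 2 * \<i> * of_real t * phase t (- x) * (cnj (a + \<i> * b) * (a - \<i> * b))
       = phase t (- x) * (2 * \<i> * of_real t * (cnj (a + \<i> * b) * (a - \<i> * b))
          + (cnj (a + \<i> * b) * (a' - \<i> * b') + cnj (a' + \<i> * b') * (a - \<i> * b)))"
      by (simp only: distrib_left mult_ac add_ac)
    also have "\<dots> = phase t (- x) * (2 * (cnj (q x) * solP u x))"
      unfolding D_derivative_algebra[OF a'_def b'_def] qx Px ..
    also have "\<dots> = 2 * (cnj (q x * phase t x) * solP u x)"
      by (simp add: cnj_phase)
    finally show "(D has_vector_derivative (2 * (cnj (q x * phase t x) * solP u x))) (at x within {0..1})" using dD by simp
  qed
  fix x :: real assume x: "x \<in> {0..1}"
  have x': "0 \<le> x" "x \<le> 1" using x by auto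
  have q0: "q s = 0" if "s \<le> 0" for s using that by (intro q_supp) simp
  have iG: "integrable lborel (\<lambda>s. indicator {..x} s *\<^sub>R ?G s)"
    using integrable_q_mult[of "\<lambda>s. phase t s * solD t u s" "B1 + B2" x] bD by (simp add: norm_mult mult.assoc)
  have "((\<lambda>s. ?G s + cnj (?G s)) has_integral (P x - P 0)) {0..x}"
    by (rule AC01_fundamental_theorem[OF P_ac N der(1) x'])
  then have "(\<integral>s. indicator {..x} s *\<^sub>R (?G s + cnj (?G s)) \<partial>lborel) = P x - P 0"
  proof (rule integral_eq_on_unit[rotated 2])
    show "integrable lborel (\<lambda>s. indicator {..x} s *\<^sub>R (?G s + cnj (?G s)))"
      using Bochner_Integration.integrable_add[OF iG Bochner_Integration.integrable_cnj[OF iG]] by (simp add: scaleR_add_right)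
  qed (simp add: q0)
  moreover have "(\<integral>s. indicator {..x} s *\<^sub>R (?G s + cnj (?G s)) \<partial>lborel) = stepP t (solD t u) x"
  proof -
    have "(\<integral>s. indicator {..x} s *\<^sub>R (?G s + cnj (?G s)) \<partial>lborel)
       = (\<integral>s. indicator {..x} s *\<^sub>R ?G s + cnj (indicator {..x} s *\<^sub>R ?G s) \<partial>lborel)"
      by (intro Bochner_Integration.integral_cong refl) (simp add: scaleR_add_right)
    also have "\<dots> = (\<integral>s. indicator {..x} s *\<^sub>R ?G s \<partial>lborel) + (\<integral>s. cnj (indicator {..x} s *\<^sub>R ?G s) \<partial>lborel)"
      by (rule Bochner_Integration.integral_add[OF iG Bochner_Integration.integrable_cnj[OF iG]])
    also have "(\<integral>s. cnj (indicator {..x} s *\<^sub>R ?G s) \<partial>lborel) = cnj (\<integral>s. indicator {..x} s *\<^sub>R ?G s \<partial>lborel)"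
      by (rule Bochner_Integration.integral_cnj)
    finally show ?thesis by (simp add: stepP_def)
  qed
  moreover have "P 0 = u 0 $ 1 * cnj (u 0 $ 1)" using u20 by (simp add: P_def)
  ultimately have "P x - u 0 $ 1 * cnj (u 0 $ 1) = stepP t (solD t u) x" by argo
  then show "solP u x = u 0 $ 1 * cnj (u 0 $ 1) + stepP t (solD t u) x"
    using x by (simp add: sP algebra_simps)
  let ?H = "\<lambda>s. 2 * (cnj (q s * phase t s) * solP u s)"
  have iq: "integrable lborel (\<lambda>s. indicator {..x} s *\<^sub>R (q s * (phase t s * solP u s)))"
    by (rule integrable_q_mult[of _ "B1 + B2"]) (use bP in \<open>auto simp: norm_mult\<close>)
  have iH: "integrable lborel (\<lambda>s. indicator {..x} s *\<^sub>R ?H s)"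
    by (rule Bochner_Integration.integrable_bound[OF integrable_mult_right[OF iq, of 2]])
       (auto simp: norm_mult indicator_def)
  have "(?H has_integral (D x - D 0)) {0..x}"
    by (rule AC01_fundamental_theorem[OF D_ac N der(2) x'])
  then have "(\<integral>s. indicator {..x} s *\<^sub>R ?H s \<partial>lborel) = D x - D 0"
    by (rule integral_eq_on_unit[OF iH, rotated]) (simp add: q0)
  moreover have "(\<integral>s. indicator {..x} s *\<^sub>R ?H s \<partial>lborel) = stepD t (solP u) x"
    unfolding stepD_def by (subst integral_mult_right_zero[symmetric]) simp
  moreover have "D 0 = u 0 $ 1 * cnj (u 0 $ 1)" using u20 by (simp add: D_def phase_def mult.commute)
  ultimately have "D x - u 0 $ 1 * cnj (u 0 $ 1) = stepD t (solP u) x" by argo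
  then show "solD t u x = u 0 $ 1 * cnj (u 0 $ 1) + stepD t (solP u) x"
    using x by (simp add: sD algebra_simps)
qed

end

lemma has_vector_derivative_vector_scale:
  fixes u :: "real \<Rightarrow> complex^2"
  assumes "(u has_vector_derivative u') (at x)"
  shows "((\<lambda>x. c *s u x) has_vector_derivative c *s u') (at x)"
proof -
  have "linear (\<lambda>v::complex^2. c *s v)"
    by (rule linearI) (simp_all add: vec_eq_iff algebra_simps)
  then have "bounded_linear (\<lambda>v::complex^2. c *s v)" by (simp only: linear_conv_bounded_linear)
  then show ?thesis using assms by (rule bounded_linear.has_vector_derivative)
qed

lemma solP_eq_norm:
  assumes "x \<in> {0..1}"
  shows "solP u x = of_real ((norm (u x $ 1))\<^sup>2 + (norm (u x $ 2))\<^sup>2)"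
  using assms unfolding of_real_add complex_norm_square solP_def by simp

context dirac
begin

text \<open>Existence of the solution \<open>c\<close> at an eigenvalue comes for free: normalise an
  eigenfunction. Its first component at the origin is nonzero, since otherwise $P$ would solve the homogeneous system
  and vanish.\<close>

lemma eigenvalue_solution:
  assumes "complex_of_real t \<in> eigenvalues_A1 Q"
  shows "is_sol_c Q (of_real t) (sol_c Q (of_real t))"
proof -
  obtain u where u: "u \<in> dom_A1 Q" "\<not> (AE x in leb01. u x = 0)" "dirac_expr Q u (\<lambda>x. of_real t *s u x)"
    using assms by (auto simp: eigenvalues_A1_def)
  have ac: "(\<lambda>x. u x $ 1) \<in> AC01" "(\<lambda>x. u x $ 2) \<in> AC01" and u20: "u 0 $ 2 = 0"
    using u(1) by (auto simp: dom_A1_def)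
  note sq = solution_quadratic[OF ac u(3) u20]
  define c where "c = 1 / u 0 $ 1"
  have u10: "u 0 $ 1 \<noteq> 0"
  proof
    assume z: "u 0 $ 1 = 0"
    obtain B where B: "\<And>x. norm (solP u x) \<le> B" "\<And>x. norm (solD t u x) \<le> B" using sq(3) by blast
    have "u x = 0" if x: "x \<in> {0<..<1}" for x
    proof -
      have "solP u x = 0"
        by (rule homogeneous_unique[OF sq(1,2) B, of t x]) (use sq(4,5) z x in auto)
      then have "complex_of_real ((norm (u x $ 1))\<^sup>2 + (norm (u x $ 2))\<^sup>2) = 0"
        using x solP_eq_norm[of x u] by simp
      then have "(norm (u x $ 1))\<^sup>2 + (norm (u x $ 2))\<^sup>2 = 0" by (simp only: of_real_eq_0_iff)
      then show ?thesis by (simp add: vec_eq_iff forall_2 sum_power2_eq_zero_iff)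
    qed
    then have "AE x in leb01. u x = 0" by (auto simp: AE_restrict_space_iff)
    with u(2) show False by blast
  qed
  have "is_sol_c Q (of_real t) (\<lambda>x. c *s u x)"
    unfolding is_sol_c_def
  proof (intro conjI)
    show "(\<lambda>x. (c *s u x) $ 1) \<in> AC01" "(\<lambda>x. (c *s u x) $ 2) \<in> AC01"
      using AC01_cmult[OF ac(1), of c] AC01_cmult[OF ac(2), of c] by simp_all
    show "(c *s u 0) $ 1 = 1" "(c *s u 0) $ 2 = 0" using u10 u20 by (simp_all add: c_def)
    show "dirac_expr Q (\<lambda>x. c *s u x) (\<lambda>x. of_real t *s (c *s u x))"
      unfolding dirac_expr_def using u(3)[unfolded dirac_expr_def]
    proof eventually_elim
      fix x assume "\<exists>u'. (u has_vector_derivative u') (at x) \<and> of_real t *s u x = dirac_B *v u' + Q x *v u x"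
      then obtain u' where u': "(u has_vector_derivative u') (at x)" "of_real t *s u x = dirac_B *v u' + Q x *v u x" by blast
      have "of_real t *s (c *s u x) = c *s (of_real t *s u x)" by (simp add: vec_eq_iff)
      also have "\<dots> = dirac_B *v (c *s u') + Q x *v (c *s u x)"
        unfolding u'(2) by (simp add: vector_scalar_commute vector_add_ldistrib)
      finally show "\<exists>u'. ((\<lambda>x. c *s u x) has_vector_derivative u') (at x) \<and> of_real t *s (c *s u x) = dirac_B *v u' + Q x *v (c *s u x)"
        using has_vector_derivative_vector_scale[OF u'(1), of c] by blast
    qed
  qed
  then show ?thesis unfolding sol_c_def by (rule someI[of "is_sol_c Q (of_real t)"])
qed

text \<open>Integrate the first equation of the system over the unit interval and interchange the two
  integrations; the weight $1 - s$ is the length of $[s,1]$. Positivity holds because $P$ is continuous with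
  $P(0) = 1$.\<close>

lemma HH_norm_formula:
  assumes sol: "is_sol_c Q (of_real t) u"
  defines "z \<equiv> (\<integral>s. of_real (1 - s) * q s * phase t s * solD t u s \<partial>lborel)"
  shows "complex_of_real ((HH_norm u)\<^sup>2) = 1 + (z + cnj z)" and "0 < (HH_norm u)\<^sup>2"
proof -
  have ac: "(\<lambda>x. u x $ 1) \<in> AC01" "(\<lambda>x. u x $ 2) \<in> AC01" and ode: "dirac_expr Q u (\<lambda>x. of_real t *s u x)"
    and u0: "u 0 $ 1 = 1" "u 0 $ 2 = 0" using sol by (auto simp: is_sol_c_def)
  note sq = solution_quadratic[OF ac ode u0(2)]
  obtain B where B: "\<And>x. norm (solP u x) \<le> B" "\<And>x. norm (solD t u x) \<le> B" using sq(3) by blast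
  have [measurable]: "solP u \<in> borel_measurable borel" "solD t u \<in> borel_measurable borel" by (rule sq)+
  define F where "F = (\<lambda>i x. indicator {0..1} x *\<^sub>R (norm (u x $ i))\<^sup>2)"
  have Fm: "F 1 \<in> borel_measurable borel" "F 2 \<in> borel_measurable borel"
    unfolding F_def by (intro borel_measurable_continuous_on_indicator continuous_intros AC01_continuous ac; simp)+
  note [measurable] = Fm
  have Fint: "integrable lborel (\<lambda>x. indicator {0<..<1} x *\<^sub>R F i x)" if "i = 1 \<or> i = 2" for i
  proof (rule integrableI_bounded_set_indicator[where B=B])
    show "AE x in lborel. x \<in> {0<..<1} \<longrightarrow> norm (F i x) \<le> B"
    proof (intro AE_I2 impI)
      fix x :: real assume x: "x \<in> {0<..<1}"
      have "solP u x = complex_of_real ((norm (u x $ 1))\<^sup>2 + (norm (u x $ 2))\<^sup>2)"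
        using x by (intro solP_eq_norm) auto
      then have "(norm (u x $ 1))\<^sup>2 + (norm (u x $ 2))\<^sup>2 \<le> B"
        using B(1)[of x] by (metis abs_le_D1 norm_of_real)
      moreover have "0 \<le> (norm (u x $ 1))\<^sup>2" "0 \<le> (norm (u x $ 2))\<^sup>2" by auto
      ultimately have "(norm (u x $ 1))\<^sup>2 \<le> B" "(norm (u x $ 2))\<^sup>2 \<le> B" by linarith+
      then show "norm (F i x) \<le> B" using that x by (auto simp: F_def)
    qed
  qed (use that Fm in auto)
  have L: "(LINT x|leb01. (norm (u x $ i))\<^sup>2) = (\<integral>x. indicator {0<..<1} x *\<^sub>R F i x \<partial>lborel)" if "i = 1 \<or> i = 2" for i
  proof -
    have "(LINT x|leb01. (norm (u x $ i))\<^sup>2) = (LINT x|leb01. F i x)"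
      by (intro Bochner_Integration.integral_cong refl) (auto simp: F_def space_restrict_space)
    also have "\<dots> = (\<integral>x. indicator {0<..<1} x *\<^sub>R F i x \<partial>lborel)"
      using that Fm by (intro integral_leb01) auto
    finally show ?thesis .
  qed
  have nn: "0 \<le> (LINT x|leb01. (norm (u x $ i))\<^sup>2)" for i by (rule integral_nonneg_AE) simp
  have H2: "(HH_norm u)\<^sup>2 = (\<integral>x. indicator {0<..<1} x *\<^sub>R (F 1 x + F 2 x) \<partial>lborel)"
  proof -
    have "(HH_norm u)\<^sup>2 = (\<integral>x. indicator {0<..<1} x *\<^sub>R F 1 x \<partial>lborel) + (\<integral>x. indicator {0<..<1} x *\<^sub>R F 2 x \<partial>lborel)"
      unfolding HH_norm_def using nn[of 1] nn[of 2] L by simp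
    then show ?thesis using Fint by (simp add: scaleR_add_right distrib_left)
  qed
  have sF: "indicator {0<..<1} x *\<^sub>R solP u x = complex_of_real (indicator {0<..<1} x *\<^sub>R (F 1 x + F 2 x))" for x
    using solP_eq_norm[of x u] by (cases "x \<in> {0<..<1}") (auto simp: F_def)
  have HP: "complex_of_real ((HH_norm u)\<^sup>2) = (\<integral>x. indicator {0<..<1} x *\<^sub>R solP u x \<partial>lborel)"
    unfolding sF H2 by (rule integral_complex_of_real[symmetric])
  define g where "g = (\<lambda>s. q s * phase t s * solD t u s)"
  have [measurable]: "g \<in> borel_measurable borel" unfolding g_def by measurable
  have gint: "integrable lborel g"
    unfolding g_def
  proof (rule Bochner_Integration.integrable_bound)
    show "integrable lborel (\<lambda>s. B *\<^sub>R q s)" using q_int by simp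
    show "AE s in lborel. norm (q s * phase t s * solD t u s) \<le> norm (B *\<^sub>R q s)"
    proof (rule AE_I2)
      fix s
      have "norm (q s) * norm (solD t u s) \<le> norm (q s) * B" by (intro mult_left_mono B) auto
      moreover have "0 \<le> B" using B(1)[of 0] norm_ge_zero order_trans by blast
      ultimately show "norm (q s * phase t s * solD t u s) \<le> norm (B *\<^sub>R q s)"
        by (simp add: norm_mult mult.commute)
    qed
  qed measurable
  define Z where "Z = (\<lambda>x. \<integral>s. indicator {..x} s *\<^sub>R g s \<partial>lborel)"
  have G2: "integrable (lborel \<Otimes>\<^sub>M lborel) (\<lambda>p. indicator {0<..<1} (fst p) *\<^sub>R (indicator {..fst p} (snd p) *\<^sub>R g (snd p)))"
  proof (subst integrable_lborel_pair_iff)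
    have "(\<integral>\<^sup>+x. \<integral>\<^sup>+s. ennreal (norm (indicator {0<..<1} x *\<^sub>R (indicator {..x} s *\<^sub>R g s))) \<partial>lborel \<partial>lborel)
       \<le> (\<integral>\<^sup>+x. \<integral>\<^sup>+s. indicator {0<..<1::real} x * ennreal (norm (g s)) \<partial>lborel \<partial>lborel)"
      by (intro nn_integral_mono) (auto simp: indicator_def)
    also have "\<dots> = (\<integral>\<^sup>+s. ennreal (norm (g s)) \<partial>lborel)"
      by (simp add: nn_integral_cmult nn_integral_multc)
    also have "\<dots> < \<infinity>" using gint by (simp add: integrable_iff_bounded)
    finally show "(\<integral>\<^sup>+x. \<integral>\<^sup>+y. ennreal (norm (indicator {0<..<1} (fst (x, y)) *\<^sub>R (indicator {..fst (x, y)} (snd (x, y)) *\<^sub>R g (snd (x, y))))) \<partial>lborel \<partial>lborel) < \<infinity>"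
      by simp
  qed measurable
  have Zi: "integrable lborel (\<lambda>x. indicator {0<..<1} x *\<^sub>R Z x)"
    using lborel_pair.integrable_fst[of "\<lambda>x s. indicator {0<..<1} x *\<^sub>R (indicator {..x} s *\<^sub>R g s)"] G2
    by (simp add: Z_def case_prod_unfold del: scaleR_scaleR)
  have Zz: "(\<integral>x. indicator {0<..<1} x *\<^sub>R Z x \<partial>lborel) = z"
  proof -
    have "(\<integral>x. indicator {0<..<1} x *\<^sub>R Z x \<partial>lborel) = (\<integral>x. \<integral>s. indicator {0<..<1} x *\<^sub>R (indicator {..x} s *\<^sub>R g s) \<partial>lborel \<partial>lborel)"
      by (simp add: Z_def del: scaleR_scaleR)
    also have "\<dots> = (\<integral>s. \<integral>x. indicator {0<..<1} x *\<^sub>R (indicator {..x} s *\<^sub>R g s) \<partial>lborel \<partial>lborel)"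
      using lborel_pair.Fubini_integral[of "\<lambda>x s. indicator {0<..<1} x *\<^sub>R (indicator {..x} s *\<^sub>R g s)"] G2
      by (simp add: case_prod_unfold del: scaleR_scaleR)
    also have "\<dots> = z"
      unfolding z_def
    proof (rule Bochner_Integration.integral_cong[OF refl])
      fix s :: real
      show "(\<integral>x. indicator {0<..<1} x *\<^sub>R (indicator {..x} s *\<^sub>R g s) \<partial>lborel) = of_real (1 - s) * q s * phase t s * solD t u s"
      proof (cases "s \<in> {0<..<1}")
        case False
        then show ?thesis by (simp add: g_def q_supp)
      next
        case True
        have "(\<integral>x. indicator {0<..<1} x *\<^sub>R (indicator {..x} s *\<^sub>R g s) \<partial>lborel) = (\<integral>x. indicator {s..<1} x *\<^sub>R g s \<partial>lborel)"
          using True by (intro Bochner_Integration.integral_cong refl) (auto simp: indicator_def)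
        also have "\<dots> = (1 - s) *\<^sub>R g s"
          using True by (subst integral_scaleR_left) (auto intro!: integrable_real_indicator)
        finally show ?thesis by (simp add: g_def scaleR_conv_of_real mult.assoc)
      qed
    qed
    finally show ?thesis .
  qed
  have one: "(\<integral>x. indicator {0<..<1::real} x *\<^sub>R (1::complex) \<partial>lborel) = 1"
    by (subst integral_scaleR_left) (auto intro: integrable_real_indicator)
  have i1: "integrable lborel (\<lambda>x. indicator {0<..<1::real} x *\<^sub>R (1::complex))"
    by (rule integrableI_bounded_set_indicator[where B=1]) auto
  have "(\<integral>x. indicator {0<..<1} x *\<^sub>R solP u x \<partial>lborel)
     = (\<integral>x. indicator {0<..<1} x *\<^sub>R 1 + (indicator {0<..<1} x *\<^sub>R Z x + cnj (indicator {0<..<1} x *\<^sub>R Z x)) \<partial>lborel)"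
  proof (rule Bochner_Integration.integral_cong[OF refl])
    fix x :: real
    show "indicator {0<..<1} x *\<^sub>R solP u x = indicator {0<..<1} x *\<^sub>R 1 + (indicator {0<..<1} x *\<^sub>R Z x + cnj (indicator {0<..<1} x *\<^sub>R Z x))"
      using sq(4)[of x] u0 by (cases "x \<in> {0<..<1}") (auto simp: stepP_def Z_def g_def)
  qed
  also have "\<dots> = 1 + (z + cnj z)"
    using Zi i1 by (simp only: Bochner_Integration.integral_add Bochner_Integration.integrable_add
       Bochner_Integration.integrable_cnj one Zz Bochner_Integration.integral_cnj)
  finally show "complex_of_real ((HH_norm u)\<^sup>2) = 1 + (z + cnj z)" unfolding HP .
  have "continuous_on {0..1} (\<lambda>x. (norm (u x $ 1))\<^sup>2)"
    by (intro continuous_intros AC01_continuous ac)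
  then obtain d where d: "0 < d" "\<And>x. x \<in> {0..1} \<Longrightarrow> dist x 0 < d \<Longrightarrow> dist ((norm (u x $ 1))\<^sup>2) ((norm (u 0 $ 1))\<^sup>2) < 1/2"
    unfolding continuous_on_iff by (metis atLeastAtMost_iff half_gt_zero_iff less_numeral_extra(1) order_refl zero_le_one)
  define e where "e = min d 1"
  have e: "0 < e" "e \<le> 1" "e \<le> d" using d by (auto simp: e_def)
  have "0 < e * (1/2)" using e by simp
  also have "e * (1/2) = (\<integral>x. indicator {0<..<e} x *\<^sub>R (1/2::real) \<partial>lborel)"
    using e by (subst integral_scaleR_left) (auto intro!: integrable_real_indicator)
  also have "\<dots> \<le> (\<integral>x. indicator {0<..<1} x *\<^sub>R (F 1 x + F 2 x) \<partial>lborel)"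
  proof (rule integral_mono)
    show "integrable lborel (\<lambda>x. indicator {0<..<e} x *\<^sub>R (1/2::real))"
      by (rule integrableI_bounded_set_indicator[where B=1]) (use e in auto)
    show "integrable lborel (\<lambda>x. indicator {0<..<1} x *\<^sub>R (F 1 x + F 2 x))"
      using Bochner_Integration.integrable_add[OF Fint[of 1] Fint[of 2]] by (simp add: scaleR_add_right distrib_left)
    fix x :: real
    show "indicator {0<..<e} x *\<^sub>R (1/2::real) \<le> indicator {0<..<1} x *\<^sub>R (F 1 x + F 2 x)"
    proof (cases "x \<in> {0<..<e}")
      case True
      then have "dist ((norm (u x $ 1))\<^sup>2) 1 < 1/2" using d(2)[of x] e u0 by (simp add: dist_real_def)
      then have "1/2 < (norm (u x $ 1))\<^sup>2" unfolding dist_real_def by linarith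
      moreover have "0 \<le> (norm (u x $ 2))\<^sup>2" by simp
      ultimately have "1/2 \<le> (norm (u x $ 1))\<^sup>2 + (norm (u x $ 2))\<^sup>2" by linarith
      then show ?thesis using True e by (simp add: F_def)
    qed (simp add: F_def)
  qed
  finally show "0 < (HH_norm u)\<^sup>2" unfolding H2 .
qed

end

section \<open>Asymptotics of the norming constants\<close>

text \<open>The function $F$ on an abstract measure space and the frequency map $\sigma$ cover both a
  function on the line and a kernel on the plane with $\sigma(t,s) = t + s$. Expand the exponential of
  $-2 i \epsilon_n \sigma$ as a power series. The term of order zero is the unperturbed sequence. All others contain a
  factor $\epsilon_n$, which already lies in the ideal, so for them membership in the algebra is enough; boundedness of
  $\sigma$ makes the series converge there.\<close>

lemma Lp_coeffs_perturbed_frequency: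
  fixes F :: "'a \<Rightarrow> complex" and \<sigma> :: "'a \<Rightarrow> real" and \<epsilon> :: "int \<Rightarrow> real"
  assumes p: "1 \<le> p" and \<epsilon>: "Lp_coeffs p (\<lambda>n. of_real (\<epsilon> n))"
    and F: "integrable M F" and \<sigma>[measurable]: "\<sigma> \<in> borel_measurable M"
    and R: "0 \<le> R" "\<And>x. F x \<noteq> 0 \<Longrightarrow> \<bar>\<sigma> x\<bar> \<le> R"
    and Y0: "Lp_coeffs p (\<lambda>n. \<integral>x. F x * cis (- pi * \<sigma> x) * chr n (\<sigma> x) \<partial>M)"
    and Y: "\<And>j. L1_coeffs (R ^ j * C) (\<lambda>n. \<integral>x. F x * of_real (\<sigma> x) ^ j * cis (- pi * \<sigma> x) * chr n (\<sigma> x) \<partial>M)"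
  shows "Lp_coeffs p (\<lambda>n. \<integral>x. F x * phase (pi * (of_int n + 1/2) + \<epsilon> n) (\<sigma> x) \<partial>M)"
proof -
  define y where "y = (\<lambda>j n. \<integral>x. F x * of_real (\<sigma> x) ^ j * cis (- pi * \<sigma> x) * chr n (\<sigma> x) \<partial>M)"
  obtain E where E: "L1_coeffs E (\<lambda>n. of_real (\<epsilon> n))" using Lp_coeffs_imp_L1_coeffs[OF \<epsilon> p] by blast
  have [measurable]: "F \<in> borel_measurable M" using F by auto
  have cisM [measurable]: "(\<lambda>x. cis (- pi * \<sigma> x)) \<in> borel_measurable M"
    by (rule measurable_compose[OF \<sigma>], rule borel_measurable_continuous_onI) (auto intro!: continuous_intros)
  have chrM [measurable]: "(\<lambda>x. chr n (\<sigma> x)) \<in> borel_measurable M" for n by measurable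
  \<comment> \<open>Coefficients of the power series in the frequency.\<close>
  define c where "c = (\<lambda>j n. (- 2 * \<i> * of_real (\<epsilon> n)) ^ j / fact j)"
  have expand: "(\<integral>x. F x * phase (pi * (of_int n + 1/2) + \<epsilon> n) (\<sigma> x) \<partial>M) = (\<Sum>j. c j n * y j n)"
    and summ: "summable (\<lambda>j. c j n * y j n)" for n
  proof -
    let ?f = "\<lambda>j x. c j n * (F x * of_real (\<sigma> x) ^ j * cis (- pi * \<sigma> x) * chr n (\<sigma> x))"
    have nf: "norm (?f j x) \<le> norm (F x) * ((2 * \<bar>\<epsilon> n\<bar> * R) ^ j / fact j)" for j x
    proof (cases "F x = 0")
      case False
      have "norm (?f j x) = norm (F x) * ((2 * \<bar>\<epsilon> n\<bar> * \<bar>\<sigma> x\<bar>) ^ j / fact j)"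
        by (simp add: c_def norm_mult norm_divide norm_power power_mult_distrib)
      also have "\<dots> \<le> norm (F x) * ((2 * \<bar>\<epsilon> n\<bar> * R) ^ j / fact j)"
        using R(2)[OF False] by (intro mult_left_mono divide_right_mono power_mono) auto
      finally show ?thesis .
    qed simp
    have exps: "summable (\<lambda>j. a ^ j / fact j)" for a :: real
      using summable_exp[of a] by (simp add: divide_inverse mult.commute)
    have fi: "integrable M (?f j)" for j
    proof (rule Bochner_Integration.integrable_bound)
      show "integrable M (\<lambda>x. norm (F x) * ((2 * \<bar>\<epsilon> n\<bar> * R) ^ j / fact j))"
        by (rule integrable_mult_left, rule integrable_norm[OF F])
      show "AE x in M. norm (?f j x) \<le> norm (norm (F x) * ((2 * \<bar>\<epsilon> n\<bar> * R) ^ j / fact j))"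
        using nf by (intro AE_I2) (metis abs_ge_self order_trans real_norm_def)
    qed measurable
    have sn: "summable (\<lambda>j. norm (?f j x))" for x
      by (rule summable_comparison_test[OF _ summable_mult[OF exps]]) (use nf in auto)
    have si: "summable (\<lambda>j. \<integral>x. norm (?f j x) \<partial>M)"
    proof (rule summable_comparison_test[OF _ summable_mult[OF exps]])
      have "(\<integral>x. norm (?f j x) \<partial>M) \<le> (\<integral>x. norm (F x) \<partial>M) * ((2 * \<bar>\<epsilon> n\<bar> * R) ^ j / fact j)" for j
      proof -
        have "(\<integral>x. norm (?f j x) \<partial>M) \<le> (\<integral>x. norm (F x) * ((2 * \<bar>\<epsilon> n\<bar> * R) ^ j / fact j) \<partial>M)"
          by (intro integral_mono integrable_norm fi integrable_mult_left F nf)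
        then show ?thesis by simp
      qed
      then show "\<exists>N. \<forall>j\<ge>N. norm (\<integral>x. norm (?f j x) \<partial>M) \<le> (\<integral>x. norm (F x) \<partial>M) * ((2 * \<bar>\<epsilon> n\<bar> * R) ^ j / fact j)"
        by (intro exI[of _ 0]) (auto simp: integral_nonneg_AE)
    qed
    have AEs: "AE x in M. summable (\<lambda>j. norm (?f j x))" using sn by simp
    have sumf: "(\<Sum>j. ?f j x) = F x * phase (pi * (of_int n + 1/2) + \<epsilon> n) (\<sigma> x)" for x
    proof -
      let ?b = "F x * (cis (- pi * \<sigma> x) * chr n (\<sigma> x))"
      let ?z = "- 2 * \<i> * of_real (\<epsilon> n) * of_real (\<sigma> x) :: complex"
      have "?z ^ j = (- 2 * \<i> * of_real (\<epsilon> n)) ^ j * of_real (\<sigma> x) ^ j" for j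
        by (rule power_mult_distrib)
      then have "?f j x = ?b * (?z ^ j /\<^sub>R fact j)" for j
        unfolding c_def by (simp only: scaleR_conv_of_real divide_inverse of_real_inverse of_real_fact mult_ac)
      then have "(\<Sum>j. ?f j x) = ?b * exp ?z"
        using suminf_mult[OF sums_summable[OF exp_converges[of ?z]], of ?b] sums_unique[OF exp_converges[of ?z]] by simp
      also have "exp ?z = cis (- (2 * \<epsilon> n * \<sigma> x))" by (simp add: cis_conv_exp mult_ac)
      also have "?b * \<dots> = F x * phase (pi * (of_int n + 1/2) + \<epsilon> n) (\<sigma> x)"
        by (simp add: chr_def phase_def cis_mult mult.assoc algebra_simps)
      finally show ?thesis .
    qed
    have iy: "integral\<^sup>L M (?f j) = c j n * y j n" for j
      unfolding y_def by (rule integral_mult_right_zero)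
    have "(\<integral>x. (\<Sum>j. ?f j x) \<partial>M) = (\<Sum>j. integral\<^sup>L M (?f j))"
      by (rule integral_suminf[OF fi AEs si])
    then show "(\<integral>x. F x * phase (pi * (of_int n + 1/2) + \<epsilon> n) (\<sigma> x) \<partial>M) = (\<Sum>j. c j n * y j n)"
      unfolding sumf iy .
    have "summable (\<lambda>j. norm (integral\<^sup>L M (?f j)))"
      by (rule summable_comparison_test[OF _ si], intro exI[of _ 0] allI impI, simp only: real_norm_def abs_norm_cancel)
         (rule integral_norm_bound)
    then show "summable (\<lambda>j. c j n * y j n)" unfolding iy by (rule summable_norm_cancel)
  qed
  \<comment> \<open>The terms of positive order after division by $\epsilon_n$.\<close>
  define b where "b = (\<lambda>j n. (- 2 * \<i>) ^ Suc j / fact (Suc j) * (of_real (\<epsilon> n) ^ j * y (Suc j) n))"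
  have C0: "0 \<le> C" using order_trans[OF norm_ge_zero L1_coeffs_bound[OF Y[of 0], of 0]] by simp
  have E0: "0 \<le> E" by (rule order_trans[OF norm_ge_zero L1_coeffs_bound[OF E, of 0]])
  have bA: "L1_coeffs (2 ^ Suc j / fact (Suc j) * (E ^ j * (R ^ Suc j * C))) (b j)" for j
  proof -
    have "L1_coeffs (E ^ j * (R ^ Suc j * C)) (\<lambda>n. of_real (\<epsilon> n) ^ j * y (Suc j) n)"
    proof (cases j)
      case 0
      then show ?thesis using Y[of 1] by (simp add: y_def)
    next
      case (Suc i)
      show ?thesis unfolding Suc y_def by (intro L1_coeffs_mult L1_coeffs_power[OF E] Y)
    qed
    from L1_coeffs_cmult[OF this, of "(- 2 * \<i>) ^ Suc j / fact (Suc j)"] show ?thesis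
      unfolding b_def by (simp add: norm_divide norm_mult norm_power del: fact_Suc power_Suc)
  qed
  have bs: "summable (\<lambda>j. 2 ^ Suc j / fact (Suc j) * (E ^ j * (R ^ Suc j * C)))"
  proof (rule summable_comparison_test)
    show "summable (\<lambda>j. (2 * R * C) * ((2 * E * R) ^ j / fact j))"
      using summable_mult[OF summable_exp[of "2 * E * R"], of "2 * R * C"] by (simp add: divide_inverse mult_ac)
    show "\<exists>N. \<forall>j\<ge>N. norm (2 ^ Suc j / fact (Suc j) * (E ^ j * (R ^ Suc j * C))) \<le> (2 * R * C) * ((2 * E * R) ^ j / fact j)"
    proof (intro exI[of _ 0] allI impI)
      fix j
      have "norm (2 ^ Suc j / fact (Suc j) * (E ^ j * (R ^ Suc j * C))) = ((2 * R * C) * (2 * E * R) ^ j) / fact (Suc j)"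
        using C0 E0 R(1) by (simp add: abs_mult power_mult_distrib mult_ac del: fact_Suc)
      also have "\<dots> \<le> ((2 * R * C) * (2 * E * R) ^ j) / fact j"
        using C0 E0 R(1) by (intro divide_left_mono) (auto intro: fact_mono)
      finally show "norm (2 ^ Suc j / fact (Suc j) * (E ^ j * (R ^ Suc j * C))) \<le> (2 * R * C) * ((2 * E * R) ^ j / fact j)"
        by simp
    qed
  qed
  note S = L1_coeffs_suminf[OF bA bs]
  have "(\<integral>x. F x * phase (pi * (of_int n + 1/2) + \<epsilon> n) (\<sigma> x) \<partial>M) = y 0 n + of_real (\<epsilon> n) * (\<Sum>j. b j n)" for n
  proof -
    have "(\<Sum>j. c j n * y j n) = c 0 n * y 0 n + (\<Sum>j. c (Suc j) n * y (Suc j) n)"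
      using suminf_split_head[OF summ[of n]] by simp
    also have "(\<Sum>j. c (Suc j) n * y (Suc j) n) = (\<Sum>j. of_real (\<epsilon> n) * b j n)"
    proof (rule suminf_cong)
      fix j
      have "c (Suc j) n = (- 2 * \<i>) ^ Suc j * of_real (\<epsilon> n) ^ Suc j / fact (Suc j)"
        unfolding c_def power_mult_distrib[of "- 2 * \<i>"] ..
      then show "c (Suc j) n * y (Suc j) n = of_real (\<epsilon> n) * b j n"
        by (simp add: b_def mult_ac del: fact_Suc)
    qed
    also have "\<dots> = of_real (\<epsilon> n) * (\<Sum>j. b j n)" by (rule suminf_mult[OF S(2)])
    finally show ?thesis unfolding expand by (simp add: c_def)
  qed
  then show ?thesis
    using Lp_coeffs_add[OF p Y0 Lp_coeffs_mult[OF p \<epsilon> S(1)]] by (simp add: y_def)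
qed

lemma Lp_coeffs_line:
  assumes p: "1 \<le> p" and \<epsilon>: "Lp_coeffs p (\<lambda>n. of_real (\<epsilon> n))"
    and f[measurable]: "f \<in> borel_measurable borel" and supp: "\<And>x. x \<notin> {0<..<1} \<Longrightarrow> f x = 0"
    and fp: "integrable lborel (\<lambda>x. norm (f x) powr p)"
  shows "Lp_coeffs p (\<lambda>n. \<integral>x. f x * phase (pi * (of_int n + 1/2) + \<epsilon> n) x \<partial>lborel)"
proof (rule Lp_coeffs_perturbed_frequency[OF p \<epsilon>, where R=1 and C="\<integral>x. norm (f x) \<partial>lborel"])
  show fi: "integrable lborel f" by (rule integrable_of_powr[OF f supp p fp])
  show "\<bar>x\<bar> \<le> 1" if "f x \<noteq> 0" for x using that supp[of x] by (cases "x \<in> {0<..<1}") auto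
  show "Lp_coeffs p (\<lambda>n. \<integral>x. f x * cis (- pi * x) * chr n x \<partial>lborel)"
    unfolding Lp_coeffs_iff[OF p]
  proof (intro exI[of _ "\<lambda>x. f x * cis (- pi * x)"] conjI allI impI)
    show "integrable lborel (\<lambda>x. norm (f x * cis (- pi * x)) powr p)" using fp by (simp add: norm_mult)
    show "integrable lborel (\<lambda>x. f x * cis (- pi * x))"
      by (rule Bochner_Integration.integrable_bound[OF fi]) (auto simp: norm_mult)
  qed (auto simp: supp mult.commute)
  show "L1_coeffs (1 ^ j * (\<integral>x. norm (f x) \<partial>lborel)) (\<lambda>n. \<integral>x. f x * of_real x ^ j * cis (- pi * x) * chr n x \<partial>lborel)" for j
    unfolding L1_coeffs_def
  proof (intro exI[of _ "\<lambda>x. f x * of_real x ^ j * cis (- pi * x)"] conjI allI impI)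
    have le: "norm (f x * of_real x ^ j * cis (- pi * x)) \<le> norm (f x)" for x
    proof (cases "x \<in> {0<..<1}")
      case True
      then have "norm (f x) * \<bar>x\<bar> ^ j \<le> norm (f x) * 1" by (intro mult_left_mono power_le_one) auto
      then show ?thesis by (simp add: norm_mult norm_power)
    qed (simp add: supp)
    show i: "integrable lborel (\<lambda>x. f x * of_real x ^ j * cis (- pi * x))"
      by (rule Bochner_Integration.integrable_bound[OF fi]) (use le in auto)
    show "(\<integral>x. norm (f x * of_real x ^ j * cis (- pi * x)) \<partial>lborel) \<le> 1 ^ j * (\<integral>x. norm (f x) \<partial>lborel)"
      using fi i le by (simp only: power_one mult_1_left) (intro integral_mono integrable_norm; simp)
  qed (auto simp: supp mult.commute)
qed auto

text \<open>The bound by a product $g(t) h(s)$ yields the $L_p$ statement for the zeroth power of the frequency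
  $t + s$; for the other powers, the bounded support of $F$ in the direction of $t + s$ yields the geometric growth of
  the $L_1$ norms.\<close>

lemma Lp_coeffs_plane:
  assumes p: "1 \<le> p" and \<epsilon>: "Lp_coeffs p (\<lambda>n. of_real (\<epsilon> n))"
    and F[measurable]: "F \<in> borel_measurable (borel \<Otimes>\<^sub>M borel)"
    and [measurable]: "g \<in> borel_measurable borel" "h \<in> borel_measurable borel"
    and g0: "\<And>s. 0 \<le> g s" and h0: "\<And>s. 0 \<le> h s" and h: "integrable lborel h"
    and g: "integrable lborel (\<lambda>t. g t powr p)" and supp: "\<And>t. t \<notin> {0<..<1} \<Longrightarrow> g t = 0"
    and bd: "\<And>t s. norm (F (t, s)) \<le> g t * h s"
    and R: "0 \<le> R" "\<And>t s. R < \<bar>t + s\<bar> \<Longrightarrow> F (t, s) = 0"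
  shows "Lp_coeffs p (\<lambda>n. \<integral>x. F x * phase (pi * (of_int n + 1/2) + \<epsilon> n) (fst x + snd x) \<partial>(lborel \<Otimes>\<^sub>M lborel))"
proof -
  let ?M = "lborel \<Otimes>\<^sub>M (lborel :: real measure)"
  note fol = Lp_coeffs_folded[where g=g and h=h, OF _ _ _ p g0 h0 h g supp]
  have Fi: "integrable ?M F" by (rule fol(1)[of F]) (use bd in auto)
  show ?thesis
  proof (rule Lp_coeffs_perturbed_frequency[OF p \<epsilon> Fi _ R(1), where C="\<integral>x. norm (F x) \<partial>?M"])
    show "\<bar>fst x + snd x\<bar> \<le> R" if "F x \<noteq> 0" for x
      using that R(2)[of "fst x" "snd x"] by (cases "R < \<bar>fst x + snd x\<bar>") auto
    show "Lp_coeffs p (\<lambda>n. \<integral>x. F x * cis (- pi * (fst x + snd x)) * chr n (fst x + snd x) \<partial>?M)"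
      by (rule fol(2)[of "\<lambda>x. F x * cis (- pi * (fst x + snd x))"]) (use bd in \<open>auto simp: norm_mult\<close>)
    show "L1_coeffs (R ^ j * (\<integral>x. norm (F x) \<partial>?M))
        (\<lambda>n. \<integral>x. F x * of_real (fst x + snd x) ^ j * cis (- pi * (fst x + snd x)) * chr n (fst x + snd x) \<partial>?M)" for j
    proof -
      let ?G = "\<lambda>x. F x * of_real (fst x + snd x) ^ j * cis (- pi * (fst x + snd x))"
      have le: "norm (?G x) \<le> R ^ j * norm (F x)" for x
      proof (cases "F x = 0")
        case False
        then have "\<bar>fst x + snd x\<bar> \<le> R" using R(2)[of "fst x" "snd x"] by force
        then have "norm (F x) * \<bar>fst x + snd x\<bar> ^ j \<le> norm (F x) * R ^ j" by (intro mult_left_mono power_mono) auto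
        moreover have "norm (?G x) = norm (F x) * \<bar>fst x + snd x\<bar> ^ j"
          unfolding norm_mult norm_power norm_of_real norm_cis by simp
        ultimately show ?thesis by (simp add: mult.commute)
      qed simp
      have i: "integrable ?M ?G"
        by (rule Bochner_Integration.integrable_bound[OF integrable_mult_right[OF integrable_norm[OF Fi], of "R ^ j"]])
           (use le R(1) in \<open>auto simp: abs_mult\<close>)
      have "L1_coeffs (\<integral>x. norm (?G x) \<partial>?M) (\<lambda>n. \<integral>x. ?G x * chr n (fst x + snd x) \<partial>?M)"
      proof (rule L1_coeffs_folded)
        show "?G \<in> borel_measurable (borel \<Otimes>\<^sub>M borel)" by measurable
        fix t s :: real assume "t \<notin> {0<..<1}"
        then have "F (t, s) = 0" using bd[of t s] supp[of t] by simp
        then show "?G (t, s) = 0" by simp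
      qed (rule i)
      moreover have "(\<integral>x. norm (?G x) \<partial>?M) \<le> (\<integral>x. R ^ j * norm (F x) \<partial>?M)"
        by (rule integral_mono[OF integrable_norm[OF i] integrable_mult_right[OF integrable_norm[OF Fi]] le])
      moreover have "(\<integral>x. R ^ j * norm (F x) \<partial>?M) = R ^ j * (\<integral>x. norm (F x) \<partial>?M)"
        by (rule integral_mult_right_zero)
      ultimately show ?thesis by (simp only: L1_coeffs_mono)
    qed
  qed measurable
qed

theorem theorem3p3:
  fixes p :: real
    and Q :: "real \<Rightarrow> complex^2^2"
    and q\<^sub>1 q\<^sub>2 :: "real \<Rightarrow> real"
    and lam :: "int \<Rightarrow> real"
  assumes "1 \<le> p"
    and "Q \<in> Lp_M2 p"
    and "q\<^sub>1 \<in> Lp p" and "q\<^sub>2 \<in> Lp p"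
    and "AE x in leb01. Q x = vector [vector [of_real (q\<^sub>1 x), of_real (q\<^sub>2 x)],
                                      vector [of_real (q\<^sub>2 x), - of_real (q\<^sub>1 x)]]"
    and "eigenvalue_enum p Q lam"
  shows "\<exists>g \<in> (Lp p :: (real \<Rightarrow> complex) set).
           \<forall>n. complex_of_real (norming_constant Q (lam n)) = 1 + fourier_coeff n g"
proof -
  note p = assms(1)
  obtain q where q: "q \<in> borel_measurable borel" "\<And>x. x \<notin> {0<..<1} \<Longrightarrow> q x = 0"
    "integrable lborel (\<lambda>x. norm (q x) powr p)" "integrable lborel q"
    "AE x in leb01. complex_of_real (q\<^sub>2 x) - \<i> * of_real (q\<^sub>1 x) = q x"
    using Lp_representative[OF Lp_complex_combination[OF assms(1,3,4)] p] by blast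
  interpret dirac q Q q\<^sub>1 q\<^sub>2
    by unfold_locales (use q assms(5) in auto)
  define \<epsilon> where "\<epsilon> = (\<lambda>n. lam n - pi * (of_int n + 1/2))"
  have lam: "lam n = pi * (of_int n + 1/2) + \<epsilon> n" for n by (simp add: \<epsilon>_def)
  obtain g1 where g1: "g1 \<in> Lp p" "\<And>n. complex_of_real (lam n) = of_real (pi * (of_int n + 1/2)) + fourier_coeff n g1"
    and rng: "range (\<lambda>n. complex_of_real (lam n)) = eigenvalues_A1 Q"
    using assms(6) by (auto simp: eigenvalue_enum_def)
  have "complex_of_real (\<epsilon> n) = fourier_coeff n g1" for n
    using g1(2)[of n] unfolding \<epsilon>_def of_real_diff by simp
  then have \<epsilon>: "Lp_coeffs p (\<lambda>n. complex_of_real (\<epsilon> n))" unfolding Lp_coeffs_def using g1(1) by auto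
  obtain d h where d [measurable]: "d \<in> borel_measurable (borel \<Otimes>\<^sub>M borel)" and hm [measurable]: "h \<in> borel_measurable borel"
    and h0: "\<And>s. 0 \<le> h s" and hi: "integrable lborel h" and dh: "\<And>t s. norm (d (t, s)) \<le> h s"
    and dsupp: "\<And>t s. 2 < \<bar>s\<bar> \<Longrightarrow> d (t, s) = 0"
    and dker: "\<And>l P D B x. \<lbrakk>P \<in> borel_measurable borel; D \<in> borel_measurable borel;
       \<And>t. norm (P t) \<le> B; \<And>t. norm (D t) \<le> B;
       \<And>x. x \<in> {0..1} \<Longrightarrow> P x = 1 + stepP l D x;
       \<And>x. x \<in> {0..1} \<Longrightarrow> D x = 1 + stepD l P x; x \<in> {0..1}\<rbrakk>
      \<Longrightarrow> D x = 1 + (\<integral>s. d (x, s) * phase l s \<partial>lborel)"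
    by (rule solution_kernel) blast
  define f where "f = (\<lambda>s. complex_of_real (1 - s) * q s)"
  define F where "F = (\<lambda>x. f (fst x) * d x)"
  have [measurable]: "f \<in> borel_measurable borel" unfolding f_def by measurable
  have Fm [measurable]: "F \<in> borel_measurable (borel \<Otimes>\<^sub>M borel)" unfolding F_def by measurable
  have fq: "norm (f s) \<le> norm (q s)" for s
  proof (cases "s \<in> {0<..<1}")
    case True
    then have "\<bar>1 - s\<bar> * norm (q s) \<le> 1 * norm (q s)" by (intro mult_right_mono) auto
    then show ?thesis unfolding f_def norm_mult norm_of_real by simp
  qed (simp add: f_def q(2))
  have fsupp: "f s = 0" if "s \<notin> {0<..<1}" for s using that by (simp add: f_def q(2))
  have fp: "integrable lborel (\<lambda>x. norm (f x) powr p)"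
    by (rule Bochner_Integration.integrable_bound[OF q(3)]) (use fq p in \<open>auto intro!: powr_mono2\<close>)
  have fi: "integrable lborel f" by (rule Bochner_Integration.integrable_bound[OF q(4)]) (use fq in auto)
  have Fb: "norm (F (t, s)) \<le> norm (q t) * h s" for t s
    unfolding F_def norm_mult fst_conv by (intro mult_mono fq dh) auto
  have Fi: "integrable (lborel \<Otimes>\<^sub>M lborel) F"
    by (rule Lp_coeffs_folded(1)[where g="\<lambda>t. norm (q t)" and h=h and p=p]) (use p h0 hi q Fb in auto)
  define u where "u = (\<lambda>n. sol_c Q (of_real (lam n)))"
  define z where "z = (\<lambda>n. \<integral>s. of_real (1 - s) * q s * phase (lam n) s * solD (lam n) (u n) s \<partial>lborel)"
  have sol: "is_sol_c Q (of_real (lam n)) (u n)" for n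
    unfolding u_def by (rule eigenvalue_solution) (use rng in blast)
  have zeq: "z n = (\<integral>x. f x * phase (lam n) x \<partial>lborel)
      + (\<integral>x. F x * phase (lam n) (fst x + snd x) \<partial>(lborel \<Otimes>\<^sub>M lborel))" for n
  proof -
    have s: "(\<lambda>x. u n x $ 1) \<in> AC01" "(\<lambda>x. u n x $ 2) \<in> AC01"
      "dirac_expr Q (u n) (\<lambda>x. of_real (lam n) *s u n x)" "u n 0 $ 2 = 0" and u1: "u n 0 $ 1 = 1"
      using sol[of n] by (auto simp: is_sol_c_def)
    note sq = solution_quadratic[OF s]
    obtain B where B: "\<And>x. norm (solP (u n) x) \<le> B" "\<And>x. norm (solD (lam n) (u n) x) \<le> B" using sq(3) by blast
    have D: "solD (lam n) (u n) x = 1 + (\<integral>s. d (x, s) * phase (lam n) s \<partial>lborel)" if "x \<in> {0..1}" for x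
      by (rule dker[OF sq(1,2) B]) (use sq(4,5) u1 that in auto)
    have FEi: "integrable (lborel \<Otimes>\<^sub>M lborel) (\<lambda>x. F x * phase (lam n) (fst x + snd x))"
      by (rule Bochner_Integration.integrable_bound[OF Fi]) (auto simp: norm_mult)
    have "z n = (\<integral>t. f t * phase (lam n) t + (\<integral>s. F (t, s) * phase (lam n) (t + s) \<partial>lborel) \<partial>lborel)"
      unfolding z_def
    proof (rule Bochner_Integration.integral_cong[OF refl])
      fix t
      show "of_real (1 - t) * q t * phase (lam n) t * solD (lam n) (u n) t
         = f t * phase (lam n) t + (\<integral>s. F (t, s) * phase (lam n) (t + s) \<partial>lborel)"
      proof (cases "t \<in> {0<..<1}")
        case True
        have "(\<integral>s. F (t, s) * phase (lam n) (t + s) \<partial>lborel) = (\<integral>s. (f t * phase (lam n) t) * (d (t, s) * phase (lam n) s) \<partial>lborel)"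
          by (intro Bochner_Integration.integral_cong refl) (simp add: F_def phase_add mult_ac)
        also have "\<dots> = (f t * phase (lam n) t) * (\<integral>s. d (t, s) * phase (lam n) s \<partial>lborel)"
          by (rule integral_mult_right_zero)
        finally show ?thesis using D[of t] True unfolding f_def by (simp add: distrib_left)
      qed (simp add: fsupp F_def q(2))
    qed
    also have "\<dots> = (\<integral>t. f t * phase (lam n) t \<partial>lborel) + (\<integral>t. \<integral>s. F (t, s) * phase (lam n) (t + s) \<partial>lborel \<partial>lborel)"
    proof (rule Bochner_Integration.integral_add)
      show "integrable lborel (\<lambda>t. f t * phase (lam n) t)"
        by (rule Bochner_Integration.integrable_bound[OF fi]) (auto simp: norm_mult)
      show "integrable lborel (\<lambda>t. \<integral>s. F (t, s) * phase (lam n) (t + s) \<partial>lborel)"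
        using lborel_pair.integrable_fst[of "\<lambda>t s. F (t, s) * phase (lam n) (t + s)"] FEi by (simp add: case_prod_unfold)
    qed
    also have "(\<integral>t. \<integral>s. F (t, s) * phase (lam n) (t + s) \<partial>lborel \<partial>lborel) = (\<integral>x. F x * phase (lam n) (fst x + snd x) \<partial>(lborel \<Otimes>\<^sub>M lborel))"
      using lborel_pair.integral_fst[of "\<lambda>t s. F (t, s) * phase (lam n) (t + s)"] FEi by (simp add: case_prod_unfold)
    finally show ?thesis .
  qed
  \<comment> \<open>Here $t$ contributes at most $1$ to the frequency and the support of $d$ at most $2$.\<close>
  have F3: "F (t, s) = 0" if "3 < \<bar>t + s\<bar>" for t s
  proof (cases "t \<in> {0<..<1}")
    case True
    then have "2 < \<bar>s\<bar>" using that by auto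
    then show ?thesis by (simp add: F_def dsupp)
  qed (simp add: F_def fsupp)
  have "Lp_coeffs p z"
    unfolding zeq lam
    by (intro Lp_coeffs_add[OF p] Lp_coeffs_line[OF p \<epsilon> _ fsupp fp] Lp_coeffs_plane[OF p \<epsilon> Fm _ hm _ h0 hi _ _ Fb _ F3])
       (use q in auto)
  then have a: "Lp_coeffs p (\<lambda>n. z n + cnj (z n))" by (intro Lp_coeffs_add[OF p] Lp_coeffs_cnj[OF p])
  have N: "complex_of_real ((HH_norm (u n))\<^sup>2) = 1 + (z n + cnj (z n))" and Npos: "0 < (HH_norm (u n))\<^sup>2" for n
    using HH_norm_formula[OF sol[of n]] by (simp_all add: z_def)
  have nz: "1 + (z n + cnj (z n)) \<noteq> 0" for n
    using Npos[of n] unfolding N[symmetric] by simp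
  obtain C where C: "L1_coeffs C (\<lambda>n. z n + cnj (z n))" using Lp_coeffs_imp_L1_coeffs[OF a p] by blast
  obtain E s where s: "L1_coeffs E s" "\<And>n. 1 / (1 + (z n + cnj (z n))) = 1 + s n"
    using wiener_lemma[OF C nz] by blast
  \<comment> \<open>With $a_n = 2\,\mathrm{Re}\, z_n$ this is the sequence $-a_n(1 + s_n) = \alpha_n - 1$.\<close>
  have "Lp_coeffs p (\<lambda>n. (-1) * (z n + cnj (z n)) + (-1) * ((z n + cnj (z n)) * s n))"
    by (intro Lp_coeffs_add[OF p] Lp_coeffs_cmult[OF p] Lp_coeffs_mult[OF p _ s(1)] a)
  then obtain g where g: "g \<in> Lp p" "\<And>n. (-1) * (z n + cnj (z n)) + (-1) * ((z n + cnj (z n)) * s n) = fourier_coeff n g"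
    by (auto simp: Lp_coeffs_def)
  have "complex_of_real (norming_constant Q (lam n)) = 1 + fourier_coeff n g" for n
  proof -
    let ?a = "z n + cnj (z n)"
    have "norming_constant Q (lam n) = 1 / (HH_norm (u n))\<^sup>2"
      by (simp add: norming_constant_def u_def power_int_minus divide_inverse)
    then have "complex_of_real (norming_constant Q (lam n)) = 1 / (1 + ?a)"
      by (simp only: of_real_divide of_real_1 N)
    moreover have "1 / (1 + ?a) = 1 + ((-1) * ?a + (-1) * (?a * s n))"
    proof -
      have r: "(1 + ?a) * (1 + s n) = 1" using nz[of n] unfolding s(2)[symmetric] by simp
      have "1 + s n = (1 + ?a) * (1 + s n) - ?a * (1 + s n)" by (simp add: algebra_simps)
      then show ?thesis unfolding s(2) r by (simp add: algebra_simps)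
    qed
    ultimately show ?thesis unfolding g(2) by simp
  qed
  with g(1) show ?thesis by blast
qed

end
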